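(* Let $(A_n,\rho_{n+1,n})_n$ be a $C^*$-encoding system with limit $L=\overline{\bigcup_n\rho_n(A_n)}\subset A_\infty$. Then there exists an associative bilinear map $\bullet\colon L\times L\to L$, given on $\bigcup_n\rho_n(A_n)$ by $$\rho_k(x)\bullet\rho_k(y)=\lim_n\rho_n(\rho_{n,k}(x)\rho_{n,k}(y))$$ for each $k\ge0$ and $x,y\in A_k$, so that when equipped with this product, $L$ is a $C^*$-algebra with the same involution and norm inherited as a subspace of $A_\infty$.
   Context: A map is c.p.c. if it is completely positive and contractive. For a sequence $(A_n)_{n\ge 0}$ of $C^*$-algebras, $\prod_n A_n$ denotes the $C^*$-algebra of norm bounded sequences, $\bigoplus_n A_n$ its ideal of sequences converging to $0$ in norm, $A_\infty=\prod_n A_n/\bigoplus_n A_n$, and $[(a_n)_n]$ the class of $(a_n)_n$. A c.p.c. system $(A_n,\rho_{n+1,n})_n$ consists of $C^*$-algebras $(A_n)_{n\ge0}$ and c.p.c. maps $\rho_{n+1,n}\colon A_n\to A_{n+1}$. For $m>n$ set $\rho_{m,n}=\rho_{m,m-1}\circ\cdots\circ\rho_{n+1,n}$ and $\rho_{n,n}=\mathrm{id}_{A_n}$. Define $\rho_n\colon A_n\to A_\infty$ by $\rho_n(x)=[(\rho_{m,n}(x))_{m>n}]$. The limit of the system is the closed self-adjoint subspace $L=\overline{\bigcup_n\rho_n(A_n)}\subset A_\infty$. A c.p.c. system is $C^*$-encoding if for any $k\ge0$, $x,y\in A_k$ and $\varepsilon>0$ there is $M>k$ such that for all $m>n,j>M$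 (that is, $n,j>M$ and $m>\max\{n,j\}$), $$\|\rho_{m,n}(\rho_{n,k}(x)\rho_{n,k}(y))-\rho_{m,j}(\rho_{j,k}(x)\rho_{j,k}(y))\|<\varepsilon .$$ *)

theory Defs
  imports "HOL-Analysis.Analysis" "HOL-Algebra.Algebraic_Closure_Type" "HOL-Algebra.QuotRing"
begin

section \<open>\<open>C\<^sup>*\<close>-algebras\<close>

text \<open>
  The algebras of a system have different underlying spaces, so \<open>C\<^sup>*\<close>-algebras are
  records with an explicit carrier. The type of records for complex algebras is the one of
  \<^theory>\<open>HOL-Algebra.Module\<close>. \<open>C\<^sup>*\<close>-algebras need not be unital, and no
  condition is imposed on the field \<^const>\<open>one\<close>, which plays no role.
\<close>

record 'a cstar = "(complex, 'a) module" +
  star :: "'a \<Rightarrow> 'a"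
  nrm :: "'a \<Rightarrow> real"

text \<open>Cut off outside the carrier because \<^locale>\<open>Metric_space\<close> requires
  nonnegativity and symmetry on the whole type.\<close>

definition norm_dist :: "'a cstar \<Rightarrow> 'a \<Rightarrow> 'a \<Rightarrow> real" where
  "norm_dist A x y =
     (if x \<in> carrier A \<and> y \<in> carrier A then nrm A (x \<ominus>\<^bsub>A\<^esub> y) else 0)"

definition norm_topology :: "'a cstar \<Rightarrow> 'a topology" where
  "norm_topology A = Metric_space.mtopology (carrier A) (norm_dist A)"

locale cstar_algebra = Module.module "ring_of_type_algebra :: complex ring" A
  for A :: "'a cstar" (structure) +
  assumes mult_closed: "\<lbrakk>x \<in> carrier A; y \<in> carrier A\<rbrakk> \<Longrightarrow> x \<otimes> y \<in> carrier A"
    and mult_assoc: "\<lbrakk>x \<in> carrier A; y \<in> carrier A; z \<in> carrier A\<rbrakk>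
      \<Longrightarrow> (x \<otimes> y) \<otimes> z = x \<otimes> (y \<otimes> z)"
    and mult_add_left: "\<lbrakk>x \<in> carrier A; y \<in> carrier A; z \<in> carrier A\<rbrakk>
      \<Longrightarrow> (x \<oplus> y) \<otimes> z = (x \<otimes> z) \<oplus> (y \<otimes> z)"
    and mult_add_right: "\<lbrakk>x \<in> carrier A; y \<in> carrier A; z \<in> carrier A\<rbrakk>
      \<Longrightarrow> x \<otimes> (y \<oplus> z) = (x \<otimes> y) \<oplus> (x \<otimes> z)"
    and mult_smult_left: "\<lbrakk>x \<in> carrier A; y \<in> carrier A\<rbrakk>
      \<Longrightarrow> (c \<odot> x) \<otimes> y = c \<odot> (x \<otimes> y)"
    and mult_smult_right: "\<lbrakk>x \<in> carrier A; y \<in> carrier A\<rbrakk>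
      \<Longrightarrow> x \<otimes> (c \<odot> y) = c \<odot> (x \<otimes> y)"
    and star_closed: "x \<in> carrier A \<Longrightarrow> star A x \<in> carrier A"
    and star_star: "x \<in> carrier A \<Longrightarrow> star A (star A x) = x"
    and star_add: "\<lbrakk>x \<in> carrier A; y \<in> carrier A\<rbrakk>
      \<Longrightarrow> star A (x \<oplus> y) = star A x \<oplus> star A y"
    and star_smult: "x \<in> carrier A \<Longrightarrow> star A (c \<odot> x) = cnj c \<odot> star A x"
    and star_mult: "\<lbrakk>x \<in> carrier A; y \<in> carrier A\<rbrakk>
      \<Longrightarrow> star A (x \<otimes> y) = star A y \<otimes> star A x"
    and nrm_nonneg: "x \<in> carrier A \<Longrightarrow> 0 \<le> nrm A x"
    and nrm_eq_0_iff: "x \<in> carrier A \<Longrightarrow> nrm A x = 0 \<longleftrightarrow> x = \<zero>"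
    and nrm_triangle: "\<lbrakk>x \<in> carrier A; y \<in> carrier A\<rbrakk>
      \<Longrightarrow> nrm A (x \<oplus> y) \<le> nrm A x + nrm A y"
    and nrm_smult: "x \<in> carrier A \<Longrightarrow> nrm A (c \<odot> x) = cmod c * nrm A x"
    and nrm_mult: "\<lbrakk>x \<in> carrier A; y \<in> carrier A\<rbrakk>
      \<Longrightarrow> nrm A (x \<otimes> y) \<le> nrm A x * nrm A y"
    and cstar_identity: "x \<in> carrier A \<Longrightarrow> nrm A (star A x \<otimes> x) = (nrm A x)\<^sup>2"
    and complete: "Metric_space.mcomplete (carrier A) (norm_dist A)"


section \<open>Completely positive contractive maps\<close>

text \<open>Elements of \<open>M\<^sub>r(A)\<close> are functions of two indices, of which only the values
  at indices below \<open>r\<close> matter; positive elements are those of the form \<open>b\<^sup>*b\<close>.\<close>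

definition mat_positive :: "'a cstar \<Rightarrow> nat \<Rightarrow> (nat \<Rightarrow> nat \<Rightarrow> 'a) \<Rightarrow> bool" where
  "mat_positive A r a \<longleftrightarrow>
     (\<exists>b. (\<forall>i<r. \<forall>j<r. b i j \<in> carrier A) \<and>
          (\<forall>i<r. \<forall>j<r. a i j = (\<Oplus>\<^bsub>A\<^esub>k\<in>{..<r}. star A (b k i) \<otimes>\<^bsub>A\<^esub> b k j)))"

definition linear_map :: "'a cstar \<Rightarrow> 'b cstar \<Rightarrow> ('a \<Rightarrow> 'b) \<Rightarrow> bool" where
  "linear_map A B \<phi> \<longleftrightarrow>
     \<phi> \<in> carrier A \<rightarrow> carrier B \<and>
     (\<forall>x\<in>carrier A. \<forall>y\<in>carrier A. \<phi> (x \<oplus>\<^bsub>A\<^esub> y) = \<phi> x \<oplus>\<^bsub>B\<^esub> \<phi> y) \<and>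
     (\<forall>c. \<forall>x\<in>carrier A. \<phi> (c \<odot>\<^bsub>A\<^esub> x) = c \<odot>\<^bsub>B\<^esub> \<phi> x)"

definition completely_positive :: "'a cstar \<Rightarrow> 'b cstar \<Rightarrow> ('a \<Rightarrow> 'b) \<Rightarrow> bool" where
  "completely_positive A B \<phi> \<longleftrightarrow>
     linear_map A B \<phi> \<and>
     (\<forall>r a. mat_positive A r a \<longrightarrow> mat_positive B r (\<lambda>i j. \<phi> (a i j)))"

definition cpc :: "'a cstar \<Rightarrow> 'b cstar \<Rightarrow> ('a \<Rightarrow> 'b) \<Rightarrow> bool" where
  "cpc A B \<phi> \<longleftrightarrow>
     completely_positive A B \<phi> \<and> (\<forall>x\<in>carrier A. nrm B (\<phi> x) \<le> nrm A x)"


section \<open>The sequence algebra\<close>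

definition prod_cstar :: "(nat \<Rightarrow> 'a cstar) \<Rightarrow> (nat \<Rightarrow> 'a) cstar" where
  "prod_cstar A =
     \<lparr>carrier = {a. (\<forall>n. a n \<in> carrier (A n)) \<and> bdd_above (range (\<lambda>n. nrm (A n) (a n)))},
      monoid.mult = (\<lambda>a b n. a n \<otimes>\<^bsub>A n\<^esub> b n),
      one = (\<lambda>n. \<one>\<^bsub>A n\<^esub>),
      zero = (\<lambda>n. \<zero>\<^bsub>A n\<^esub>),
      add = (\<lambda>a b n. a n \<oplus>\<^bsub>A n\<^esub> b n),
      smult = (\<lambda>c a n. c \<odot>\<^bsub>A n\<^esub> a n),
      star = (\<lambda>a n. star (A n) (a n)),
      nrm = (\<lambda>a. SUP n. nrm (A n) (a n))\<rparr>"

definition null_seqs :: "(nat \<Rightarrow> 'a cstar) \<Rightarrow> (nat \<Rightarrow> 'a) set" where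
  "null_seqs A = {a. (\<forall>n. a n \<in> carrier (A n)) \<and> (\<lambda>n. nrm (A n) (a n)) \<longlonglongrightarrow> 0}"

text \<open>The quotient ring is \<^term>\<open>A Quot I\<close> of \<^theory>\<open>HOL-Algebra.QuotRing\<close>; the
  norm is the quotient norm.\<close>

definition quot_cstar :: "'a cstar \<Rightarrow> 'a set \<Rightarrow> 'a set cstar" where
  "quot_cstar A I =
     \<lparr>carrier = carrier (A Quot I),
      monoid.mult = monoid.mult (A Quot I),
      one = \<one>\<^bsub>A Quot I\<^esub>,
      zero = \<zero>\<^bsub>A Quot I\<^esub>,
      add = add (A Quot I),
      smult = (\<lambda>c C. \<Union>x\<in>C. I +>\<^bsub>A\<^esub> (c \<odot>\<^bsub>A\<^esub> x)),
      star = (\<lambda>C. \<Union>x\<in>C. I +>\<^bsub>A\<^esub> star A x),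
      nrm = (\<lambda>C. INF x\<in>C. nrm A x)\<rparr>"

definition seq_algebra :: "(nat \<Rightarrow> 'a cstar) \<Rightarrow> (nat \<Rightarrow> 'a) set cstar" where
  "seq_algebra A = quot_cstar (prod_cstar A) (null_seqs A)"

definition seq_class :: "(nat \<Rightarrow> 'a cstar) \<Rightarrow> (nat \<Rightarrow> 'a) \<Rightarrow> (nat \<Rightarrow> 'a) set" where
  "seq_class A a = null_seqs A +>\<^bsub>prod_cstar A\<^esub> a"


section \<open>Systems and their limits\<close>

text \<open>\<^term>\<open>\<rho> n\<close> stands for \<open>\<rho>\<^bsub>n+1,n\<^esub>\<close>. Taking all algebras over one type \<^typ>\<open>'a\<close>
  is no restriction, as any sequence of algebras can be realised on a disjoint union.\<close>

locale cpc_system =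
  fixes A :: "nat \<Rightarrow> 'a cstar" and \<rho> :: "nat \<Rightarrow> 'a \<Rightarrow> 'a"
  assumes cstar: "cstar_algebra (A n)"
    and cpc: "cpc (A n) (A (Suc n)) (\<rho> n)"

text \<open>\<open>conn \<rho> m n\<close> is \<open>\<rho>\<^bsub>m,n\<^esub>\<close> for \<open>m \<ge> n\<close>; the value for \<open>m < n\<close> is arbitrary.\<close>

primrec conn :: "(nat \<Rightarrow> 'a \<Rightarrow> 'a) \<Rightarrow> nat \<Rightarrow> nat \<Rightarrow> 'a \<Rightarrow> 'a" where
  "conn \<rho> 0 n = id"
| "conn \<rho> (Suc m) n = (if n \<le> m then \<rho> m \<circ> conn \<rho> m n else id)"

text \<open>The sequence \<open>(\<rho>\<^bsub>m,n\<^esub>(x))\<^bsub>m>n\<^esub>\<close> is completed by zeros; its class does not depend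
  on this choice.\<close>

definition to_limit ::
  "(nat \<Rightarrow> 'a cstar) \<Rightarrow> (nat \<Rightarrow> 'a \<Rightarrow> 'a) \<Rightarrow> nat \<Rightarrow> 'a \<Rightarrow> (nat \<Rightarrow> 'a) set" where
  "to_limit A \<rho> n x = seq_class A (\<lambda>m. if m > n then conn \<rho> m n x else \<zero>\<^bsub>A m\<^esub>)"

definition system_limit ::
  "(nat \<Rightarrow> 'a cstar) \<Rightarrow> (nat \<Rightarrow> 'a \<Rightarrow> 'a) \<Rightarrow> (nat \<Rightarrow> 'a) set set" where
  "system_limit A \<rho> =
     Abstract_Topology.closure_of (norm_topology (seq_algebra A))
       (\<Union>n. to_limit A \<rho> n ` carrier (A n))"

locale cstar_encoding_system = cpc_system +
  assumes encoding: "\<lbrakk>x \<in> carrier (A k); y \<in> carrier (A k); \<epsilon> > 0\<rbrakk> \<Longrightarrow>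
    \<exists>M>k. \<forall>m n j. n > M \<and> j > M \<and> m > max n j \<longrightarrow>
      nrm (A m)
        (conn \<rho> m n (conn \<rho> n k x \<otimes>\<^bsub>A n\<^esub> conn \<rho> n k y) \<ominus>\<^bsub>A m\<^esub>
         conn \<rho> m j (conn \<rho> j k x \<otimes>\<^bsub>A j\<^esub> conn \<rho> j k y)) < \<epsilon>"

definition bilinear_on :: "'a cstar \<Rightarrow> 'a set \<Rightarrow> ('a \<Rightarrow> 'a \<Rightarrow> 'a) \<Rightarrow> bool" where
  "bilinear_on A V f \<longleftrightarrow>
     (\<forall>a\<in>V. \<forall>b\<in>V. f a b \<in> V) \<and>
     (\<forall>a\<in>V. \<forall>b\<in>V. \<forall>c\<in>V.
        f (a \<oplus>\<^bsub>A\<^esub> b) c = f a c \<oplus>\<^bsub>A\<^esub> f b c \<and> f a (b \<oplus>\<^bsub>A\<^esub> c) = f a b \<oplus>\<^bsub>A\<^esub> f a c) \<and>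
     (\<forall>s. \<forall>a\<in>V. \<forall>b\<in>V.
        f (s \<odot>\<^bsub>A\<^esub> a) b = s \<odot>\<^bsub>A\<^esub> f a b \<and> f a (s \<odot>\<^bsub>A\<^esub> b) = s \<odot>\<^bsub>A\<^esub> f a b)"

end

theory Submission
  imports Defs
begin

text \<open>
  The class of a bounded sequence \<open>a\<close> lies in the limit if and only if \<open>\<rho>\<^sub>n(a\<^sub>n)\<close> converges to it;
  the product of the classes of \<open>a\<close> and \<open>b\<close> is then \<open>lim\<^sub>n \<rho>\<^sub>n(a\<^sub>nb\<^sub>n)\<close>, whose existence is the
  encoding condition together with density. Bilinearity, submultiplicativity of the norm and
  compatibility with the involution are immediate, and the \<open>C\<^sup>*\<close>-identity follows from the
  Kadison-Schwarz inequality. For associativity one shows that \<open>\<rho>\<^sub>m((c\<^sub>m - a\<^sub>mb\<^sub>m)z\<^sub>m)\<close> tends to \<open>0\<close>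
  when \<open>c\<close> represents the product of \<open>a\<close> and \<open>b\<close>. By polarization one may take \<open>b = x\<close>,
  \<open>a = x\<^sup>*\<close>; then \<open>d = \<rho>\<^bsub>m,n\<^esub>(x\<^sub>n\<^sup>*x\<^sub>n) - x\<^sub>m\<^sup>*x\<^sub>m\<close> is positive, and the Cauchy-Schwarz inequality
  bounds \<open>\<rho>\<^sub>m(dz)\<close> by \<open>\<rho>\<^sub>m(d)\<close>, which is small.

  Both inequalities rest on the order structure of \<open>C\<^sup>*\<close>-algebras. It is obtained without
  Gelfand theory: \<open>h\<close> is positive if \<open>h\<^sup>* = h\<close> and \<open>\<parallel>t - h\<parallel> \<le> t\<close> for some \<open>t \<ge> 0\<close>, square roots are
  binomial series, and non-unital algebras are embedded in their multiplier algebras.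
\<close>

section \<open>Unital \<open>C\<^sup>*\<close>-algebras as a type class\<close>

text \<open>The transition maps are not multiplicative, so the pointwise product of two sequences
  that represent elements of the limit need not represent an element of it: only the images
  \<open>\<rho>\<^sub>n(a\<^sub>nb\<^sub>n)\<close> converge. This is what obstructs associativity.
  Replacing \<open>a\<^sub>mb\<^sub>m\<close> by \<open>c\<^sub>m\<close> before multiplying by
  \<open>z\<^sub>m\<close> commits an error that need not be small in \<open>A m\<close>; it becomes
  small only when transported further, and the transport of a product is not controlled by the
  transports of its factors. Positivity of 2 by 2 matrices supplies the missing control. The
  estimates are therefore iterated limits: a product is formed at an index \<open>n\<close>, and
  then \<open>m\<close> tends to infinity. The carriers vary with \<open>n\<close>, whereas
  algebraic rewriting is convenient in a type class. Positivity is therefore developed in the class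
  below, whose complex scalars are central elements \<open>cscale c\<close>, and all
  \<open>A n\<close> are realised as subsets of one algebra of this class, where the limit is then
  studied.\<close>

class cstar_unital = real_normed_algebra + banach + monoid_mult +
  fixes adj :: "'a \<Rightarrow> 'a" and cscale :: "complex \<Rightarrow> 'a"
  assumes adj_adj [simp]: "adj (adj x) = x"
    and adj_add: "adj (x + y) = adj x + adj y"
    and adj_mult: "adj (x * y) = adj y * adj x"
    and adj_cscale: "adj (cscale c) = cscale (cnj c)"
    and cscale_add: "cscale (c + d) = cscale c + cscale d"
    and cscale_mult: "cscale (c * d) = cscale c * cscale d"
    and cscale_of_real: "cscale (of_real r) = r *\<^sub>R 1"
    and cscale_commute: "x * cscale c = cscale c * x"
    and cstar_norm: "norm (adj x * x) = (norm x)\<^sup>2"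

section \<open>Scalars, involution and norm in a unital C*-algebra\<close>

lemma cscale_0 [simp]: "cscale 0 = 0"
  using cscale_add[of 0 0] by simp

lemma cscale_1 [simp]: "cscale 1 = 1"
  using cscale_of_real[of 1] by simp

lemma cscale_minus: "cscale (- c) = - cscale c"
  using cscale_add[of "- c" c] by (simp add: eq_neg_iff_add_eq_0)

lemma cscale_left_commute: "x * (cscale c * y) = cscale c * (x * y)"
  by (metis cscale_commute mult.assoc)

lemma cscale_ii: "cscale \<i> * (cscale \<i> * x) = - x"
  by (metis cscale_1 cscale_minus cscale_mult i_squared mult.assoc mult_1 mult_minus_left)

lemma scaleR_eq_cscale: "r *\<^sub>R x = cscale (of_real r) * (x :: 'a :: cstar_unital)"
  by (simp add: cscale_of_real)

lemma adj_1 [simp]: "adj 1 = 1"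
  using adj_cscale[of 1] by simp

lemma adj_0 [simp]: "adj 0 = 0"
  using adj_add[of 0 0] by simp

lemma adj_minus: "adj (- x) = - adj x"
  using adj_add[of "- x" x] by (simp add: eq_neg_iff_add_eq_0)

lemma adj_diff: "adj (x - y) = adj x - adj y"
  using adj_add[of x "- y"] by (simp add: adj_minus)

lemma adj_cscale_mult: "adj (cscale c * x) = cscale (cnj c) * adj x"
  by (simp add: adj_mult adj_cscale cscale_commute)

lemma adj_scaleR: "adj (r *\<^sub>R x) = r *\<^sub>R adj x"
  by (simp add: scaleR_eq_cscale adj_cscale_mult)

lemma adj_power: "adj (x ^ n) = adj x ^ n"
  by (induction n) (simp_all add: adj_mult power_commutes)

lemma norm_adj [simp]:
  fixes x :: "'a :: cstar_unital"
  shows "norm (adj x) = norm x"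
proof -
  have "norm y \<le> norm (adj y)" for y :: 'a
  proof (cases "y = 0")
    case False
    have "norm y * norm y \<le> norm (adj y) * norm y"
      using norm_mult_ineq[of "adj y" y] by (simp add: cstar_norm power2_eq_square)
    with False show ?thesis by simp
  qed simp
  from this[of x] this[of "adj x"] show ?thesis by simp
qed

lemma norm_selfadjoint_square: "adj x = x \<Longrightarrow> norm (x * x) = (norm x)\<^sup>2"
  using cstar_norm[of x] by simp

text \<open>Only an inequality holds: in the zero algebra the unit is 0. For this reason the class
  does not build on \<open>real_normed_algebra_1\<close>, which demands
  \<open>norm 1 = 1\<close>.\<close>

lemma norm_one_le: "norm (1 :: 'a :: cstar_unital) \<le> 1"
proof -
  have "norm (1 :: 'a) = norm (1 :: 'a) * norm (1 :: 'a)"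
    using norm_selfadjoint_square[of "1 :: 'a"] by (simp add: power2_eq_square)
  then show ?thesis
    by (metis mult_cancel_right1 order_refl zero_le_one)
qed

lemma norm_power_le:
  fixes x :: "'a :: cstar_unital"
  shows "norm (x ^ n) \<le> norm x ^ n"
proof (induction n)
  case (Suc n)
  have "norm (x ^ Suc n) \<le> norm x * norm (x ^ n)"
    by (simp add: norm_mult_ineq)
  also have "\<dots> \<le> norm x * norm x ^ n"
    by (intro mult_left_mono Suc) simp
  finally show ?case by simp
qed (simp add: norm_one_le)

text \<open>Homogeneity for complex scalars is not an axiom of the class. It follows from the
  C*-identity, since \<open>cscale c\<close> is central and \<open>cscale (cnj c) * cscale c\<close>
  is the real scalar \<open>(cmod c)\<^sup>2\<close>.\<close>

lemma norm_cscale_mult: "norm (cscale c * x) = cmod c * norm x"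
proof -
  have "(norm (cscale c * x))\<^sup>2 = norm (cscale (cnj c) * adj x * (cscale c * x))"
    by (metis cstar_norm adj_cscale_mult)
  also have "cscale (cnj c) * adj x * (cscale c * x) = cscale (cnj c * c) * (adj x * x)"
    by (metis cscale_commute cscale_mult mult.assoc)
  also have "\<dots> = (cmod c)\<^sup>2 *\<^sub>R (adj x * x)"
    by (metis complex_norm_square mult.commute scaleR_eq_cscale)
  also have "norm \<dots> = (cmod c * norm x)\<^sup>2"
    by (simp add: cstar_norm power_mult_distrib)
  finally show ?thesis
    by (simp add: power2_eq_iff_nonneg)
qed

text \<open>For self-adjoint \<open>h\<close> the bound says that the spectrum lies in the interval
  from 0 to \<open>2 * t\<close>. In this form, sums and nonnegative multiples of positive elements
  are positive by the triangle inequality alone.\<close>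

definition pos :: "'a :: cstar_unital \<Rightarrow> bool" where
  "pos h \<longleftrightarrow> adj h = h \<and> (\<exists>t\<ge>0. norm (t *\<^sub>R 1 - h) \<le> t)"

lemma pos_adj: "pos h \<Longrightarrow> adj h = h"
  by (simp add: pos_def)

lemma pos_0 [simp]: "pos 0"
  unfolding pos_def by (auto intro!: exI[of _ 0])

lemma pos_add:
  assumes "pos h" "pos k"
  shows "pos (h + k)"
proof -
  obtain s t where st: "s \<ge> 0" "norm (s *\<^sub>R 1 - h) \<le> s" "t \<ge> 0" "norm (t *\<^sub>R 1 - k) \<le> t"
    using assms unfolding pos_def by blast
  have "norm ((s + t) *\<^sub>R 1 - (h + k)) \<le> s + t"
    using norm_triangle_mono[OF st(2,4)] by (simp add: algebra_simps)
  then show ?thesis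
    using assms st unfolding pos_def by (auto simp: adj_add intro!: exI[of _ "s + t"])
qed

lemma pos_scaleR:
  assumes "pos h" "r \<ge> 0"
  shows "pos (r *\<^sub>R h)"
proof -
  obtain t where t: "t \<ge> 0" "norm (t *\<^sub>R 1 - h) \<le> t"
    using assms unfolding pos_def by blast
  have "norm ((r * t) *\<^sub>R 1 - r *\<^sub>R h) = r * norm (t *\<^sub>R 1 - h)"
    using assms(2) norm_scaleR[of r "t *\<^sub>R 1 - h"] by (simp add: scaleR_right_diff_distrib)
  also have "\<dots> \<le> r * t"
    by (intro mult_left_mono t assms(2))
  finally show ?thesis
    using assms t unfolding pos_def by (auto simp: adj_scaleR intro!: exI[of _ "r * t"])
qed

lemma pos_norm_diff:
  assumes "adj h = h" "norm h \<le> c"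
  shows "pos (c *\<^sub>R 1 - h)"
  unfolding pos_def using assms order_trans[OF norm_ge_zero assms(2)]
  by (auto simp: adj_diff adj_scaleR intro!: exI[of _ c])

lemma tendsto_adj:
  fixes f :: "'b \<Rightarrow> 'a :: cstar_unital"
  assumes "(f \<longlongrightarrow> l) F"
  shows "((\<lambda>x. adj (f x)) \<longlongrightarrow> adj l) F"
proof -
  have "bounded_linear (adj :: 'a \<Rightarrow> 'a)"
    by (rule bounded_linear_intro[of _ 1]) (simp_all add: adj_add adj_scaleR)
  from bounded_linear.tendsto[OF this assms] show ?thesis .
qed

section \<open>Functional calculus by power series with real coefficients, and square roots\<close>

definition power_series :: "(nat \<Rightarrow> real) \<Rightarrow> 'a :: cstar_unital \<Rightarrow> 'a" where
  "power_series c k = (\<Sum>n. c n *\<^sub>R k ^ n)"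

lemma summable_power_series:
  fixes k :: "'a :: cstar_unital"
  assumes "summable (\<lambda>n. \<bar>c n\<bar> * norm k ^ n)"
  shows "summable (\<lambda>n. norm (c n *\<^sub>R k ^ n))"
  by (rule summable_comparison_test'[OF assms, of 0])
     (simp add: mult_left_mono norm_power_le)

lemma power_series_commute:
  fixes k x :: "'a :: cstar_unital"
  assumes c: "summable (\<lambda>n. \<bar>c n\<bar> * norm k ^ n)" and "x * k = k * x"
  shows "x * power_series c k = power_series c k * x"
proof -
  have sm: "summable (\<lambda>n. c n *\<^sub>R k ^ n)"
    by (rule summable_norm_cancel[OF summable_power_series[OF c]])
  have pow: "x * k ^ n = k ^ n * x" for n
  proof (induction n)
    case (Suc n)
    then show ?case using assms(2) by (metis mult.assoc power_Suc)
  qed simp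
  show ?thesis
    unfolding power_series_def suminf_mult[OF sm, symmetric] suminf_mult2[OF sm]
    by (simp add: pow)
qed

lemma power_series_adj:
  fixes k :: "'a :: cstar_unital"
  assumes c: "summable (\<lambda>n. \<bar>c n\<bar> * norm k ^ n)" and "adj k = k"
  shows "adj (power_series c k) = power_series c k"
proof -
  have sm: "summable (\<lambda>n. c n *\<^sub>R k ^ n)"
    by (rule summable_norm_cancel[OF summable_power_series[OF c]])
  have "bounded_linear (adj :: 'a \<Rightarrow> 'a)"
    by (rule bounded_linear_intro[of _ 1]) (simp_all add: adj_add adj_scaleR)
  from bounded_linear.suminf[OF this sm] show ?thesis
    unfolding power_series_def by (simp add: adj_scaleR adj_power assms(2))
qed

lemma power_series_mult:
  fixes k :: "'a :: cstar_unital"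
  assumes c: "summable (\<lambda>n. \<bar>c n\<bar> * norm k ^ n)" and d: "summable (\<lambda>n. \<bar>d n\<bar> * norm k ^ n)"
  shows "power_series c k * power_series d k
    = power_series (\<lambda>n. \<Sum>i\<le>n. c i * d (n - i)) k"
proof -
  have "(\<Sum>i\<le>n. (c i *\<^sub>R k ^ i) * (d (n - i) *\<^sub>R k ^ (n - i)))
      = (\<Sum>i\<le>n. c i * d (n - i)) *\<^sub>R k ^ n" for n
    by (simp add: scaleR_sum_left mult.commute[of "c _"] flip: power_add)
  with Cauchy_product_sums[OF summable_power_series[OF c] summable_power_series[OF d]]
  show ?thesis
    unfolding power_series_def by (simp add: sums_iff)
qed

lemma power_series_finite:
  fixes k :: "'a :: cstar_unital"
  assumes "\<And>n. n > 1 \<Longrightarrow> c n = 0"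
  shows "power_series c k = c 0 *\<^sub>R 1 + c 1 *\<^sub>R k"
proof -
  have "power_series c k = (\<Sum>n\<in>{0, 1}. c n *\<^sub>R k ^ n)"
    unfolding power_series_def by (rule suminf_finite) (use assms in auto)
  then show ?thesis by simp
qed

text \<open>These are the partial sums, at 1, of the series of \<open>sqrt (1 - x)\<close>. Such a
  sum collapses to \<open>(- 1) ^ m\<close> times the binomial coefficient of
  \<open>- 1 / 2\<close>; negating the upper index leaves a product of the positive factors
  \<open>m - 1/2 - i\<close> with \<open>i < m\<close>.\<close>

lemma gbinomial_half_alternating_sum_nonneg:
  "(\<Sum>k\<le>m. ((1/2 :: real) gchoose k) * (- 1) ^ k) \<ge> 0"
proof -
  have "(- 1 / 2 :: real) gchoose m = (- 1) ^ m * ((real m - 1/2) gchoose m)"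
    using gbinomial_minus[of "1/2 :: real" m] by (simp add: algebra_simps)
  moreover have "((real m - 1/2) gchoose m) \<ge> 0"
    unfolding gbinomial_prod_rev
    by (intro divide_nonneg_nonneg prod_nonneg) auto
  ultimately show ?thesis
    unfolding gbinomial_sum_lower_neg by (simp flip: mult.assoc power_mult_distrib)
qed

text \<open>After negation of the upper index, exactly one factor of the product is negative, namely
  the last one, \<open>- 1/2\<close>.\<close>

lemma gbinomial_half_sign: "n \<ge> 1 \<Longrightarrow> ((1/2 :: real) gchoose n) * (- 1) ^ n \<le> 0"
proof -
  assume "n \<ge> 1"
  then obtain m where n: "n = Suc m" by (cases n) auto
  have "((1/2 :: real) gchoose n) = (- 1) ^ n * ((real n - 1/2 - 1) gchoose n)"
    by (rule gbinomial_negated_upper)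
  moreover have "((real n - 1/2 - 1) gchoose n) \<le> 0"
  proof -
    have "((real n - 1/2 - 1) gchoose n)
      = (\<Prod>i = 0..<m. (real m - 1/2 - real i)) * (- 1/2) / fact n"
      unfolding gbinomial_prod_rev n by (simp add: algebra_simps)
    moreover have "(\<Prod>i = 0..<m. (real m - 1/2 - real i)) \<ge> 0"
      by (intro prod_nonneg) auto
    ultimately show ?thesis by (simp add: divide_nonneg_nonneg)
  qed
  moreover have "(- 1) ^ n * x * (- 1) ^ n = x" for x :: real
    by (cases "even n") simp_all
  ultimately show ?thesis by metis
qed

text \<open>All coefficients after the constant term 1 are nonpositive, so their absolute values add
  up to 1 minus a partial sum of the series, and partial sums are nonnegative.\<close>

lemma summable_gbinomial_half:
  fixes c :: "nat \<Rightarrow> real"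
  defines "c \<equiv> \<lambda>n. ((1/2) gchoose n) * (- 1) ^ n"
  shows "summable (\<lambda>n. \<bar>c n\<bar>)" "(\<Sum>n. \<bar>c (Suc n)\<bar>) \<le> 1"
proof -
  have le: "(\<Sum>i<n. \<bar>c (Suc i)\<bar>) \<le> 1" for n
  proof -
    have "(\<Sum>i<n. \<bar>c (Suc i)\<bar>) = - (\<Sum>i<n. c (Suc i))"
      using gbinomial_half_sign[of "Suc _"]
      by (simp add: c_def sum_negf[symmetric] abs_of_nonpos del: power_Suc)
    also have "\<dots> = 1 - (\<Sum>i\<le>n. c i)"
      unfolding sum.atMost_shift by (simp add: c_def)
    also have "\<dots> \<le> 1"
      using gbinomial_half_alternating_sum_nonneg[of n] by (simp add: c_def)
    finally show ?thesis .
  qed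
  have "summable (\<lambda>n. \<bar>c (Suc n)\<bar>)"
    by (rule summableI_nonneg_bounded[OF _ le]) simp
  then show "summable (\<lambda>n. \<bar>c n\<bar>)" "(\<Sum>n. \<bar>c (Suc n)\<bar>) \<le> 1"
    using summable_Suc_iff[of "\<lambda>n. \<bar>c n\<bar>"] suminf_le_const[OF _ le] by blast+
qed

text \<open>The binomial series converges absolutely even for \<open>norm k = 1\<close>, and
  Vandermonde's identity for \<open>1/2 + 1/2\<close> shows that it squares to \<open>1 - k\<close>.
  The bound on \<open>1 - s\<close> will make \<open>s\<close> positive; the commutation clause
  stands for the fact that \<open>s\<close> is a limit of polynomials in \<open>k\<close>.\<close>

lemma sqrt_one_minus:
  fixes k :: "'a :: cstar_unital"
  assumes k: "adj k = k" "norm k \<le> 1"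
  obtains s where "adj s = s" "s * s = 1 - k" "norm (1 - s) \<le> 1"
    "\<And>x. x * k = k * x \<Longrightarrow> x * s = s * x"
proof -
  define c :: "nat \<Rightarrow> real" where "c = (\<lambda>n. ((1/2) gchoose n) * (- 1) ^ n)"
  have sm1: "summable (\<lambda>n. \<bar>c n\<bar>)" and le1: "(\<Sum>n. \<bar>c (Suc n)\<bar>) \<le> 1"
    using summable_gbinomial_half unfolding c_def by auto
  have pw: "norm k ^ n \<le> 1" for n
    using k(2) by (simp add: power_le_one)
  have le: "\<bar>c n\<bar> * norm k ^ n \<le> \<bar>c n\<bar>" for n
    using mult_left_mono[OF pw, of "\<bar>c n\<bar>"] by simp
  have sm: "summable (\<lambda>n. \<bar>c n\<bar> * norm k ^ n)"
    by (rule summable_comparison_test'[OF sm1, of 0]) (use le in simp)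
  define s where "s = power_series c k"
  have conv: "(\<Sum>i\<le>n. c i * c (n - i)) = (1 gchoose n) * (- 1) ^ n" for n
  proof -
    have "(\<Sum>i\<le>n. c i * c (n - i))
        = (\<Sum>i=0..n. (((1/2) gchoose i) * ((1/2) gchoose (n - i)))) * (- 1) ^ n"
      unfolding c_def atMost_atLeast0 sum_distrib_right
      by (intro sum.cong) (simp_all add: mult_ac flip: power_add)
    then show ?thesis
      using gbinomial_Vandermonde[of "1/2 :: real" "1/2" n] by simp
  qed
  have g1: "(1 :: real) gchoose n = of_nat (1 choose n)" for n
    using binomial_gbinomial[of 1 n, where ?'a = real] by simp
  have "s * s = power_series (\<lambda>n. (1 gchoose n) * (- 1) ^ n) k"
    unfolding s_def power_series_mult[OF sm sm] conv ..
  also have "\<dots> = 1 - k"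
    by (subst power_series_finite) (auto simp: g1)
  finally have ss: "s * s = 1 - k" .
  have nsm: "summable (\<lambda>n. norm (c n *\<^sub>R k ^ n))"
    by (rule summable_power_series[OF sm])
  have hd: "(\<Sum>n. c (Suc n) *\<^sub>R k ^ Suc n) = s - 1"
    unfolding s_def power_series_def
    using suminf_split_head[OF summable_norm_cancel[OF nsm]] by (simp add: c_def)
  have "norm (c (Suc n) *\<^sub>R k ^ Suc n) \<le> \<bar>c (Suc n)\<bar>" for n
  proof -
    have "norm (c (Suc n) *\<^sub>R k ^ Suc n) \<le> \<bar>c (Suc n)\<bar> * norm k ^ Suc n"
      unfolding norm_scaleR by (intro mult_left_mono norm_power_le) simp
    with le[of "Suc n"] show ?thesis by linarith
  qed
  moreover have nsm': "summable (\<lambda>n. norm (c (Suc n) *\<^sub>R k ^ Suc n))"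
    using nsm by (subst summable_Suc_iff)
  moreover have "summable (\<lambda>n. \<bar>c (Suc n)\<bar>)"
    using sm1 by (subst summable_Suc_iff)
  ultimately have "(\<Sum>n. norm (c (Suc n) *\<^sub>R k ^ Suc n)) \<le> 1"
    by (blast intro: order_trans[OF suminf_le le1])
  with summable_norm[OF nsm'] have "norm (1 - s) \<le> 1"
    unfolding hd by (simp add: norm_minus_commute)
  then show ?thesis
    using that[of s] ss power_series_adj[OF sm k(1)] power_series_commute[OF sm]
    unfolding s_def by blast
qed

text \<open>The bound in the definition of positivity allows \<open>h = t0 *\<^sub>R (1 - k)\<close>
  with \<open>norm k \<le> 1\<close>, unless \<open>t0 = 0\<close>, in which case
  \<open>h = 0\<close>.\<close>

lemma pos_sqrt:
  fixes h :: "'a :: cstar_unital"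
  assumes "pos h"
  obtains s where "pos s" "s * s = h" "\<And>x. x * h = h * x \<Longrightarrow> x * s = s * x"
proof -
  obtain t0 where t0: "t0 \<ge> 0" "norm (t0 *\<^sub>R 1 - h) \<le> t0" and h: "adj h = h"
    using assms unfolding pos_def by blast
  show thesis
  proof (cases "t0 = 0")
    case True
    then have "h = 0" using t0 by simp
    then show ?thesis using that[of 0] by simp
  next
    case False
    then have t: "t0 > 0" using t0 by simp
    define k where "k = 1 - (1 / t0) *\<^sub>R h"
    have hk: "h = t0 *\<^sub>R (1 - k)"
      using t by (simp add: k_def)
    have "norm k = norm (t0 *\<^sub>R 1 - h) / t0"
      using t by (simp add: hk scaleR_right_diff_distrib)
    then have nk: "norm k \<le> 1"
      using t t0 by (simp add: divide_le_eq)
    have ak: "adj k = k"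
      by (simp add: k_def adj_diff adj_scaleR h)
    obtain r where r: "adj r = r" "r * r = 1 - k" "norm (1 - r) \<le> 1"
      "\<And>x. x * k = k * x \<Longrightarrow> x * r = r * x"
      using sqrt_one_minus[OF ak nk] by blast
    have "pos r"
      unfolding pos_def using r(1,3) by (auto intro!: exI[of _ 1])
    then have "pos (sqrt t0 *\<^sub>R r)"
      using t by (intro pos_scaleR) auto
    moreover have "(sqrt t0 *\<^sub>R r) * (sqrt t0 *\<^sub>R r) = h"
      using t by (simp add: r(2) hk)
    moreover have "x * (sqrt t0 *\<^sub>R r) = (sqrt t0 *\<^sub>R r) * x" if "x * h = h * x" for x
      using r(4)[of x] that by (simp add: k_def algebra_simps)
    ultimately show ?thesis using that by blast
  qed
qed

text \<open>As \<open>s\<close> and \<open>r\<close> commute, \<open>u = s + \<i> r\<close>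
  satisfies \<open>adj u * u = s * s + r * r\<close>, which bounds the norm of \<open>u\<close>, and
  \<open>s\<close> is the real part of \<open>u\<close>. This takes the place of a comparison of
  spectra.\<close>

lemma commuting_selfadjoint_norm_le:
  fixes s r :: "'a :: cstar_unital"
  assumes "adj s = s" "adj r = r" "s * r = r * s" "s * s + r * r = c *\<^sub>R 1"
  shows "(norm s)\<^sup>2 \<le> \<bar>c\<bar>"
proof -
  define u where "u = s + cscale \<i> * r"
  have au: "adj u = s - cscale \<i> * r"
    by (simp add: u_def adj_add adj_cscale_mult assms cscale_minus)
  have "adj u * u = s * s + r * r"
    unfolding au unfolding u_def
    by (simp add: algebra_simps cscale_left_commute[of s] cscale_left_commute[of r] assms(3) cscale_ii)
  then have "(norm u)\<^sup>2 = \<bar>c\<bar> * norm (1 :: 'a)"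
    using cstar_norm[of u] assms(4) by simp
  also have "\<dots> \<le> \<bar>c\<bar>"
    using mult_left_mono[OF norm_one_le, of "\<bar>c\<bar>"] by simp
  finally have u2: "(norm u)\<^sup>2 \<le> \<bar>c\<bar>" .
  have "s = (1/2) *\<^sub>R (u + adj u)"
    unfolding au by (simp add: u_def flip: scaleR_2)
  then have "norm s \<le> (1/2) * (norm u + norm (adj u))"
    using norm_triangle_ineq[of u "adj u"] by simp
  then have "norm s \<le> norm u" by simp
  then have "(norm s)\<^sup>2 \<le> (norm u)\<^sup>2" by (simp add: power_mono)
  with u2 show ?thesis by linarith
qed

text \<open>The square roots of \<open>h\<close> and of \<open>c *\<^sub>R 1 - h\<close> commute and
  their squares add up to \<open>c\<close>.\<close>

lemma pos_norm_le:
  fixes h :: "'a :: cstar_unital"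
  assumes "pos h" "pos (c *\<^sub>R 1 - h)" "c \<ge> 0"
  shows "norm h \<le> c"
proof -
  obtain s where s: "pos s" "s * s = h" "\<And>x. x * h = h * x \<Longrightarrow> x * s = s * x"
    using pos_sqrt[OF assms(1)] by blast
  obtain r where r: "pos r" "r * r = c *\<^sub>R 1 - h"
      "\<And>x. x * (c *\<^sub>R 1 - h) = (c *\<^sub>R 1 - h) * x \<Longrightarrow> x * r = r * x"
    using pos_sqrt[OF assms(2)] by blast
  have "h * (c *\<^sub>R 1 - h) = (c *\<^sub>R 1 - h) * h" by (simp add: algebra_simps)
  then have "h * r = r * h" by (rule r(3))
  then have "r * s = s * r" using s(3)[of r] by simp
  then have "(norm s)\<^sup>2 \<le> c"
    using commuting_selfadjoint_norm_le[of s r c] s(1,2) r(1,2) assms(3) by (simp add: pos_adj)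
  then show ?thesis
    using norm_selfadjoint_square[of s] s pos_adj by metis
qed

text \<open>\<open>norm k *\<^sub>R 1 - h\<close> is the sum of the positive elements
  \<open>norm k *\<^sub>R 1 - k\<close> and \<open>k - h\<close>.\<close>

lemma pos_mono_norm:
  fixes h k :: "'a :: cstar_unital"
  assumes "pos h" "pos (k - h)"
  shows "norm h \<le> norm k"
proof -
  have "adj k = k"
    using pos_adj[OF assms(1)] pos_adj[OF assms(2)] by (simp add: adj_diff)
  then have "pos (norm k *\<^sub>R 1 - k)" by (simp add: pos_norm_diff)
  from pos_add[OF assms(2) this] show ?thesis
    using assms(1) by (simp add: pos_norm_le)
qed

lemma pos_antisym:
  fixes h :: "'a :: cstar_unital"
  assumes "pos h" "pos (- h)"
  shows "h = 0"
  using pos_norm_le[of h 0] assms by simp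

lemma pos_norm_diff_le:
  fixes h :: "'a :: cstar_unital"
  assumes "pos h" "norm h \<le> t"
  shows "norm (t *\<^sub>R 1 - h) \<le> t"
proof (rule pos_norm_le)
  show "pos (t *\<^sub>R 1 - h)" using assms by (simp add: pos_norm_diff pos_adj)
  show "t \<ge> 0" using assms(2) norm_ge_zero order_trans by blast
qed (use assms in simp)

text \<open>Scale to \<open>norm g \<le> 1\<close> and let \<open>s\<close> be a square root of
  \<open>1 - g * g\<close>. Then \<open>s\<close> commutes with \<open>g\<close> and
  \<open>s * s + g * g = 1\<close>, so \<open>1 - g * g = s * s\<close> has norm at most 1: this is
  positivity of \<open>g * g\<close> with \<open>t = 1\<close>.\<close>

lemma pos_square:
  fixes h :: "'a :: cstar_unital"
  assumes "adj h = h"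
  shows "pos (h * h)"
proof -
  \<comment> \<open>The summand 1 keeps the scaling factor positive when
    \<open>h = 0\<close>.\<close>
  define t where "t = norm h + 1"
  have t: "t > 0" "norm h \<le> t" by (simp_all add: t_def add_nonneg_pos)
  define g where "g = (1 / t) *\<^sub>R h"
  have g: "adj g = g" "norm g \<le> 1"
    using t assms by (simp_all add: g_def adj_scaleR)
  have gg: "adj (g * g) = g * g" "norm (g * g) \<le> 1"
    using g by (simp_all add: adj_mult norm_selfadjoint_square power_le_one)
  obtain s where s: "adj s = s" "s * s = 1 - g * g"
      "\<And>x. x * (g * g) = (g * g) * x \<Longrightarrow> x * s = s * x"
    using sqrt_one_minus[OF gg] by blast
  have "g * s = s * g" by (rule s(3)) (simp add: mult.assoc)
  then have "(norm s)\<^sup>2 \<le> 1"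
    using commuting_selfadjoint_norm_le[of s g 1] s(1,2) g by simp
  then have "norm (1 - g * g) \<le> 1"
    using norm_selfadjoint_square[OF s(1)] s(2) by simp
  then have "pos (g * g)"
    unfolding pos_def using gg by (auto intro!: exI[of _ 1])
  from pos_scaleR[OF this, of "t\<^sup>2"] show ?thesis
    using t by (simp add: g_def power2_eq_square)
qed

text \<open>Here \<open>x\<close> and \<open>y\<close> are the real and imaginary parts of
  \<open>b\<close>; the mixed terms cancel.\<close>

lemma adj_mult_self_sum:
  fixes b :: "'a :: cstar_unital"
  obtains x y where "adj x = x" "adj y = y" "adj b * b + b * adj b = 2 *\<^sub>R (x * x + y * y)"
proof
  define x where "x = (1/2) *\<^sub>R (b + adj b)"
  define y where "y = (1/2) *\<^sub>R (cscale \<i> * (adj b - b))"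
  show "adj x = x" "adj y = y"
    by (simp_all add: x_def y_def adj_scaleR adj_add adj_diff adj_cscale_mult cscale_minus
        algebra_simps)
  have "x * x = (1/4) *\<^sub>R ((b + adj b) * (b + adj b))"
    by (simp add: x_def)
  moreover have "(cscale \<i> * d) * (cscale \<i> * d) = - (d * d)" for d :: 'a
    by (metis cscale_ii mult.assoc cscale_left_commute)
  then have "y * y = - (1/4) *\<^sub>R ((adj b - b) * (adj b - b))"
    by (simp add: y_def)
  moreover have "(b + adj b) * (b + adj b) - (adj b - b) * (adj b - b)
      = 2 *\<^sub>R (adj b * b + b * adj b)"
    by (simp add: algebra_simps scaleR_2)
  moreover have "2 *\<^sub>R ((1/4) *\<^sub>R u + - (1/4) *\<^sub>R v) = (1/2) *\<^sub>R (u - v)" for u v :: 'a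
    by (simp add: scaleR_right_diff_distrib scaleR_add_right)
  ultimately show "adj b * b + b * adj b = 2 *\<^sub>R (x * x + y * y)"
    by simp
qed

text \<open>This replaces the usual argument that \<open>adj b * b\<close> and
  \<open>b * adj b\<close> have the same nonzero spectrum. With
  \<open>p = - (adj b * b) = q * q\<close> and \<open>w = b * adj b\<close>, the element
  \<open>c = b * q\<close> satisfies \<open>adj c * c = - (p * p)\<close> and
  \<open>c * adj c = - (w * w)\<close>. Their sum is twice a sum of two squares, hence positive, but
  it is also negative; so \<open>p * p + w * w = 0\<close>.\<close>

lemma neg_adj_mult_self_eq_0:
  fixes b :: "'a :: cstar_unital"
  assumes "pos (- (adj b * b))"
  shows "b = 0"
proof -
  define p where "p = - (adj b * b)"
  define w where "w = b * adj b"
  obtain q where q: "pos q" "q * q = p"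
    using pos_sqrt[OF assms] p_def by metis
  have aq: "adj q = q" using q pos_adj by blast
  have p: "adj p = p" "adj w = w"
    by (simp_all add: p_def w_def adj_minus adj_mult)
  define c where "c = b * q"
  have qp: "q * p * q = p * p"
    using q(2) by (metis mult.assoc)
  have "adj c * c = - (q * p * q)"
    by (simp add: c_def adj_mult aq p_def mult.assoc)
  then have cc1: "adj c * c = - (p * p)" by (simp add: qp)
  have "c * adj c = b * (q * q) * adj b"
    by (simp add: c_def adj_mult aq mult.assoc)
  then have cc2: "c * adj c = - (w * w)"
    by (simp add: q(2) p_def w_def mult.assoc)
  obtain x y where xy: "adj x = x" "adj y = y" "adj c * c + c * adj c = 2 *\<^sub>R (x * x + y * y)"
    using adj_mult_self_sum by blast
  have "pos (adj c * c + c * adj c)"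
    unfolding xy(3) using xy by (intro pos_scaleR pos_add pos_square) auto
  moreover have "pos (p * p + w * w)"
    using p by (intro pos_add pos_square) auto
  ultimately have sum0: "p * p + w * w = 0"
    using pos_antisym[of "p * p + w * w"] by (simp add: cc1 cc2)
  have "p * p = 0"
  proof (rule pos_antisym)
    show "pos (p * p)" using p by (simp add: pos_square)
    show "pos (- (p * p))" using sum0 p(2) pos_square[of w]
      by (simp add: add_eq_0_iff)
  qed
  then have "norm p = 0" using norm_selfadjoint_square[OF p(1)] by simp
  then have "adj b * b = 0" by (simp add: p_def)
  then show ?thesis using cstar_norm[of b] by simp
qed

text \<open>Here \<open>s\<close> is the absolute value of \<open>h\<close> and
  \<open>n = s - h\<close> is twice its negative part. From \<open>h * n = - (s * n)\<close> one
  sees that \<open>- (adj (a * n) * (a * n))\<close> is the square of the self-adjoint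
  \<open>q * n\<close>, so \<open>a * n = 0\<close>. Then \<open>h * n\<close> and
  \<open>s * n\<close> vanish, and with them \<open>n * n\<close>.\<close>

theorem pos_adj_mult_self:
  fixes a :: "'a :: cstar_unital"
  shows "pos (adj a * a)"
proof -
  define h where "h = adj a * a"
  have h: "adj h = h" by (simp add: h_def adj_mult)
  obtain s where s: "pos s" "s * s = h * h" "\<And>x. x * (h * h) = h * h * x \<Longrightarrow> x * s = s * x"
    using pos_sqrt[OF pos_square[OF h]] by blast
  have sa: "adj s = s" using s pos_adj by blast
  have hs: "h * s = s * h" by (rule s(3)) (simp add: mult.assoc)
  define n where "n = s - h"
  have an: "adj n = n" by (simp add: n_def adj_diff sa h)
  have hn: "h * n = - (s * n)" by (simp add: n_def algebra_simps s(2) hs)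
  obtain q where q: "pos q" "q * q = s" "\<And>x. x * s = s * x \<Longrightarrow> x * q = q * x"
    using pos_sqrt[OF s(1)] by blast
  have aq: "adj q = q" using q pos_adj by blast
  have ns: "n * s = s * n" by (simp add: n_def algebra_simps hs)
  have nq: "n * q = q * n" by (rule q(3)[OF ns])
  have "adj (a * n) * (a * n) = n * (h * n)"
    by (simp add: adj_mult an h_def mult.assoc)
  also have "\<dots> = - ((q * n) * (q * n))"
    unfolding hn by (metis mult.assoc mult_minus_right nq q(2))
  finally have "- (adj (a * n) * (a * n)) = (q * n) * (q * n)" by simp
  moreover have "pos ((q * n) * (q * n))"
    by (rule pos_square) (simp add: adj_mult an aq nq)
  ultimately have "a * n = 0"
    by (intro neg_adj_mult_self_eq_0) simp
  then have hn0: "h * n = 0" by (simp add: h_def mult.assoc)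
  then have "n * n = 0"
    using hn by (simp add: n_def left_diff_distrib)
  then have "n = 0" using norm_selfadjoint_square[OF an] by simp
  then show ?thesis using s(1) by (simp add: n_def h_def)
qed

section \<open>Order properties and the Cauchy-Schwarz inequality\<close>

lemma pos_conj:
  fixes h c :: "'a :: cstar_unital"
  assumes "pos h"
  shows "pos (adj c * h * c)"
proof -
  obtain s where s: "pos s" "s * s = h" using pos_sqrt[OF assms] by blast
  have "adj c * h * c = adj (s * c) * (s * c)"
    by (simp add: adj_mult mult.assoc pos_adj[OF s(1)] flip: s(2))
  then show ?thesis by (simp add: pos_adj_mult_self)
qed

text \<open>A convergent sequence is bounded, so one and the same \<open>t\<close> witnesses the
  positivity of all its terms and passes to the limit.\<close>

lemma pos_closed:
  fixes h :: "nat \<Rightarrow> 'a :: cstar_unital"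
  assumes "\<And>n. pos (h n)" "h \<longlonglongrightarrow> l"
  shows "pos l"
proof -
  have "Bseq h" using assms(2) convergentI convergent_imp_Bseq by blast
  then obtain t where t: "\<And>n. norm (h n) \<le> t" "t > 0" by (auto simp: Bseq_def)
  have "norm (t *\<^sub>R 1 - h n) \<le> t" for n
    by (rule pos_norm_diff_le[OF assms(1) t(1)])
  moreover have "(\<lambda>n. norm (t *\<^sub>R 1 - h n)) \<longlonglongrightarrow> norm (t *\<^sub>R 1 - l)"
    by (intro tendsto_intros assms(2))
  ultimately have "norm (t *\<^sub>R 1 - l) \<le> t"
    by (meson LIMSEQ_le_const2)
  moreover have "adj l = l"
    using tendsto_adj[OF assms(2)] assms(2) pos_adj[OF assms(1)] LIMSEQ_unique by fastforce
  ultimately show ?thesis using t(2) unfolding pos_def by (auto intro!: exI[of _ t])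
qed

lemma norm_adj_mult_self_le_add:
  fixes a b :: "'a :: cstar_unital"
  shows "(norm a)\<^sup>2 \<le> norm (adj a * a + adj b * b)"
  using pos_mono_norm[of "adj a * a" "adj a * a + adj b * b"]
  by (simp add: pos_adj_mult_self cstar_norm)

text \<open>The Cauchy-Schwarz inequality for the inner product
  \<open>\<langle>c, b\<rangle> = c\<^sub>0\<^sup>*b\<^sub>0 + c\<^sub>1\<^sup>*b\<^sub>1\<close>: expand \<open>\<langle>b - ca/M, b - ca/M\<rangle> \<ge> 0\<close> with \<open>a = \<langle>c, b\<rangle>\<close>.\<close>

lemma pair_Cauchy_Schwarz:
  fixes b0 b1 c0 c1 :: "'a :: cstar_unital"
  defines "a \<equiv> adj c0 * b0 + adj c1 * b1"
  assumes M: "norm (adj c0 * c0 + adj c1 * c1) \<le> M"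
  shows "pos (M *\<^sub>R (adj b0 * b0 + adj b1 * b1) - adj a * a)"
\<comment> \<open>The expansion divides by \<open>M\<close>. If \<open>M = 0\<close>, then
  \<open>c0\<close>, \<open>c1\<close> and with them \<open>a\<close> vanish.\<close>
proof (cases "M = 0")
  case True
  have "(norm c0)\<^sup>2 \<le> 0" "(norm c1)\<^sup>2 \<le> 0"
    using norm_adj_mult_self_le_add[of c0 c1] norm_adj_mult_self_le_add[of c1 c0] M True
    by (simp_all add: add.commute)
  then show ?thesis by (simp add: True a_def)
next
  case False
  then have M0: "M > 0" using M norm_ge_zero order_trans by (metis order_le_less)
  define C where "C = adj c0 * c0 + adj c1 * c1"
  define d0 where "d0 = b0 - (1/M) *\<^sub>R (c0 * a)"
  define d1 where "d1 = b1 - (1/M) *\<^sub>R (c1 * a)"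
  have aa: "adj a = adj b0 * c0 + adj b1 * c1"
    by (simp add: a_def adj_add adj_mult)
  have "adj d0 * d0 + adj d1 * d1
     = adj b0 * b0 + adj b1 * b1 - (1/M) *\<^sub>R (adj a * (adj c0 * b0 + adj c1 * b1))
       - (1/M) *\<^sub>R ((adj b0 * c0 + adj b1 * c1) * a) + (1/M\<^sup>2) *\<^sub>R (adj a * C * a)"
    by (simp add: d0_def d1_def C_def adj_diff adj_mult adj_scaleR algebra_simps power2_eq_square)
  also have "\<dots> = adj b0 * b0 + adj b1 * b1 - (2/M) *\<^sub>R (adj a * a) + (1/M\<^sup>2) *\<^sub>R (adj a * C * a)"
    unfolding aa[symmetric] a_def[symmetric] by (simp add: diff_diff_eq flip: scaleR_add_left)
  finally have eq: "adj d0 * d0 + adj d1 * d1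
     = adj b0 * b0 + adj b1 * b1 - (2/M) *\<^sub>R (adj a * a) + (1/M\<^sup>2) *\<^sub>R (adj a * C * a)" .
  have "adj C = C" by (simp add: C_def adj_add adj_mult)
  then have "pos (M *\<^sub>R 1 - C)" using M by (simp add: C_def pos_norm_diff)
  \<comment> \<open>Adding a multiple of this positive element turns the term
    \<open>adj a * C * a\<close> of the expansion into \<open>M\<close> times
    \<open>adj a * a\<close>.\<close>
  then have "pos (adj a * (M *\<^sub>R 1 - C) * a)" by (rule pos_conj)
  then have 1: "pos ((1/M) *\<^sub>R (adj a * (M *\<^sub>R 1 - C) * a))" using M0 by (intro pos_scaleR) auto
  have 2: "pos (M *\<^sub>R (adj d0 * d0 + adj d1 * d1))"
    using M0 by (intro pos_scaleR pos_add pos_adj_mult_self) auto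
  have "M *\<^sub>R (adj d0 * d0 + adj d1 * d1) + (1/M) *\<^sub>R (adj a * (M *\<^sub>R 1 - C) * a)
     = M *\<^sub>R (adj b0 * b0 + adj b1 * b1) - adj a * a"
    unfolding eq using M0
    by (simp add: algebra_simps power2_eq_square scaleR_2)
  then show ?thesis using pos_add[OF 2 1] by simp
qed

lemma pair_Cauchy_Schwarz_norm:
  fixes b0 b1 c0 c1 :: "'a :: cstar_unital"
  shows "(norm (adj c0 * b0 + adj c1 * b1))\<^sup>2
     \<le> norm (adj c0 * c0 + adj c1 * c1) * norm (adj b0 * b0 + adj b1 * b1)"
proof -
  define a where "a = adj c0 * b0 + adj c1 * b1"
  have "norm (adj a * a) \<le> norm (norm (adj c0 * c0 + adj c1 * c1) *\<^sub>R (adj b0 * b0 + adj b1 * b1))"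
    unfolding a_def by (intro pos_mono_norm pos_adj_mult_self pair_Cauchy_Schwarz order_refl)
  then show ?thesis by (simp add: cstar_norm a_def)
qed

text \<open>\<open>h + \<delta> = (t + \<delta>) (1 - g)\<close> with \<open>norm g < 1\<close>, so
  a Neumann series inverts it. The identities \<open>r = r h r + \<delta> r r\<close> and
  \<open>h r = (r h)(r h) + \<delta> r h r\<close> make both \<open>\<delta> r\<close> and
  \<open>h r\<close> positive; as they add up to 1, both have norm at most 1.\<close>

lemma pos_resolvent:
  fixes h :: "'a :: cstar_unital"
  assumes "pos h" "\<delta> > 0"
  obtains r where "adj r = r" "r * (h + \<delta> *\<^sub>R 1) = 1" "(h + \<delta> *\<^sub>R 1) * r = 1"
    "norm (\<delta> *\<^sub>R r) \<le> 1" "norm (h * r) \<le> 1"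
proof -
  obtain t where t: "t \<ge> 0" "norm (t *\<^sub>R 1 - h) \<le> t" and h: "adj h = h"
    using assms unfolding pos_def by blast
  define g where "g = (1 / (t + \<delta>)) *\<^sub>R (t *\<^sub>R 1 - h)"
  have td: "t + \<delta> > 0" using t assms by simp
  have "norm g \<le> t / (t + \<delta>)"
    using t td by (simp add: g_def divide_right_mono)
  also have "\<dots> < 1" using td assms by simp
  finally have ng: "norm g < 1" .
  have ag: "adj g = g" by (simp add: g_def adj_scaleR adj_diff h)
  have hd: "h + \<delta> *\<^sub>R 1 = (t + \<delta>) *\<^sub>R (1 - g)"
  proof -
    have "(t + \<delta>) *\<^sub>R g = t *\<^sub>R 1 - h" using td by (simp add: g_def)
    then show ?thesis by (simp add: scaleR_right_diff_distrib scaleR_add_left)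
  qed
  have sm: "summable (\<lambda>n. \<bar>1 :: real\<bar> * norm g ^ n)" using ng by simp
  define N where "N = power_series (\<lambda>_. 1) g"
  have aN: "adj N = N" unfolding N_def by (rule power_series_adj[OF sm ag])
  have gN: "g * N = N * g" unfolding N_def by (rule power_series_commute[OF sm]) simp
  have smg: "summable (\<lambda>n. g ^ n)"
    using summable_norm_cancel[OF summable_power_series[OF sm]] by simp
  have "N = 1 + g * N"
    using suminf_split_head[OF smg] suminf_mult[OF smg, of g]
    by (simp add: N_def power_series_def)
  then have inv: "(1 - g) * N = 1" "N * (1 - g) = 1"
    using gN by (simp_all add: algebra_simps)
  define r where "r = (1 / (t + \<delta>)) *\<^sub>R N"
  have ar: "adj r = r" by (simp add: r_def adj_scaleR aN)
  have r1: "r * (h + \<delta> *\<^sub>R 1) = 1" and r2: "(h + \<delta> *\<^sub>R 1) * r = 1"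
    using inv td by (simp_all add: hd r_def)
  have "h * r + \<delta> *\<^sub>R r = r * h + \<delta> *\<^sub>R r"
    using r1 r2 by (simp add: algebra_simps)
  then have hr: "h * r = r * h" by simp
  have pr: "pos (r * h * r)" using pos_conj[OF assms(1), of r] by (simp add: ar)
  have prr: "pos (r * r)" by (rule pos_square[OF ar])
  have phh: "pos ((r * h) * (r * h))"
    by (rule pos_square) (simp add: adj_mult ar h hr)
  have "r = r * (h + \<delta> *\<^sub>R 1) * r" by (simp add: r1)
  also have "\<dots> = r * h * r + \<delta> *\<^sub>R (r * r)" by (simp add: algebra_simps)
  finally have req: "r = r * h * r + \<delta> *\<^sub>R (r * r)" .
  then have "pos r" using pos_add[OF pr pos_scaleR[OF prr, of \<delta>]] assms(2) by simp
  have "h * r = r * h * (r * (h + \<delta> *\<^sub>R 1))" by (simp add: r1 hr)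
  also have "\<dots> = (r * h) * (r * h) + \<delta> *\<^sub>R (r * h * r)" by (simp add: algebra_simps)
  finally have "pos (h * r)"
    using pos_add[OF phh pos_scaleR[OF pr, of \<delta>]] assms(2) by simp
  have one: "h * r + \<delta> *\<^sub>R r = 1" using r2 by (simp add: algebra_simps)
  have "pos (\<delta> *\<^sub>R r)" using \<open>pos r\<close> assms(2) by (simp add: pos_scaleR)
  have "norm (\<delta> *\<^sub>R r) \<le> 1"
    by (rule pos_norm_le[OF \<open>pos (\<delta> *\<^sub>R r)\<close>]) (use \<open>pos (h * r)\<close> one in \<open>simp_all add: algebra_simps flip: one\<close>)
  moreover have "norm (h * r) \<le> 1"
    by (rule pos_norm_le[OF \<open>pos (h * r)\<close>]) (use \<open>pos (\<delta> *\<^sub>R r)\<close> one in \<open>simp_all add: algebra_simps flip: one\<close>)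
  ultimately show ?thesis using that[OF ar r1 r2] by blast
qed

text \<open>The approximate unit is \<open>e = h(h + \<delta>)\<^sup>-\<^sup>1\<close> with \<open>h = xx\<^sup>*\<close>;
  it is returned as \<open>x * u\<close> so that it lies in every right ideal containing \<open>x\<close>.\<close>

lemma approximate_left_unit:
  fixes x :: "'a :: cstar_unital"
  assumes "\<epsilon> > 0"
  obtains u where "adj (x * u) = x * u" "norm (x * u) \<le> 1" "norm (x - x * u * x) \<le> \<epsilon>"
proof -
  define h where "h = x * adj x"
  have ph: "pos h" using pos_adj_mult_self[of "adj x"] by (simp add: h_def)
  have h: "adj h = h" using ph by (rule pos_adj)
  \<comment> \<open>The estimate below bounds the square of the error by
    \<open>\<delta>\<close>.\<close>
  define \<delta> where "\<delta> = \<epsilon>\<^sup>2"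
  have \<delta>: "\<delta> > 0" using assms by (simp add: \<delta>_def)
  obtain r where r: "adj r = r" "r * (h + \<delta> *\<^sub>R 1) = 1" "(h + \<delta> *\<^sub>R 1) * r = 1"
      "norm (\<delta> *\<^sub>R r) \<le> 1" "norm (h * r) \<le> 1"
    using pos_resolvent[OF ph \<delta>] by blast
  have "h * r + \<delta> *\<^sub>R r = r * h + \<delta> *\<^sub>R r"
    using r(2,3) by (simp add: algebra_simps)
  then have hr: "h * r = r * h" by simp
  have one: "1 - h * r = \<delta> *\<^sub>R r" using r(3) by (simp add: algebra_simps)
  define y where "y = x - h * r * x"
  have y: "y = (\<delta> *\<^sub>R r) * x" unfolding y_def one[symmetric] by (simp add: algebra_simps)
  have "(norm y)\<^sup>2 = norm (y * adj y)"
    using cstar_norm[of "adj y"] by simp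
  also have "y * adj y = \<delta> *\<^sub>R ((\<delta> *\<^sub>R r) * (h * r))"
    by (simp add: y adj_mult adj_scaleR r(1) h_def mult.assoc)
  also have "norm \<dots> \<le> \<delta> * (1 * 1)"
  proof -
    have "norm ((\<delta> *\<^sub>R r) * (h * r)) \<le> 1 * 1"
      by (rule order_trans[OF norm_mult_ineq mult_mono]) (use r(4,5) in auto)
    then show ?thesis using \<delta> by simp
  qed
  finally have "norm y \<le> \<epsilon>"
    using assms by (simp add: \<delta>_def power2_le_iff_abs_le)
  moreover have xu: "x * (adj x * r) = h * r" by (simp add: h_def mult.assoc)
  moreover have "adj (h * r) = h * r" by (simp add: adj_mult r(1) h hr)
  ultimately show ?thesis
    using that[of "adj x * r"] r(5) unfolding xu y_def by blast
qed

section \<open>Normed complex spaces with a carrier\<close>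

text \<open>The linear and metric part of \<open>cstar_algebra\<close>, separated so that the
  sequence algebra and the limit can be treated as metric spaces before a product on them is
  studied.\<close>

locale normed_cspace = Module.module "ring_of_type_algebra :: complex ring" A
  for A :: "'a cstar" (structure) +
  assumes nrm_nonneg: "x \<in> carrier A \<Longrightarrow> 0 \<le> nrm A x"
    and nrm_eq_0_iff: "x \<in> carrier A \<Longrightarrow> nrm A x = 0 \<longleftrightarrow> x = \<zero>"
    and nrm_triangle: "\<lbrakk>x \<in> carrier A; y \<in> carrier A\<rbrakk>
      \<Longrightarrow> nrm A (x \<oplus> y) \<le> nrm A x + nrm A y"
    and nrm_smult: "x \<in> carrier A \<Longrightarrow> nrm A (c \<odot> x) = cmod c * nrm A x"
begin

lemma csmult_closed: "x \<in> carrier A \<Longrightarrow> c \<odot> x \<in> carrier A"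
  using smult_closed[of c x] by (simp add: ring_of_type_algebra_def)

lemma csmult_add_left: "x \<in> carrier A \<Longrightarrow> (c + d) \<odot> x = c \<odot> x \<oplus> d \<odot> x"
  using smult_l_distr[of c d x] by (simp add: ring_of_type_algebra_def)

lemma csmult_add_right:
  "\<lbrakk>x \<in> carrier A; y \<in> carrier A\<rbrakk> \<Longrightarrow> c \<odot> (x \<oplus> y) = c \<odot> x \<oplus> c \<odot> y"
  using smult_r_distr[of c x y] by (simp add: ring_of_type_algebra_def)

lemma csmult_csmult: "x \<in> carrier A \<Longrightarrow> c \<odot> (d \<odot> x) = (c * d) \<odot> x"
  using smult_assoc1[of c d x] by (simp add: ring_of_type_algebra_def)

lemma csmult_1: "x \<in> carrier A \<Longrightarrow> 1 \<odot> x = x"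
  using smult_one[of x] by (simp add: ring_of_type_algebra_def)

lemma csmult_0: "x \<in> carrier A \<Longrightarrow> 0 \<odot> x = \<zero>"
  using smult_l_null[of x] by (simp add: ring_of_type_algebra_def)

lemma csmult_zero: "c \<odot> \<zero> = \<zero>"
  using smult_r_null[of c] by (simp add: ring_of_type_algebra_def)

lemma csmult_minus_1: "x \<in> carrier A \<Longrightarrow> (- 1) \<odot> x = \<ominus> x"
  using csmult_add_left[of x "-1" 1]
  by (simp add: csmult_0 csmult_1 csmult_closed M.minus_equality)

lemma minus_eq_csmult: "\<lbrakk>x \<in> carrier A; y \<in> carrier A\<rbrakk> \<Longrightarrow> x \<ominus> y = x \<oplus> (- 1) \<odot> y"
  by (simp add: a_minus_def csmult_minus_1)

lemma nrm_zero: "nrm A \<zero> = 0"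
  using nrm_eq_0_iff[of \<zero>] by simp

lemma eq_iff_minus_eq_zero: "\<lbrakk>x \<in> carrier A; y \<in> carrier A\<rbrakk> \<Longrightarrow> x \<ominus> y = \<zero> \<longleftrightarrow> x = y"
  by (metis M.r_neg a_minus_def M.minus_minus M.minus_equality M.a_inv_closed M.a_comm)

lemma minus_add_minus:
  "\<lbrakk>x \<in> carrier A; y \<in> carrier A; z \<in> carrier A\<rbrakk> \<Longrightarrow> (x \<ominus> y) \<oplus> (y \<ominus> z) = x \<ominus> z"
  by (simp add: a_minus_def M.a_assoc M.r_neg1)

lemma csmult_minus_1_minus:
  "\<lbrakk>x \<in> carrier A; y \<in> carrier A\<rbrakk> \<Longrightarrow> (- 1) \<odot> (x \<ominus> y) = y \<ominus> x"
  by (simp add: csmult_minus_1 a_minus_def M.minus_add M.a_comm)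

lemma nrm_minus_commute:
  "\<lbrakk>x \<in> carrier A; y \<in> carrier A\<rbrakk> \<Longrightarrow> nrm A (x \<ominus> y) = nrm A (y \<ominus> x)"
  using nrm_smult[of "x \<ominus> y" "-1"] by (simp add: csmult_minus_1_minus)

lemma nrm_minus_triangle:
  "\<lbrakk>x \<in> carrier A; y \<in> carrier A; z \<in> carrier A\<rbrakk>
   \<Longrightarrow> nrm A (x \<ominus> z) \<le> nrm A (x \<ominus> y) + nrm A (y \<ominus> z)"
  using nrm_triangle[of "x \<ominus> y" "y \<ominus> z"] by (simp add: minus_add_minus)

sublocale metric: Metric_space "carrier A" "norm_dist A"
proof
  show "0 \<le> norm_dist A x y" for x y by (simp add: norm_dist_def nrm_nonneg)
  show "norm_dist A x y = norm_dist A y x" for x y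
    by (simp add: norm_dist_def nrm_minus_commute)
  show "norm_dist A x y = 0 \<longleftrightarrow> x = y" if "x \<in> carrier A" "y \<in> carrier A" for x y
    using that by (simp add: norm_dist_def nrm_eq_0_iff eq_iff_minus_eq_zero)
  show "norm_dist A x z \<le> norm_dist A x y + norm_dist A y z"
    if "x \<in> carrier A" "y \<in> carrier A" "z \<in> carrier A" for x y z
    using that by (simp add: norm_dist_def nrm_minus_triangle)
qed

end

sublocale cstar_algebra \<subseteq> normed_cspace
  by unfold_locales (fact nrm_nonneg nrm_eq_0_iff nrm_triangle nrm_smult)+

section \<open>Adjointable operators\<close>

text \<open>\<open>T\<close> is an adjoint of \<open>S\<close> for the \<open>A\<close>-valued inner
  product that sends \<open>x\<close> and \<open>y\<close> to \<open>star A x \<otimes> y\<close>;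
  such \<open>S\<close> are the multipliers of \<open>A\<close>.\<close>

definition adj_pair :: "'a cstar \<Rightarrow> ('a \<Rightarrow> 'a) \<Rightarrow> ('a \<Rightarrow> 'a) \<Rightarrow> bool" where
  "adj_pair A S T \<longleftrightarrow>
     S \<in> carrier A \<rightarrow> carrier A \<and> T \<in> carrier A \<rightarrow> carrier A \<and>
     (\<forall>x\<in>carrier A. \<forall>y\<in>carrier A. star A (S x) \<otimes>\<^bsub>A\<^esub> y = star A x \<otimes>\<^bsub>A\<^esub> T y)"

context cstar_algebra
begin

lemma nrm_star: "x \<in> carrier A \<Longrightarrow> nrm A (star A x) = nrm A x"
proof -
  have le: "nrm A y \<le> nrm A (star A y)" if "y \<in> carrier A" for y
  proof (cases "nrm A y = 0")
    case False
    have "nrm A y * nrm A y \<le> nrm A (star A y) * nrm A y"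
      using nrm_mult[of "star A y" y] cstar_identity[OF that] that
      by (simp add: star_closed power2_eq_square)
    with False nrm_nonneg[OF that] show ?thesis by simp
  qed (use that star_closed nrm_nonneg in auto)
  assume "x \<in> carrier A"
  with le[of x] le[of "star A x"] show ?thesis by (simp add: star_closed star_star)
qed

lemma eq_zeroI: "\<lbrakk>x \<in> carrier A; star A x \<otimes> x = \<zero>\<rbrakk> \<Longrightarrow> x = \<zero>"
  using cstar_identity[of x] by (simp add: nrm_zero nrm_eq_0_iff)

lemma mult_minus_right:
  "\<lbrakk>z \<in> carrier A; x \<in> carrier A; y \<in> carrier A\<rbrakk> \<Longrightarrow> z \<otimes> (x \<ominus> y) = z \<otimes> x \<ominus> z \<otimes> y"
  by (simp add: minus_eq_csmult mult_add_right mult_smult_right csmult_closed mult_closed)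

lemma star_minus:
  "\<lbrakk>x \<in> carrier A; y \<in> carrier A\<rbrakk> \<Longrightarrow> star A (x \<ominus> y) = star A x \<ominus> star A y"
  by (simp add: minus_eq_csmult star_add star_smult star_closed csmult_closed)

lemma mult_minus_left:
  "\<lbrakk>z \<in> carrier A; x \<in> carrier A; y \<in> carrier A\<rbrakk> \<Longrightarrow> (x \<ominus> y) \<otimes> z = x \<otimes> z \<ominus> y \<otimes> z"
  by (simp add: minus_eq_csmult mult_add_left mult_smult_left csmult_closed mult_closed)

text \<open>The inner product is nondegenerate: test with \<open>z = x \<ominus> y\<close> and apply
  the C*-identity.\<close>

lemma left_cancelI:
  assumes "x \<in> carrier A" "y \<in> carrier A"
    and "\<And>z. z \<in> carrier A \<Longrightarrow> star A z \<otimes> x = star A z \<otimes> y"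
  shows "x = y"
proof -
  have d: "x \<ominus> y \<in> carrier A" using assms(1,2) by simp
  have "star A (x \<ominus> y) \<otimes> (x \<ominus> y)
      = star A (x \<ominus> y) \<otimes> x \<ominus> star A (x \<ominus> y) \<otimes> y"
    by (rule mult_minus_right[OF star_closed[OF d] assms(1,2)])
  also have "\<dots> = \<zero>"
    unfolding assms(3)[OF d]
    by (simp only: eq_iff_minus_eq_zero mult_closed[OF star_closed[OF d] assms(2)])
  finally have "star A (x \<ominus> y) \<otimes> (x \<ominus> y) = \<zero>" .
  then have "x \<ominus> y = \<zero>" by (rule eq_zeroI[OF d])
  then show ?thesis using eq_iff_minus_eq_zero[OF assms(1,2)] by blast
qed

lemma adj_pair_closed:
  "adj_pair A S T \<Longrightarrow> x \<in> carrier A \<Longrightarrow> S x \<in> carrier A"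
  "adj_pair A S T \<Longrightarrow> x \<in> carrier A \<Longrightarrow> T x \<in> carrier A"
  by (auto simp: adj_pair_def)

lemma adj_pair_eq:
  "\<lbrakk>adj_pair A S T; x \<in> carrier A; y \<in> carrier A\<rbrakk> \<Longrightarrow> star A (S x) \<otimes> y = star A x \<otimes> T y"
  by (auto simp: adj_pair_def)

lemma adj_pair_sym:
  assumes "adj_pair A S T"
  shows "adj_pair A T S"
proof -
  have "star A (T x) \<otimes> y = star A x \<otimes> S y" if "x \<in> carrier A" "y \<in> carrier A" for x y
  proof -
    have "star A (star A (S y) \<otimes> x) = star A (star A y \<otimes> T x)"
      using adj_pair_eq[OF assms that(2,1)] by simp
    then show ?thesis
      using that adj_pair_closed[OF assms] by (simp add: star_mult star_closed star_star)
  qed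
  with assms show ?thesis by (auto simp: adj_pair_def)
qed

lemma adj_pair_unique:
  assumes "adj_pair A S T" "adj_pair A S T'" "x \<in> carrier A"
  shows "T x = T' x"
proof (rule left_cancelI)
  show "star A z \<otimes> T x = star A z \<otimes> T' x" if "z \<in> carrier A" for z
    using adj_pair_eq[OF assms(1) that assms(3)] adj_pair_eq[OF assms(2) that assms(3)] by simp
qed (use assms adj_pair_closed in blast)+

text \<open>Linearity of an adjointable operator is automatic: inside an inner product it is moved
  to the other factor, and the test vectors \<open>z\<close> are then cancelled. The next two lemmas
  work in the same way.\<close>

lemma adj_pair_add_arg:
  assumes "adj_pair A S T" "x \<in> carrier A" "y \<in> carrier A"
  shows "S (x \<oplus> y) = S x \<oplus> S y"
proof (rule left_cancelI)
  fix z assume z: "z \<in> carrier A"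
  note TS = adj_pair_sym[OF assms(1)]
  show "star A z \<otimes> S (x \<oplus> y) = star A z \<otimes> (S x \<oplus> S y)"
    using assms z TS adj_pair_closed[OF TS]
    by (simp add: mult_add_right star_closed adj_pair_eq[OF TS, symmetric])
qed (use assms adj_pair_closed in auto)

lemma adj_pair_smult_arg:
  assumes "adj_pair A S T" "x \<in> carrier A"
  shows "S (c \<odot> x) = c \<odot> S x"
proof (rule left_cancelI)
  fix z assume z: "z \<in> carrier A"
  note TS = adj_pair_sym[OF assms(1)]
  show "star A z \<otimes> S (c \<odot> x) = star A z \<otimes> (c \<odot> S x)"
    using assms z TS adj_pair_closed[OF TS]
    by (simp add: mult_smult_right star_closed csmult_closed adj_pair_eq[OF TS, symmetric])
qed (use assms adj_pair_closed csmult_closed in auto)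

lemma adj_pair_mult_arg:
  assumes "adj_pair A S T" "x \<in> carrier A" "y \<in> carrier A"
  shows "S (x \<otimes> y) = S x \<otimes> y"
proof (rule left_cancelI)
  fix z assume z: "z \<in> carrier A"
  note TS = adj_pair_sym[OF assms(1)]
  show "star A z \<otimes> S (x \<otimes> y) = star A z \<otimes> (S x \<otimes> y)"
    using assms z TS adj_pair_closed[OF TS]
    by (simp add: star_closed mult_closed adj_pair_eq[OF TS, symmetric] flip: mult_assoc)
qed (use assms adj_pair_closed mult_closed in auto)

text \<open>By the C*-identity and the adjoint relation, the square of \<open>nrm A (T x)\<close> is
  the norm of the inner product of \<open>S (T x)\<close> and \<open>x\<close>, hence at most
  \<open>C * nrm A (T x) * nrm A x\<close>.\<close>

lemma adj_pair_bound:
  assumes ST: "adj_pair A S T" and C: "\<And>x. x \<in> carrier A \<Longrightarrow> nrm A (S x) \<le> C * nrm A x"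
    and x: "x \<in> carrier A"
  shows "nrm A (T x) \<le> C * nrm A x"
proof (cases "nrm A (T x) = 0")
  case True
  have "0 \<le> C * nrm A x" using C[OF x] nrm_nonneg adj_pair_closed(1)[OF ST x] order_trans by blast
  with True show ?thesis by simp
next
  case False
  have Tx: "T x \<in> carrier A" "S (T x) \<in> carrier A" using ST x by (auto simp: adj_pair_closed)
  have "(nrm A (T x))\<^sup>2 = nrm A (star A (S (T x)) \<otimes> x)"
    using cstar_identity[OF Tx(1)] adj_pair_eq[OF ST Tx(1) x] by simp
  also have "\<dots> \<le> nrm A (S (T x)) * nrm A x"
    using nrm_mult[of "star A (S (T x))" x] Tx x by (simp add: star_closed nrm_star)
  also have "\<dots> \<le> C * nrm A (T x) * nrm A x"
    by (intro mult_right_mono C Tx nrm_nonneg x)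
  finally have "nrm A (T x) * nrm A (T x) \<le> (C * nrm A x) * nrm A (T x)"
    by (simp add: power2_eq_square mult_ac)
  then show ?thesis using False nrm_nonneg[OF Tx(1)] by simp
qed

section \<open>Examples of adjointable operators and operations on them\<close>

lemma adj_pair_zero: "adj_pair A (\<lambda>_. \<zero>) (\<lambda>_. \<zero>)"
proof -
  have "star A \<zero> = \<zero>" using star_smult[of \<zero> 0] by (simp add: csmult_0 star_closed)
  moreover have "\<zero> \<otimes> y = \<zero>" "y \<otimes> \<zero> = \<zero>" if "y \<in> carrier A" for y
    using mult_smult_left[of \<zero> y 0] mult_smult_right[of y \<zero> 0] that
    by (simp_all add: csmult_0 mult_closed)
  ultimately show ?thesis by (simp add: adj_pair_def star_closed)
qed

lemma adj_pair_id: "adj_pair A (\<lambda>x. x) (\<lambda>x. x)"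
  by (simp add: adj_pair_def)

lemma adj_pair_smult: "adj_pair A (\<lambda>x. c \<odot> x) (\<lambda>x. cnj c \<odot> x)"
  by (simp add: adj_pair_def csmult_closed star_smult mult_smult_left mult_smult_right star_closed)

lemma adj_pair_add:
  "\<lbrakk>adj_pair A S T; adj_pair A S' T'\<rbrakk> \<Longrightarrow> adj_pair A (\<lambda>x. S x \<oplus> S' x) (\<lambda>x. T x \<oplus> T' x)"
  by (auto simp: adj_pair_def Pi_iff star_add mult_add_left mult_add_right star_closed)

lemma adj_pair_comp:
  "\<lbrakk>adj_pair A S T; adj_pair A S' T'\<rbrakk> \<Longrightarrow> adj_pair A (\<lambda>x. S (S' x)) (\<lambda>x. T' (T x))"
  by (auto simp: adj_pair_def Pi_iff)

lemma adj_pair_left_mult: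
  assumes "a \<in> carrier A"
  shows "adj_pair A (\<lambda>x. a \<otimes> x) (\<lambda>x. star A a \<otimes> x)"
  using assms by (auto simp: adj_pair_def mult_closed star_closed star_mult mult_assoc)

lemma complete_seq:
  fixes a :: "nat \<Rightarrow> 'a"
  assumes "\<And>n. a n \<in> carrier A"
    and "\<And>\<epsilon>. \<epsilon> > 0 \<Longrightarrow> \<exists>N. \<forall>m n. N \<le> m \<longrightarrow> N \<le> n \<longrightarrow> nrm A (a m \<ominus> a n) < \<epsilon>"
  obtains l where "l \<in> carrier A" "(\<lambda>n. nrm A (a n \<ominus> l)) \<longlonglongrightarrow> 0"
proof -
  have "metric.MCauchy a"
    unfolding metric.MCauchy_def using assms by (auto simp: norm_dist_def)
  then obtain l where l: "limitin metric.mtopology a l sequentially"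
    using complete unfolding metric.mcomplete_def by blast
  then have lc: "l \<in> carrier A" by (simp add: metric.limit_metric_sequentially)
  have "(\<lambda>n. nrm A (a n \<ominus> l)) \<longlonglongrightarrow> 0"
  proof (rule LIMSEQ_I)
    fix r :: real assume "r > 0"
    then obtain N where "\<And>n. n \<ge> N \<Longrightarrow> norm_dist A (a n) l < r"
      using l unfolding metric.limit_metric_sequentially by blast
    then have "norm (nrm A (a n \<ominus> l) - 0) < r" if "n \<ge> N" for n
      using that assms(1) lc nrm_nonneg[of "a n \<ominus> l"] by (auto simp: norm_dist_def)
    then show "\<exists>no. \<forall>n\<ge>no. norm (nrm A (a n \<ominus> l) - 0) < r" by blast
  qed
  with lc show ?thesis using that by blast
qed

text \<open>The inner product is continuous, so the adjoint relation survives pointwise limits;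
  convergence is needed for the operators and for their adjoints.\<close>

lemma adj_pair_limit:
  assumes ST: "\<And>n. adj_pair A (S n) (T n)"
    and S: "\<And>x. x \<in> carrier A \<Longrightarrow> S' x \<in> carrier A \<and> (\<lambda>n. nrm A (S n x \<ominus> S' x)) \<longlonglongrightarrow> 0"
    and T: "\<And>x. x \<in> carrier A \<Longrightarrow> T' x \<in> carrier A \<and> (\<lambda>n. nrm A (T n x \<ominus> T' x)) \<longlonglongrightarrow> 0"
  shows "adj_pair A S' T'"
proof -
  have "star A (S' x) \<otimes> y = star A x \<otimes> T' y" if x: "x \<in> carrier A" and y: "y \<in> carrier A" for x y
  proof -
    note c = x y ST[THEN adj_pair_closed(1), OF x] ST[THEN adj_pair_closed(2), OF y]
      S[OF x, THEN conjunct1] T[OF y, THEN conjunct1]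
    let ?d = "star A (S' x) \<otimes> y \<ominus> star A x \<otimes> T' y"
    have "nrm A ?d \<le> nrm A (S n x \<ominus> S' x) * nrm A y + nrm A x * nrm A (T n y \<ominus> T' y)" for n
    proof -
      have "nrm A ?d \<le> nrm A (star A (S' x) \<otimes> y \<ominus> star A (S n x) \<otimes> y)
          + nrm A (star A (S n x) \<otimes> y \<ominus> star A x \<otimes> T' y)"
        using c by (intro nrm_minus_triangle) (auto simp: mult_closed star_closed)
      also have "star A (S n x) \<otimes> y \<ominus> star A x \<otimes> T' y = star A x \<otimes> (T n y \<ominus> T' y)"
        using c by (simp add: mult_minus_right star_closed adj_pair_eq[OF ST x y])
      also have "star A (S' x) \<otimes> y \<ominus> star A (S n x) \<otimes> y = star A (S' x \<ominus> S n x) \<otimes> y"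
        using c by (simp add: mult_minus_left star_minus star_closed)
      also have "nrm A (star A (S' x \<ominus> S n x) \<otimes> y) \<le> nrm A (S n x \<ominus> S' x) * nrm A y"
        using c nrm_mult[of "star A (S' x \<ominus> S n x)" y] nrm_minus_commute[of "S n x" "S' x"]
        by (simp add: star_closed nrm_star)
      also have "nrm A (star A x \<otimes> (T n y \<ominus> T' y)) \<le> nrm A x * nrm A (T n y \<ominus> T' y)"
        using c nrm_mult[of "star A x" "T n y \<ominus> T' y"] by (simp add: star_closed nrm_star)
      finally show ?thesis by simp
    qed
    moreover have "(\<lambda>n. nrm A (S n x \<ominus> S' x) * nrm A y + nrm A x * nrm A (T n y \<ominus> T' y))
        \<longlonglongrightarrow> 0 * nrm A y + nrm A x * 0"
      using S[OF x] T[OF y] by (intro tendsto_intros) auto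
    ultimately have "nrm A ?d \<le> 0" by (intro LIMSEQ_le_const) auto
    then have "?d = \<zero>"
      using c nrm_nonneg[of ?d] nrm_eq_0_iff[of ?d] by (simp add: mult_closed star_closed)
    then show ?thesis using c by (simp add: eq_iff_minus_eq_zero mult_closed star_closed)
  qed
  with S T show ?thesis by (auto simp: adj_pair_def)
qed

end

section \<open>A unital \<open>C\<^sup>*\<close>-algebra containing all \<open>C\<^sup>*\<close>-algebras on a type\<close>

text \<open>An element is a bounded family consisting of one adjointable operator (a multiplier) for
  each \<open>C\<^sup>*\<close>-algebra with underlying type \<^typ>\<open>'a\<close>. Taking all algebras at once avoids a type
  depending on an algebra.\<close>

typedef 'a multiplier = "{S :: 'a cstar \<Rightarrow> 'a \<Rightarrow> 'a.
    (\<forall>A. cstar_algebra A \<longrightarrow> (\<exists>T. adj_pair A (S A) T)) \<and>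
    (\<exists>C. \<forall>A x. cstar_algebra A \<longrightarrow> x \<in> carrier A \<longrightarrow> nrm A (S A x) \<le> C * nrm A x) \<and>
    (\<forall>A x. \<not> (cstar_algebra A \<and> x \<in> carrier A) \<longrightarrow> S A x = undefined)}"
  morphisms app Abs_multiplier
proof (rule exI, rule CollectI, intro conjI)
  let ?S = "\<lambda>A x. if cstar_algebra A \<and> x \<in> carrier A then x else undefined"
  show "\<forall>A. cstar_algebra A \<longrightarrow> (\<exists>T. adj_pair A (?S A) T)"
    by (auto simp: adj_pair_def intro!: exI[of _ "\<lambda>x. x"])
  show "\<exists>C. \<forall>A x. cstar_algebra A \<longrightarrow> x \<in> carrier A \<longrightarrow> nrm A (?S A x) \<le> C * nrm A x"
    by (auto intro!: exI[of _ 1])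
qed auto

text \<open>Resets a family to \<open>undefined\<close> off the carriers, as the type demands. With
  these values fixed, multipliers are equal as soon as they agree on all carriers.\<close>

definition multiplier_of :: "('a cstar \<Rightarrow> 'a \<Rightarrow> 'a) \<Rightarrow> 'a multiplier" where
  "multiplier_of S =
     Abs_multiplier (\<lambda>A x. if cstar_algebra A \<and> x \<in> carrier A then S A x else undefined)"

lemma adj_pair_cong:
  assumes "adj_pair A S T" "\<And>x. x \<in> carrier A \<Longrightarrow> S x = S' x" "\<And>x. x \<in> carrier A \<Longrightarrow> T x = T' x"
  shows "adj_pair A S' T'"
  using assms by (auto simp: adj_pair_def Pi_iff)

lemma app_multiplier_of:
  assumes "\<And>A. cstar_algebra A \<Longrightarrow> \<exists>T. adj_pair A (S A) T"
    and "\<And>A x. cstar_algebra A \<Longrightarrow> x \<in> carrier A \<Longrightarrow> nrm A (S A x) \<le> C * nrm A x"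
    and "cstar_algebra A" "x \<in> carrier A"
  shows "app (multiplier_of S) A x = S A x"
proof -
  have "\<exists>T. adj_pair B (\<lambda>x. if cstar_algebra B \<and> x \<in> carrier B then S B x else undefined) T"
    if B: "cstar_algebra B" for B
  proof -
    obtain T where "adj_pair B (S B) T" using assms(1)[OF B] by blast
    then have "adj_pair B (\<lambda>x. if cstar_algebra B \<and> x \<in> carrier B then S B x else undefined) T"
      by (rule adj_pair_cong) (use B in auto)
    then show ?thesis by blast
  qed
  moreover have "\<exists>C. \<forall>A x. cstar_algebra A \<longrightarrow> x \<in> carrier A \<longrightarrow>
      nrm A (if cstar_algebra A \<and> x \<in> carrier A then S A x else undefined) \<le> C * nrm A x"
    using assms(2) by auto
  ultimately show ?thesis
    unfolding multiplier_of_def using assms(3,4) by (subst Abs_multiplier_inverse) auto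
qed

lemma app_undefined:
  assumes "\<not> (cstar_algebra A \<and> x \<in> carrier A)"
  shows "app f A x = undefined"
  using CollectD[OF app[of f]] assms by blast

lemma multiplier_eqI:
  assumes "\<And>A x. cstar_algebra A \<Longrightarrow> x \<in> carrier A \<Longrightarrow> app f A x = app g A x"
  shows "f = g"
proof -
  have "app f A x = app g A x" for A x
  proof (cases "cstar_algebra A \<and> x \<in> carrier A")
    case True
    show ?thesis by (rule assms[OF conjunct1[OF True] conjunct2[OF True]])
  next
    case False
    show ?thesis by (simp only: app_undefined[OF False])
  qed
  then have "app f = app g" by (intro ext)
  then show ?thesis by (rule iffD1[OF app_inject])
qed

lemma app_adj_pair: "cstar_algebra A \<Longrightarrow> \<exists>T. adj_pair A (app f A) T"
  using CollectD[OF app[of f]] by blast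

lemma app_closed: "\<lbrakk>cstar_algebra A; x \<in> carrier A\<rbrakk> \<Longrightarrow> app f A x \<in> carrier A"
  using app_adj_pair[of A f] by (auto simp: adj_pair_def)

lemma app_add_arg:
  assumes "cstar_algebra A" "x \<in> carrier A" "y \<in> carrier A"
  shows "app f A (x \<oplus>\<^bsub>A\<^esub> y) = app f A x \<oplus>\<^bsub>A\<^esub> app f A y"
  by (rule exE[OF app_adj_pair[OF assms(1)]], rule cstar_algebra.adj_pair_add_arg[OF assms(1) _ assms(2,3)])

lemma app_smult_arg:
  assumes "cstar_algebra A" "x \<in> carrier A"
  shows "app f A (c \<odot>\<^bsub>A\<^esub> x) = c \<odot>\<^bsub>A\<^esub> app f A x"
  by (rule exE[OF app_adj_pair[OF assms(1)]], rule cstar_algebra.adj_pair_smult_arg[OF assms(1) _ assms(2)])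

lemma app_mult_arg:
  assumes "cstar_algebra A" "x \<in> carrier A" "y \<in> carrier A"
  shows "app f A (x \<otimes>\<^bsub>A\<^esub> y) = app f A x \<otimes>\<^bsub>A\<^esub> y"
  by (rule exE[OF app_adj_pair[OF assms(1)]], rule cstar_algebra.adj_pair_mult_arg[OF assms(1) _ assms(2,3)])

text \<open>The condition \<open>0 \<le> C\<close> keeps the infimum that defines the norm
  nonnegative: on trivial carriers every real number would satisfy the inequality.\<close>

definition mbound :: "'a multiplier \<Rightarrow> real \<Rightarrow> bool" where
  "mbound f C \<longleftrightarrow> 0 \<le> C \<and>
     (\<forall>A x. cstar_algebra A \<longrightarrow> x \<in> carrier A \<longrightarrow> nrm A (app f A x) \<le> C * nrm A x)"

lemma mbound_exists: "\<exists>C. mbound f C"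
proof -
  obtain C where C: "\<And>A x. cstar_algebra A \<Longrightarrow> x \<in> carrier A \<Longrightarrow> nrm A (app f A x) \<le> C * nrm A x"
    using CollectD[OF app[of f]] by blast
  have "nrm A (app f A x) \<le> max C 0 * nrm A x" if "cstar_algebra A" "x \<in> carrier A" for A x
    using C[OF that] mult_right_mono[of C "max C 0" "nrm A x"]
      cstar_algebra.nrm_nonneg[OF that] by simp
  then show ?thesis unfolding mbound_def by (intro exI[of _ "max C 0"]) auto
qed

lemma mboundD:
  "\<lbrakk>mbound f C; cstar_algebra A; x \<in> carrier A\<rbrakk> \<Longrightarrow> nrm A (app f A x) \<le> C * nrm A x"
  by (simp add: mbound_def)

definition mscale :: "complex \<Rightarrow> 'a multiplier" where
  "mscale c = multiplier_of (\<lambda>A x. c \<odot>\<^bsub>A\<^esub> x)"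

text \<open>An adjoint is chosen on each algebra separately. On a carrier there is only one by
  \<open>adj_pair_unique\<close>, and by \<open>adj_pair_bound\<close> a bound of \<open>f\<close>
  also bounds the adjoints, uniformly in the algebra.\<close>

definition madj :: "'a multiplier \<Rightarrow> 'a multiplier" where
  "madj f = multiplier_of (\<lambda>A. SOME T. adj_pair A (app f A) T)"

lemma app_mscale:
  assumes "cstar_algebra A" "x \<in> carrier A"
  shows "app (mscale c) A x = c \<odot>\<^bsub>A\<^esub> x"
  unfolding mscale_def
proof (rule app_multiplier_of[OF _ _ assms])
  show "\<exists>T. adj_pair B (\<lambda>x. c \<odot>\<^bsub>B\<^esub> x) T" if "cstar_algebra B" for B :: "'a cstar"
    by (rule exI, rule cstar_algebra.adj_pair_smult[OF that])
  show "nrm B (c \<odot>\<^bsub>B\<^esub> y) \<le> cmod c * nrm B y" if "cstar_algebra B" "y \<in> carrier B" for B and y :: 'a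
    using cstar_algebra.nrm_smult[OF that] by simp
qed

lemma adj_pair_madj:
  assumes A: "cstar_algebra A"
  shows "adj_pair A (app f A) (app (madj f) A)"
proof -
  obtain C where C: "mbound f C" using mbound_exists by metis
  let ?T = "\<lambda>A. SOME T. adj_pair A (app f A) T"
  have T: "adj_pair B (app f B) (?T B)" if "cstar_algebra B" for B
    using app_adj_pair[OF that] by (rule someI_ex)
  have "app (madj f) A x = ?T A x" if x: "x \<in> carrier A" for x
    unfolding madj_def
  proof (rule app_multiplier_of[OF _ _ A x])
    show "\<exists>T. adj_pair B (?T B) T" if "cstar_algebra B" for B
      by (rule exI, rule cstar_algebra.adj_pair_sym[OF that T[OF that]])
    show "nrm B (?T B y) \<le> C * nrm B y" if "cstar_algebra B" "y \<in> carrier B" for B y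
      using cstar_algebra.adj_pair_bound[OF that(1) T[OF that(1)] mboundD[OF C that(1)] that(2)] .
  qed
  note eq = this
  show ?thesis by (rule adj_pair_cong[OF T[OF A] refl]) (simp only: eq)
qed

lemma madj_eqI:
  assumes "\<And>A. cstar_algebra A \<Longrightarrow> adj_pair A (app f A) (app g A)"
  shows "madj f = g"
  by (rule multiplier_eqI)
     (rule cstar_algebra.adj_pair_unique[OF _ adj_pair_madj assms])

section \<open>The normed algebra of multipliers\<close>

instantiation multiplier :: (type) real_normed_algebra
begin

definition zero_multiplier :: "'a multiplier" where
  "zero_multiplier = multiplier_of (\<lambda>A x. \<zero>\<^bsub>A\<^esub>)"

definition plus_multiplier :: "'a multiplier \<Rightarrow> 'a multiplier \<Rightarrow> 'a multiplier" where
  "f + g = multiplier_of (\<lambda>A x. app f A x \<oplus>\<^bsub>A\<^esub> app g A x)"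

definition times_multiplier :: "'a multiplier \<Rightarrow> 'a multiplier \<Rightarrow> 'a multiplier" where
  "f * g = multiplier_of (\<lambda>A x. app f A (app g A x))"

definition uminus_multiplier :: "'a multiplier \<Rightarrow> 'a multiplier" where
  "- f = mscale (- 1) * (f :: 'a multiplier)"

definition minus_multiplier :: "'a multiplier \<Rightarrow> 'a multiplier \<Rightarrow> 'a multiplier" where
  "f - g = f + (- g :: 'a multiplier)"

definition scaleR_multiplier :: "real \<Rightarrow> 'a multiplier \<Rightarrow> 'a multiplier" where
  "r *\<^sub>R f = mscale (of_real r) * (f :: 'a multiplier)"

definition norm_multiplier :: "'a multiplier \<Rightarrow> real" where
  "norm f = Inf {C. mbound f C}"

definition dist_multiplier :: "'a multiplier \<Rightarrow> 'a multiplier \<Rightarrow> real" where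
  "dist f g = norm (f - g :: 'a multiplier)"

definition sgn_multiplier :: "'a multiplier \<Rightarrow> 'a multiplier" where
  "sgn f = inverse (norm f) *\<^sub>R (f :: 'a multiplier)"

definition uniformity_multiplier :: "('a multiplier \<times> 'a multiplier) filter" where
  "uniformity_multiplier = (INF e\<in>{0 <..}. principal {(f, g :: 'a multiplier). dist f g < e})"

definition open_multiplier :: "'a multiplier set \<Rightarrow> bool" where
  "open_multiplier U \<longleftrightarrow> (\<forall>f\<in>U. \<forall>\<^sub>F (f', g :: 'a multiplier) in uniformity. f' = f \<longrightarrow> g \<in> U)"

context
  fixes A :: "'a cstar" and x :: 'a
  assumes A: "cstar_algebra A" and x: "x \<in> carrier A"
begin

lemma app_zero: "app 0 A x = \<zero>\<^bsub>A\<^esub>"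
  unfolding zero_multiplier_def
proof (rule app_multiplier_of[OF _ _ A x])
  show "\<exists>T. adj_pair B (\<lambda>_. \<zero>\<^bsub>B\<^esub>) T" if "cstar_algebra B" for B :: "'a cstar"
    using cstar_algebra.adj_pair_zero[OF that] by blast
  show "nrm B \<zero>\<^bsub>B\<^esub> \<le> 0 * nrm B y" if "cstar_algebra B" for B and y :: 'a
  proof -
    interpret B: cstar_algebra B by (fact that)
    show ?thesis by (simp add: B.nrm_zero)
  qed
qed

lemma app_plus: "app (f + g) A x = app f A x \<oplus>\<^bsub>A\<^esub> app g A x"
  unfolding plus_multiplier_def
proof -
  obtain C D where CD: "mbound f C" "mbound g D" using mbound_exists by metis
  show "app (multiplier_of (\<lambda>A x. app f A x \<oplus>\<^bsub>A\<^esub> app g A x)) A x = app f A x \<oplus>\<^bsub>A\<^esub> app g A x"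
  proof (rule app_multiplier_of[OF _ _ A x])
    show "\<exists>T. adj_pair B (\<lambda>x. app f B x \<oplus>\<^bsub>B\<^esub> app g B x) T" if "cstar_algebra B" for B
      by (rule exE[OF app_adj_pair[OF that, of f]], rule exE[OF app_adj_pair[OF that, of g]],
          rule exI, rule cstar_algebra.adj_pair_add[OF that])
    show "nrm B (app f B y \<oplus>\<^bsub>B\<^esub> app g B y) \<le> (C + D) * nrm B y"
      if "cstar_algebra B" "y \<in> carrier B" for B y
    proof -
      interpret B: cstar_algebra B by (fact that)
      show ?thesis
        using B.nrm_triangle[of "app f B y" "app g B y"] mboundD[OF CD(1) that] mboundD[OF CD(2) that] that
        by (simp add: app_closed distrib_right)
    qed
  qed
qed

lemma app_times: "app (f * g) A x = app f A (app g A x)"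
proof -
  obtain C D where CD: "mbound f C" "mbound g D" using mbound_exists by metis
  show "app (f * g) A x = app f A (app g A x)"
    unfolding times_multiplier_def
  proof (rule app_multiplier_of[OF _ _ A x])
    show "\<exists>T. adj_pair B (\<lambda>x. app f B (app g B x)) T" if "cstar_algebra B" for B
      by (rule exE[OF app_adj_pair[OF that, of f]], rule exE[OF app_adj_pair[OF that, of g]],
          rule exI, rule cstar_algebra.adj_pair_comp[OF that])
    show "nrm B (app f B (app g B y)) \<le> (C * D) * nrm B y"
      if "cstar_algebra B" "y \<in> carrier B" for B y
    proof -
      have "nrm B (app f B (app g B y)) \<le> C * nrm B (app g B y)"
        using that by (intro mboundD[OF CD(1)] app_closed)
      also have "\<dots> \<le> C * (D * nrm B y)"
        using CD that by (intro mult_left_mono mboundD) (auto simp: mbound_def)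
      finally show ?thesis by (simp add: mult.assoc)
    qed
  qed
qed

end

lemmas app_simps = app_zero app_plus app_times app_mscale

lemma app_uminus: "\<lbrakk>cstar_algebra A; x \<in> carrier A\<rbrakk> \<Longrightarrow> app (- f) A x = (- 1) \<odot>\<^bsub>A\<^esub> app f A x"
  by (simp add: uminus_multiplier_def app_simps app_closed)

lemma app_minus:
  assumes "cstar_algebra A" "x \<in> carrier A"
  shows "app (f - g) A x = app f A x \<ominus>\<^bsub>A\<^esub> app g A x"
proof -
  interpret cstar_algebra A by (fact assms)
  show ?thesis
    using assms by (simp add: minus_multiplier_def app_plus app_uminus minus_eq_csmult app_closed)
qed

lemma app_scaleR: "\<lbrakk>cstar_algebra A; x \<in> carrier A\<rbrakk> \<Longrightarrow> app (r *\<^sub>R f) A x = of_real r \<odot>\<^bsub>A\<^esub> app f A x"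
  by (simp add: scaleR_multiplier_def app_simps app_closed)

lemma mbound_norm: "mbound f (norm f)"
proof -
  have ne: "{C. mbound f C} \<noteq> {}" using mbound_exists by auto
  have "0 \<le> norm f"
    unfolding norm_multiplier_def by (rule cInf_greatest[OF ne]) (auto simp: mbound_def)
  moreover have "nrm A (app f A x) \<le> norm f * nrm A x" if A: "cstar_algebra A" and x: "x \<in> carrier A" for A x
  proof (cases "nrm A x = 0")
    case True
    obtain C where "mbound f C" using mbound_exists by metis
    with mboundD[OF this A x] True show ?thesis by simp
  next
    case False
    then have pos: "nrm A x > 0" using cstar_algebra.nrm_nonneg[OF A x] by simp
    have "nrm A (app f A x) / nrm A x \<le> norm f"
      unfolding norm_multiplier_def
      by (rule cInf_greatest[OF ne]) (use mboundD A x pos in \<open>auto simp: divide_le_eq\<close>)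
    with pos show ?thesis by (simp add: divide_le_eq)
  qed
  ultimately show ?thesis by (simp add: mbound_def)
qed

lemma norm_le_iff_mbound: "norm f \<le> C \<longleftrightarrow> mbound f C"
proof
  assume "norm f \<le> C"
  moreover have "nrm A (app f A x) \<le> C * nrm A x" if "norm f \<le> C" "cstar_algebra A" "x \<in> carrier A" for A x
    using mboundD[OF mbound_norm that(2,3)] mult_right_mono[OF that(1), of "nrm A x"]
      cstar_algebra.nrm_nonneg[OF that(2,3)] by (meson order_trans)
  ultimately show "mbound f C"
    using mbound_norm[of f] unfolding mbound_def by (meson order_trans)
next
  assume "mbound f C"
  then show "norm f \<le> C"
    unfolding norm_multiplier_def by (intro cInf_lower) (auto simp: bdd_below_def mbound_def)
qed

lemma nrm_app_le: "\<lbrakk>cstar_algebra A; x \<in> carrier A\<rbrakk> \<Longrightarrow> nrm A (app f A x) \<le> norm f * nrm A x"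
  by (rule mboundD[OF mbound_norm])

lemma norm_multiplier_nonneg: "0 \<le> norm (f :: 'a multiplier)"
  using mbound_norm by (simp add: mbound_def)

lemma norm_multiplier_leI:
  assumes "0 \<le> C" "\<And>A x. \<lbrakk>cstar_algebra A; x \<in> carrier A\<rbrakk> \<Longrightarrow> nrm A (app f A x) \<le> C * nrm A x"
  shows "norm (f :: 'a multiplier) \<le> C"
  using assms by (simp add: norm_le_iff_mbound mbound_def)

instance
proof
  fix f g h :: "'a multiplier" and r s :: real and c d :: complex
  note ac = app_simps app_uminus app_minus app_scaleR app_closed
  have cn: "normed_cspace A" if "cstar_algebra A" for A :: "'a cstar"
  proof -
    interpret cstar_algebra A by (fact that)
    show ?thesis by unfold_locales
  qed
  have ab: "abelian_group A" if "cstar_algebra A" for A :: "'a cstar"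
  proof -
    interpret cstar_algebra A by (fact that)
    show ?thesis by unfold_locales
  qed
  note am = ab[THEN abelian_group.axioms(1)]
  note cl = normed_cspace.csmult_closed[OF cn] normed_cspace.csmult_add_left[OF cn]
    normed_cspace.csmult_add_right[OF cn] normed_cspace.csmult_csmult[OF cn]
    normed_cspace.csmult_1[OF cn] normed_cspace.csmult_0[OF cn]
  show "f + g + h = f + (g + h)"
    by (rule multiplier_eqI) (simp add: ac abelian_monoid.a_assoc[OF am])
  show add_comm: "f + g = g + f" for f g :: "'a multiplier"
    by (rule multiplier_eqI) (simp add: ac abelian_monoid.a_comm[OF am])
  show "0 + f = f"
    by (rule multiplier_eqI) (simp add: ac abelian_monoid.l_zero[OF am])
  show "- f + f = 0"
    by (rule multiplier_eqI)
      (simp add: ac abelian_group.l_neg[OF ab] normed_cspace.csmult_minus_1[OF cn])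
  show "f - g = f + - g" by (simp add: minus_multiplier_def)
  show "r *\<^sub>R (f + g) = r *\<^sub>R f + r *\<^sub>R g"
    by (rule multiplier_eqI) (simp add: ac cl)
  show "(r + s) *\<^sub>R f = r *\<^sub>R f + s *\<^sub>R f"
    by (rule multiplier_eqI) (simp add: ac cl)
  show "r *\<^sub>R s *\<^sub>R f = (r * s) *\<^sub>R f"
    by (rule multiplier_eqI) (simp add: ac cl)
  show "1 *\<^sub>R f = f"
    by (rule multiplier_eqI) (simp add: ac cl)
  show "f * g * h = f * (g * h)"
    by (rule multiplier_eqI) (simp add: ac)
  show "(f + g) * h = f * h + g * h"
    by (rule multiplier_eqI) (simp add: ac)
  show "f * (g + h) = f * g + f * h"
    by (rule multiplier_eqI) (simp add: ac app_add_arg)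
  show "r *\<^sub>R f * g = r *\<^sub>R (f * g)"
    by (rule multiplier_eqI) (simp add: ac)
  show "f * r *\<^sub>R g = r *\<^sub>R (f * g)"
    by (rule multiplier_eqI) (simp add: ac app_smult_arg)
  show "dist f g = norm (f - g)" by (simp add: dist_multiplier_def)
  show "sgn f = inverse (norm f) *\<^sub>R f" by (simp add: sgn_multiplier_def)
  show "(uniformity :: ('a multiplier \<times> _) filter) = (INF e\<in>{0 <..}. principal {(f, g). dist f g < e})"
    by (simp add: uniformity_multiplier_def)
  show "open U \<longleftrightarrow> (\<forall>f\<in>U. \<forall>\<^sub>F (f', g) in uniformity. f' = f \<longrightarrow> g \<in> U)" for U :: "'a multiplier set"
    by (simp add: open_multiplier_def)
  show "norm f = 0 \<longleftrightarrow> f = 0"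
  proof
    assume n0: "norm f = 0"
    show "f = 0"
    proof (rule multiplier_eqI)
      fix A :: "'a cstar" and x assume Ax: "cstar_algebra A" "x \<in> carrier A"
      interpret cstar_algebra A by (fact Ax)
      have "nrm A (app f A x) = 0"
        using nrm_app_le[OF Ax, of f] n0 nrm_nonneg[OF app_closed[OF Ax, of f]] by simp
      then show "app f A x = app 0 A x"
        using Ax by (simp add: app_zero nrm_eq_0_iff app_closed)
    qed
  next
    assume "f = 0"
    then have "norm f \<le> 0"
      by (intro norm_multiplier_leI) (simp_all add: app_zero normed_cspace.nrm_zero[OF cn])
    then show "norm f = 0" using norm_multiplier_nonneg[of f] by simp
  qed
  show tri: "norm (f + g) \<le> norm f + norm g" for f g :: "'a multiplier"
  proof (rule norm_multiplier_leI)
    fix A :: "'a cstar" and x assume Ax: "cstar_algebra A" "x \<in> carrier A"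
    show "nrm A (app (f + g) A x) \<le> (norm f + norm g) * nrm A x"
      using cstar_algebra.nrm_triangle[OF Ax(1) app_closed[OF Ax, of f] app_closed[OF Ax, of g]]
        nrm_app_le[OF Ax, of f] nrm_app_le[OF Ax, of g]
      by (simp add: app_plus[OF Ax] distrib_right)
  qed (simp add: norm_multiplier_nonneg add_nonneg_nonneg)
  have mul: "norm (f * g) \<le> norm f * norm g" for f g :: "'a multiplier"
  proof (rule norm_multiplier_leI)
    fix A :: "'a cstar" and x assume Ax: "cstar_algebra A" "x \<in> carrier A"
    have "nrm A (app f A (app g A x)) \<le> norm f * nrm A (app g A x)"
      by (intro nrm_app_le app_closed Ax)
    also have "\<dots> \<le> norm f * (norm g * nrm A x)"
      by (intro mult_left_mono nrm_app_le Ax norm_multiplier_nonneg)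
    finally show "nrm A (app (f * g) A x) \<le> norm f * norm g * nrm A x"
      by (simp add: app_times[OF Ax] mult.assoc)
  qed (simp add: norm_multiplier_nonneg)
  show "norm (f * g) \<le> norm f * norm g" by (rule mul)
  \<comment> \<open>The reverse inequality will be the same one for
    \<open>inverse r\<close>.\<close>
  have scal: "norm (r *\<^sub>R f) \<le> \<bar>r\<bar> * norm f" for r and f :: "'a multiplier"
  proof (rule norm_multiplier_leI)
    fix A :: "'a cstar" and x assume Ax: "cstar_algebra A" "x \<in> carrier A"
    show "nrm A (app (r *\<^sub>R f) A x) \<le> \<bar>r\<bar> * norm f * nrm A x"
      using nrm_app_le[OF Ax, of f] cstar_algebra.nrm_smult[OF Ax(1) app_closed[OF Ax, of f]]
      by (simp add: app_scaleR[OF Ax] mult.assoc mult_left_mono)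
  qed (simp add: norm_multiplier_nonneg)
  show "norm (r *\<^sub>R f) = \<bar>r\<bar> * norm f"
  proof (cases "r = 0")
    case True
    then show ?thesis using scal[of r f] norm_multiplier_nonneg[of "r *\<^sub>R f"] by simp
  next
    case False
    have "inverse r *\<^sub>R (r *\<^sub>R f) = f"
      using False by (intro multiplier_eqI) (simp add: ac cl)
    then have "norm f \<le> \<bar>inverse r\<bar> * norm (r *\<^sub>R f)"
      using scal[of "inverse r" "r *\<^sub>R f"] by simp
    then have "\<bar>r\<bar> * norm f \<le> norm (r *\<^sub>R f)"
      using False by (simp add: abs_inverse field_simps)
    with scal[of r f] show ?thesis by simp
  qed
qed

end

section \<open>Completeness of the multiplier algebra\<close>

lemma app_converges:
  assumes F: "Cauchy F" and A: "cstar_algebra A" and x: "x \<in> carrier A"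
  shows "\<exists>l\<in>carrier A. (\<lambda>n. nrm A (app (F n) A x \<ominus>\<^bsub>A\<^esub> l)) \<longlonglongrightarrow> 0"
proof -
  interpret cstar_algebra A by (fact A)
  show ?thesis
  proof (rule complete_seq)
    show "app (F n) A x \<in> carrier A" for n by (rule app_closed[OF A x])
    show "\<exists>N. \<forall>m n. N \<le> m \<longrightarrow> N \<le> n \<longrightarrow> nrm A (app (F m) A x \<ominus>\<^bsub>A\<^esub> app (F n) A x) < \<epsilon>"
      if "\<epsilon> > 0" for \<epsilon>
    proof -
      have p: "nrm A x + 1 > 0" using nrm_nonneg[OF x] by simp
      then have "\<epsilon> / (nrm A x + 1) > 0" using that by simp
      then obtain N where N: "\<And>m n. m \<ge> N \<Longrightarrow> n \<ge> N \<Longrightarrow> norm (F m - F n) < \<epsilon> / (nrm A x + 1)"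
        using CauchyD[OF F] by blast
      have "nrm A (app (F m) A x \<ominus>\<^bsub>A\<^esub> app (F n) A x) < \<epsilon>" if "N \<le> m" "N \<le> n" for m n
      proof -
        have "nrm A (app (F m - F n) A x) \<le> norm (F m - F n) * nrm A x"
          by (rule nrm_app_le[OF A x])
        also have "\<dots> \<le> norm (F m - F n) * (nrm A x + 1)"
          by (intro mult_left_mono) auto
        also have "\<dots> < \<epsilon>" using N[OF that] p by (simp add: less_divide_eq)
        finally show ?thesis by (simp add: app_minus[OF A x])
      qed
      then show ?thesis by blast
    qed
  qed blast
qed

lemma madj_minus: "madj (f - g) = madj f - madj g"
proof (rule madj_eqI)
  fix A :: "'a cstar" assume A: "cstar_algebra A"
  interpret cstar_algebra A by (fact A)
  have 1: "adj_pair A (\<lambda>x. app f A x \<oplus>\<^bsub>A\<^esub> (- 1) \<odot>\<^bsub>A\<^esub> app g A x)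
      (\<lambda>x. app (madj f) A x \<oplus>\<^bsub>A\<^esub> app (madj g) A (cnj (- 1) \<odot>\<^bsub>A\<^esub> x))"
    by (rule adj_pair_add[OF adj_pair_madj[OF A] adj_pair_comp[OF adj_pair_smult adj_pair_madj[OF A]]])
  show "adj_pair A (app (f - g) A) (app (madj f - madj g) A)"
    by (rule adj_pair_cong[OF 1])
      (simp_all add: app_minus[OF A] app_smult_arg[OF A] minus_eq_csmult app_closed[OF A])
qed

lemma norm_madj_le: "norm (madj f) \<le> norm f"
  by (rule norm_multiplier_leI[OF norm_ge_zero])
     (rule cstar_algebra.adj_pair_bound[OF _ adj_pair_madj], auto intro: nrm_app_le)

text \<open>A Cauchy sequence converges pointwise on every carrier. To see that the limit is again
  adjointable, the sequence of adjoints is followed as well: it is Cauchy because the involution is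
  contractive, and its pointwise limit provides the adjoint.\<close>

instance multiplier :: (type) complete_space
proof
  fix F :: "nat \<Rightarrow> 'a multiplier" assume F: "Cauchy F"
  have F': "Cauchy (\<lambda>n. madj (F n))"
  proof (rule CauchyI)
    fix e :: real assume "e > 0"
    then obtain N where "\<And>m n. m \<ge> N \<Longrightarrow> n \<ge> N \<Longrightarrow> norm (F m - F n) < e"
      using CauchyD[OF F] by blast
    then have "norm (madj (F m) - madj (F n)) < e" if "m \<ge> N" "n \<ge> N" for m n
      using norm_madj_le[of "F m - F n"] that by (fastforce simp: madj_minus)
    then show "\<exists>M. \<forall>m\<ge>M. \<forall>n\<ge>M. norm (madj (F m) - madj (F n)) < e" by blast
  qed
  define S where "S A x = (SOME l. l \<in> carrier A \<and> (\<lambda>n. nrm A (app (F n) A x \<ominus>\<^bsub>A\<^esub> l)) \<longlonglongrightarrow> 0)" for A x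
  define T where "T A x = (SOME l. l \<in> carrier A \<and> (\<lambda>n. nrm A (app (madj (F n)) A x \<ominus>\<^bsub>A\<^esub> l)) \<longlonglongrightarrow> 0)" for A x
  have S: "S A x \<in> carrier A \<and> (\<lambda>n. nrm A (app (F n) A x \<ominus>\<^bsub>A\<^esub> S A x)) \<longlonglongrightarrow> 0"
    if "cstar_algebra A" "x \<in> carrier A" for A x
    unfolding S_def by (rule someI_ex) (use app_converges[OF F that] in blast)
  have T: "T A x \<in> carrier A \<and> (\<lambda>n. nrm A (app (madj (F n)) A x \<ominus>\<^bsub>A\<^esub> T A x)) \<longlonglongrightarrow> 0"
    if "cstar_algebra A" "x \<in> carrier A" for A x
    unfolding T_def by (rule someI_ex) (use app_converges[OF F' that] in blast)
  have ST: "adj_pair A (S A) (T A)" if A: "cstar_algebra A" for A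
    by (rule cstar_algebra.adj_pair_limit[OF A adj_pair_madj[OF A] S[OF A] T[OF A]])
  \<comment> \<open>Let \<open>m\<close> tend to infinity in the Cauchy estimate. The bound is
    uniform in \<open>A\<close> and \<open>x\<close>, hence a bound for the norm of the
    multiplier.\<close>
  have approx: "nrm A (app (F n) A x \<ominus>\<^bsub>A\<^esub> S A x) \<le> e * nrm A x"
    if N: "\<And>m n. m \<ge> N \<Longrightarrow> n \<ge> N \<Longrightarrow> norm (F m - F n) < e" and n: "n \<ge> N"
      and A: "cstar_algebra A" and x: "x \<in> carrier A" for A x n N e
  proof -
    interpret cstar_algebra A by (fact A)
    have le: "nrm A (app (F n) A x \<ominus>\<^bsub>A\<^esub> S A x) \<le> e * nrm A x + nrm A (app (F m) A x \<ominus>\<^bsub>A\<^esub> S A x)"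
      if "m \<ge> N" for m
    proof -
      have "nrm A (app (F n) A x \<ominus>\<^bsub>A\<^esub> app (F m) A x) \<le> norm (F n - F m) * nrm A x"
        using nrm_app_le[OF A x, of "F n - F m"] by (simp add: app_minus[OF A x])
      also have "\<dots> \<le> e * nrm A x"
        by (intro mult_right_mono nrm_nonneg x less_imp_le N n that)
      finally show ?thesis
        using nrm_minus_triangle[OF app_closed[OF A x] app_closed[OF A x] S[OF A x, THEN conjunct1],
            of "F n" "F m"] by linarith
    qed
    have "(\<lambda>m. e * nrm A x + nrm A (app (F m) A x \<ominus>\<^bsub>A\<^esub> S A x)) \<longlonglongrightarrow> e * nrm A x + 0"
      using S[OF A x] by (intro tendsto_intros) auto
    then show ?thesis
      using le by (intro LIMSEQ_le_const[of _ "e * nrm A x"]) auto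
  qed
  obtain N1 where N1: "\<And>m n. m \<ge> N1 \<Longrightarrow> n \<ge> N1 \<Longrightarrow> norm (F m - F n) < 1"
    using CauchyD[OF F, of 1] by auto
  define g where "g = multiplier_of S"
  have g: "app g A x = S A x" if "cstar_algebra A" "x \<in> carrier A" for A x
    unfolding g_def
  proof (rule app_multiplier_of[OF _ _ that])
    show "\<exists>T. adj_pair B (S B) T" if "cstar_algebra B" for B
      by (rule exI, rule ST[OF that])
    show "nrm B (S B y) \<le> (1 + norm (F N1)) * nrm B y" if "cstar_algebra B" "y \<in> carrier B" for B y
    proof -
      interpret B: cstar_algebra B by (fact that)
      note c = S[OF that, THEN conjunct1] app_closed[OF that, of "F N1"]
      have "S B y = (S B y \<ominus>\<^bsub>B\<^esub> app (F N1) B y) \<oplus>\<^bsub>B\<^esub> app (F N1) B y"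
        using c by (simp add: a_minus_def B.M.a_assoc B.M.l_neg)
      then have "nrm B (S B y) \<le> nrm B (S B y \<ominus>\<^bsub>B\<^esub> app (F N1) B y) + nrm B (app (F N1) B y)"
        using B.nrm_triangle[OF B.M.minus_closed[OF c] c(2)] by simp
      moreover have "nrm B (app (F N1) B y \<ominus>\<^bsub>B\<^esub> S B y) \<le> 1 * nrm B y"
        by (rule approx[where N = N1]) (use N1 that in auto)
      ultimately show ?thesis
        using nrm_app_le[OF that, of "F N1"] B.nrm_minus_commute[OF c]
        by (simp add: distrib_right)
    qed
  qed
  have "F \<longlonglongrightarrow> g"
  proof (rule LIMSEQ_I)
    fix r :: real assume r: "r > 0"
    then obtain N where N: "\<And>m n. m \<ge> N \<Longrightarrow> n \<ge> N \<Longrightarrow> norm (F m - F n) < r / 2"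
      using CauchyD[OF F, of "r / 2"] by auto
    have "norm (F n - g) \<le> r / 2" if "n \<ge> N" for n
    proof (rule norm_multiplier_leI)
      show "nrm A (app (F n - g) A x) \<le> r / 2 * nrm A x" if "cstar_algebra A" "x \<in> carrier A" for A x
        unfolding app_minus[OF that] g[OF that]
        by (rule approx[where N = N]) (use N \<open>n \<ge> N\<close> that in auto)
    qed (use r in simp)
    then show "\<exists>no. \<forall>n\<ge>no. norm (F n - g) < r" using r by (intro exI[of _ N]) fastforce
  qed
  then show "convergent F" by (rule convergentI)
qed

instance multiplier :: (type) banach ..

section \<open>Unit, involution and C*-identity for multipliers\<close>

instantiation multiplier :: (type) cstar_unital
begin

definition one_multiplier :: "'a multiplier" where
  "one_multiplier = multiplier_of (\<lambda>A x. x)"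

definition cscale_multiplier :: "complex \<Rightarrow> 'a multiplier" where
  "cscale_multiplier = mscale"

definition adj_multiplier :: "'a multiplier \<Rightarrow> 'a multiplier" where
  "adj_multiplier = madj"

lemma app_one:
  assumes "cstar_algebra A" "x \<in> carrier A"
  shows "app 1 A x = x"
  unfolding one_multiplier_def
proof (rule app_multiplier_of[OF _ _ assms, where C = 1])
  show "\<exists>T. adj_pair B (\<lambda>x. x) T" if "cstar_algebra B" for B :: "'a cstar"
    by (rule exI, rule cstar_algebra.adj_pair_id[OF that])
qed simp

instance
proof
  fix f g :: "'a multiplier" and r :: real and c d :: complex
  note ac = app_one app_simps app_minus app_scaleR app_closed cscale_multiplier_def adj_multiplier_def
  have cn: "normed_cspace A" if "cstar_algebra A" for A :: "'a cstar"
  proof -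
    interpret cstar_algebra A by (fact that)
    show ?thesis by unfold_locales
  qed
  note cl = normed_cspace.csmult_closed[OF cn] normed_cspace.csmult_add_left[OF cn]
    normed_cspace.csmult_csmult[OF cn]
  show "1 * f = f" "f * 1 = f"
    by (rule multiplier_eqI, simp add: ac)+
  have pair_adj: "adj_pair A (app (madj f) A) (app f A)" if "cstar_algebra A" for A and f :: "'a multiplier"
    using cstar_algebra.adj_pair_sym[OF that adj_pair_madj[OF that]] .
  show "adj (adj f) = f"
    unfolding adj_multiplier_def by (rule madj_eqI) (rule pair_adj)
  show "adj (f + g) = adj f + adj g"
    unfolding adj_multiplier_def
    by (rule madj_eqI, rule adj_pair_cong[OF cstar_algebra.adj_pair_add[OF _ adj_pair_madj adj_pair_madj]])
       (simp_all add: app_plus)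
  show "adj (f * g) = adj g * adj f"
    unfolding adj_multiplier_def
    by (rule madj_eqI, rule adj_pair_cong[OF cstar_algebra.adj_pair_comp[OF _ adj_pair_madj adj_pair_madj]])
       (simp_all add: app_times)
  show "adj (cscale c) = (cscale (cnj c) :: 'a multiplier)"
    unfolding adj_multiplier_def cscale_multiplier_def
    by (rule madj_eqI, rule adj_pair_cong[OF cstar_algebra.adj_pair_smult])
       (simp_all add: app_mscale)
  show "cscale (c + d) = (cscale c + cscale d :: 'a multiplier)"
    by (rule multiplier_eqI) (simp add: ac cl)
  show "cscale (c * d) = (cscale c * cscale d :: 'a multiplier)"
    by (rule multiplier_eqI) (simp add: ac cl)
  show "cscale (of_real r) = (r *\<^sub>R 1 :: 'a multiplier)"
    by (rule multiplier_eqI) (simp add: ac cl)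
  show "f * cscale c = cscale c * f"
    by (rule multiplier_eqI) (simp add: ac cl app_smult_arg)
  show "norm (adj f * f) = (norm f)\<^sup>2"
  proof (rule antisym)
    have "norm (adj f * f) \<le> norm f * norm f"
      using norm_mult_ineq[of "adj f" f] mult_right_mono[OF norm_madj_le[of f] norm_ge_zero[of f]]
      unfolding adj_multiplier_def by linarith
    then show "norm (adj f * f) \<le> (norm f)\<^sup>2" by (simp add: power2_eq_square)
    \<comment> \<open>On each carrier, the C*-identity of the algebra turns the square of the norm
      of \<open>f x\<close> into the norm of the inner product of \<open>x\<close> and
      \<open>adj f * f\<close> applied to \<open>x\<close>.\<close>
    have "norm f \<le> sqrt (norm (adj f * f))"
    proof (rule norm_multiplier_leI)
      fix A :: "'a cstar" and x assume Ax: "cstar_algebra A" "x \<in> carrier A"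
      interpret cstar_algebra A by (fact Ax)
      note cl = Ax app_closed[OF Ax] app_closed[OF Ax(1) app_closed[OF Ax]]
      have "(nrm A (app f A x))\<^sup>2 = nrm A (star A (app f A x) \<otimes>\<^bsub>A\<^esub> app f A x)"
        using cl by (simp add: cstar_identity)
      also have "\<dots> = nrm A (star A x \<otimes>\<^bsub>A\<^esub> app (adj f * f) A x)"
        using cl adj_pair_eq[OF adj_pair_madj[OF Ax(1)] Ax(2) app_closed[OF Ax], of f f]
        by (simp add: app_times adj_multiplier_def)
      also have "\<dots> \<le> nrm A x * nrm A (app (adj f * f) A x)"
        using nrm_mult[OF star_closed[OF Ax(2)] app_closed[OF Ax, of "adj f * f"]]
        by (simp only: nrm_star[OF Ax(2)])
      also have "\<dots> \<le> nrm A x * (norm (adj f * f) * nrm A x)"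
        by (intro mult_left_mono nrm_app_le Ax nrm_nonneg)
      finally have "(nrm A (app f A x))\<^sup>2 \<le> norm (adj f * f) * (nrm A x)\<^sup>2"
        by (simp add: power2_eq_square mult_ac)
      then have "nrm A (app f A x) \<le> sqrt (norm (adj f * f) * (nrm A x)\<^sup>2)"
        by (rule real_le_rsqrt)
      then show "nrm A (app f A x) \<le> sqrt (norm (adj f * f)) * nrm A x"
        using nrm_nonneg[OF Ax(2)] by (simp add: real_sqrt_mult)
    qed simp
    then have "(norm f)\<^sup>2 \<le> (sqrt (norm (adj f * f)))\<^sup>2" by (intro power_mono norm_ge_zero)
    then show "(norm f)\<^sup>2 \<le> norm (adj f * f)" by simp
  qed
qed

end

section \<open>The embedding of an algebra\<close>

text \<open>Left multiplication on \<open>A\<close> itself and zero on every other algebra. Thanks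
  to the zeros, products of arbitrary multipliers with elements of the image stay in the
  image.\<close>

definition emb :: "'a cstar \<Rightarrow> 'a \<Rightarrow> 'a multiplier" where
  "emb A a = multiplier_of (\<lambda>B x. if B = A then a \<otimes>\<^bsub>A\<^esub> x else \<zero>\<^bsub>B\<^esub>)"

context cstar_algebra
begin

lemma app_emb:
  assumes a: "a \<in> carrier A" and B: "cstar_algebra B" and x: "x \<in> carrier B"
  shows "app (emb A a) B x = (if B = A then a \<otimes> x else \<zero>\<^bsub>B\<^esub>)"
  unfolding emb_def
proof (rule app_multiplier_of[OF _ _ B x])
  show "\<exists>T. adj_pair B (\<lambda>x. if B = A then a \<otimes> x else \<zero>\<^bsub>B\<^esub>) T" if "cstar_algebra B" for B
  proof (cases "B = A")
    case True
    then show ?thesis using adj_pair_left_mult[OF a] by auto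
  next
    case False
    then show ?thesis using cstar_algebra.adj_pair_zero[OF that] by auto
  qed
  show "nrm B (if B = A then a \<otimes> y else \<zero>\<^bsub>B\<^esub>) \<le> nrm A a * nrm B y"
    if "cstar_algebra B" "y \<in> carrier B" for B y
  proof -
    interpret B: cstar_algebra B by (fact that)
    show ?thesis
      using that a by (auto simp: nrm_mult B.nrm_zero nrm_nonneg B.nrm_nonneg)
  qed
qed

lemma app_emb_self: "\<lbrakk>a \<in> carrier A; x \<in> carrier A\<rbrakk> \<Longrightarrow> app (emb A a) A x = a \<otimes> x"
  by (simp add: app_emb[OF _ cstar_algebra_axioms])

lemma emb_eqI:
  assumes "a \<in> carrier A"
    and "\<And>x. x \<in> carrier A \<Longrightarrow> app u A x = a \<otimes> x"
    and "\<And>B x. \<lbrakk>cstar_algebra B; x \<in> carrier B; B \<noteq> A\<rbrakk> \<Longrightarrow> app u B x = \<zero>\<^bsub>B\<^esub>"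
  shows "u = emb A a"
  by (rule multiplier_eqI) (use assms in \<open>auto simp: app_emb\<close>)

lemma emb_add:
  assumes "x \<in> carrier A" "y \<in> carrier A"
  shows "emb A (x \<oplus> y) = emb A x + emb A y"
proof (rule emb_eqI[symmetric])
  show "app (emb A x + emb A y) B z = \<zero>\<^bsub>B\<^esub>" if "cstar_algebra B" "z \<in> carrier B" "B \<noteq> A" for B z
  proof -
    interpret B: cstar_algebra B by (fact that)
    show ?thesis using that assms by (simp add: app_plus app_emb)
  qed
qed (use assms cstar_algebra_axioms in \<open>simp_all add: app_plus app_emb mult_add_left\<close>)

text \<open>\<open>u\<close> commutes with right multiplications, so left multiplication by
  \<open>x\<close> followed by \<open>u\<close> is left multiplication by the image of
  \<open>x\<close> under \<open>u\<close>. The image of \<open>A\<close> is thus a left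
  ideal.\<close>

lemma mult_emb:
  assumes "x \<in> carrier A"
  shows "u * emb A x = emb A (app u A x)"
proof (rule emb_eqI)
  note A = cstar_algebra_axioms
  show "app u A x \<in> carrier A" by (rule app_closed[OF A assms])
  show "app (u * emb A x) A y = app u A x \<otimes> y" if "y \<in> carrier A" for y
    using that assms by (simp add: app_times[OF A] app_emb_self app_mult_arg[OF A])
  show "app (u * emb A x) B z = \<zero>\<^bsub>B\<^esub>" if "cstar_algebra B" "z \<in> carrier B" "B \<noteq> A" for B z
  proof -
    interpret B: cstar_algebra B by (fact that)
    have "app u B \<zero>\<^bsub>B\<^esub> = app u B (0 \<odot>\<^bsub>B\<^esub> \<zero>\<^bsub>B\<^esub>)" by (simp add: B.csmult_zero)
    also have "\<dots> = \<zero>\<^bsub>B\<^esub>"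
      by (simp only: app_smult_arg[OF that(1) B.M.zero_closed]
          B.csmult_0[OF app_closed[OF that(1) B.M.zero_closed]])
    finally show ?thesis using that assms by (simp add: app_times app_emb)
  qed
qed

lemma emb_smult: "x \<in> carrier A \<Longrightarrow> emb A (c \<odot> x) = cscale c * emb A x"
  by (simp add: mult_emb cscale_multiplier_def app_mscale[OF cstar_algebra_axioms])

lemma emb_mult: "\<lbrakk>x \<in> carrier A; y \<in> carrier A\<rbrakk> \<Longrightarrow> emb A (x \<otimes> y) = emb A x * emb A y"
  by (simp add: mult_emb app_emb_self)

lemma emb_minus: "\<lbrakk>x \<in> carrier A; y \<in> carrier A\<rbrakk> \<Longrightarrow> emb A (x \<ominus> y) = emb A x - emb A y"
  by (simp add: minus_eq_csmult emb_add emb_smult csmult_closed cscale_minus)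

lemma emb_zero: "emb A \<zero> = 0"
  using emb_smult[of \<zero> 0] by (simp add: csmult_0)

lemma emb_star:
  assumes "x \<in> carrier A"
  shows "emb A (star A x) = adj (emb A x)"
  unfolding adj_multiplier_def
proof (rule madj_eqI[symmetric])
  fix B :: "'a cstar" assume B: "cstar_algebra B"
  note s = star_closed[OF assms]
  show "adj_pair B (app (emb A x) B) (app (emb A (star A x)) B)"
  proof (cases "B = A")
    case True
    show ?thesis unfolding True
      by (rule adj_pair_cong[OF adj_pair_left_mult[OF assms]]) (simp_all add: app_emb_self assms s)
  next
    case False
    show ?thesis
      by (rule adj_pair_cong[OF cstar_algebra.adj_pair_zero[OF B]])
        (simp_all add: app_emb[OF _ B] assms s False)
  qed
qed

text \<open>The lower bound comes from evaluating at \<open>star A x\<close>.\<close>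

lemma norm_emb:
  assumes x: "x \<in> carrier A"
  shows "norm (emb A x) = nrm A x"
proof (rule antisym)
  note s = star_closed[OF x]
  show "norm (emb A x) \<le> nrm A x"
  proof (rule norm_multiplier_leI[OF nrm_nonneg[OF x]])
    fix B :: "'a cstar" and y assume By: "cstar_algebra B" "y \<in> carrier B"
    interpret B: cstar_algebra B by (fact By)
    show "nrm B (app (emb A x) B y) \<le> nrm A x * nrm B y"
      using By x by (auto simp: app_emb nrm_mult B.nrm_zero nrm_nonneg B.nrm_nonneg)
  qed
  have "(nrm A x)\<^sup>2 = nrm A (app (emb A x) A (star A x))"
    using cstar_identity[OF s] by (simp add: app_emb_self x s star_star nrm_star)
  also have "\<dots> \<le> norm (emb A x) * nrm A x"
    using nrm_app_le[OF cstar_algebra_axioms s, of "emb A x"] by (simp only: nrm_star[OF x])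
  finally have "nrm A x * nrm A x \<le> norm (emb A x) * nrm A x" by (simp add: power2_eq_square)
  then show "nrm A x \<le> norm (emb A x)"
    using nrm_nonneg[OF x] by (cases "nrm A x = 0") auto
qed

lemma norm_emb_minus: "\<lbrakk>x \<in> carrier A; y \<in> carrier A\<rbrakk> \<Longrightarrow> norm (emb A x - emb A y) = nrm A (x \<ominus> y)"
  by (metis emb_minus norm_emb M.minus_closed)

lemma emb_inj: "\<lbrakk>x \<in> carrier A; y \<in> carrier A; emb A x = emb A y\<rbrakk> \<Longrightarrow> x = y"
  using norm_emb_minus[of x y] by (simp add: nrm_eq_0_iff eq_iff_minus_eq_zero)

text \<open>The right ideal property, from \<open>mult_emb\<close> by taking adjoints. It brings
  elements constructed in the multiplier algebra, such as approximate units, back into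
  \<open>A\<close>.\<close>

lemma emb_mult_right:
  assumes "x \<in> carrier A"
  shows "\<exists>c\<in>carrier A. emb A x * u = emb A c"
proof -
  note s = star_closed[OF assms]
  note t = app_closed[OF cstar_algebra_axioms s, of "adj u"]
  have "adj (adj u * emb A (star A x)) = adj (emb A (app (adj u) A (star A x)))"
    by (simp only: mult_emb[OF s])
  then have "emb A x * u = emb A (star A (app (adj u) A (star A x)))"
    by (simp only: adj_mult adj_adj emb_star[OF assms] emb_star[OF t])
  then show ?thesis using star_closed[OF t] by blast
qed

lemma emb_image_closed:
  assumes a: "\<And>n :: nat. a n \<in> carrier A" and lim: "(\<lambda>n. emb A (a n)) \<longlonglongrightarrow> u"
  shows "\<exists>c\<in>carrier A. u = emb A c"
proof -
  have "Cauchy (\<lambda>n. emb A (a n))" using lim LIMSEQ_imp_Cauchy by blast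
  then have C: "\<exists>N. \<forall>m n. N \<le> m \<longrightarrow> N \<le> n \<longrightarrow> nrm A (a m \<ominus> a n) < \<epsilon>" if "\<epsilon> > 0" for \<epsilon>
    using CauchyD[OF _ that] norm_emb_minus[OF a a] by (metis (no_types, lifting))
  obtain l where l: "l \<in> carrier A" "(\<lambda>n. nrm A (a n \<ominus> l)) \<longlonglongrightarrow> 0"
    using complete_seq[OF a C] by blast
  have "(\<lambda>n. emb A (a n) - emb A l) \<longlonglongrightarrow> 0"
    using l(2) by (subst tendsto_norm_zero_iff[symmetric]) (simp only: norm_emb_minus[OF a l(1)])
  then have "(\<lambda>n. emb A (a n)) \<longlonglongrightarrow> emb A l" by (rule LIM_zero_cancel)
  then have "u = emb A l" using lim LIMSEQ_unique by blast
  with l(1) show ?thesis by blast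
qed

lemma approximate_unit:
  assumes x: "x \<in> carrier A" and "\<epsilon> > 0"
  shows "\<exists>e\<in>carrier A. star A e = e \<and> nrm A e \<le> 1 \<and> nrm A (x \<ominus> e \<otimes> x) \<le> \<epsilon>"
proof -
  obtain u where u: "adj (emb A x * u) = emb A x * u" "norm (emb A x * u) \<le> 1"
      "norm (emb A x - emb A x * u * emb A x) \<le> \<epsilon>"
    using approximate_left_unit[OF assms(2)] by blast
  obtain e where e: "e \<in> carrier A" "emb A x * u = emb A e"
    using emb_mult_right[OF x] by blast
  have "emb A (star A e) = emb A e"
    unfolding emb_star[OF e(1)] using u(1) unfolding e(2) .
  then have "star A e = e" using emb_inj e(1) star_closed by blast
  moreover have "nrm A e \<le> 1" using u(2) unfolding e(2) norm_emb[OF e(1)] .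
  moreover have "nrm A (x \<ominus> e \<otimes> x) \<le> \<epsilon>"
    using u(3) unfolding e(2) emb_mult[OF e(1) x, symmetric]
      norm_emb_minus[OF x mult_closed[OF e(1) x]] .
  ultimately show ?thesis using e(1) by blast
qed

text \<open>The square root \<open>q\<close> of \<open>D = emb A d\<close> exists among the
  multipliers and has to be located in \<open>A\<close>. With \<open>r\<close> the inverse of
  \<open>D + \<delta>\<close>, the product \<open>q * (D * r)\<close> lies in the ideal
  \<open>A\<close>, and it differs from \<open>q\<close> by
  \<open>q * (\<delta> *\<^sub>R r)\<close>, of norm at most \<open>sqrt \<delta>\<close>. As
  \<open>A\<close> is closed, \<open>q\<close> belongs to it.\<close>

lemma pos_emb_eq_star_mult_self:
  assumes d: "d \<in> carrier A" and pos: "pos (emb A d)"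
  shows "\<exists>s\<in>carrier A. d = star A s \<otimes> s"
proof -
  define D where "D = emb A d"
  obtain q where q: "pos q" "q * q = D"
    using pos_sqrt[OF pos] unfolding D_def by blast
  have aq: "adj q = q" by (rule pos_adj[OF q(1)])
  have "\<exists>c\<in>carrier A. norm (emb A c - q) \<le> sqrt \<delta>" if \<delta>: "\<delta> > 0" for \<delta>
  proof -
    obtain r where r: "adj r = r" "(D + \<delta> *\<^sub>R 1) * r = 1"
      "norm (\<delta> *\<^sub>R r) \<le> 1" "norm (D * r) \<le> 1"
      using pos_resolvent[OF pos \<delta>] unfolding D_def by metis
    have "D * r + \<delta> *\<^sub>R r = 1" using r(2) by (simp add: distrib_right)
    then have one: "q - q * (D * r) = q * (\<delta> *\<^sub>R r)"
      by (metis add_diff_cancel_left' mult.right_neutral right_diff_distrib)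
    have "(norm (q - q * (D * r)))\<^sup>2 = norm (adj (q * (\<delta> *\<^sub>R r)) * (q * (\<delta> *\<^sub>R r)))"
      unfolding one cstar_norm ..
    also have "adj (q * (\<delta> *\<^sub>R r)) * (q * (\<delta> *\<^sub>R r)) = (\<delta> *\<^sub>R r) * ((q * q) * (\<delta> *\<^sub>R r))"
      by (simp only: adj_mult adj_scaleR r(1) aq mult.assoc)
    also have "\<dots> = \<delta> *\<^sub>R ((\<delta> *\<^sub>R r) * (D * r))"
      by (simp add: q(2))
    also have "norm \<dots> \<le> \<delta>"
    proof -
      have "norm ((\<delta> *\<^sub>R r) * (D * r)) \<le> 1 * 1"
        by (rule order_trans[OF norm_mult_ineq mult_mono]) (use r(3,4) in auto)
      then show ?thesis using \<delta> by simp
    qed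
    finally have "norm (q * (D * r) - q) \<le> sqrt \<delta>"
      by (simp add: real_le_rsqrt norm_minus_commute)
    moreover obtain c where "c \<in> carrier A" "q * (D * r) = emb A c"
      using emb_mult_right[OF app_closed[OF cstar_algebra_axioms d, of q], of r]
      unfolding D_def by (metis mult.assoc mult_emb[OF d])
    ultimately show ?thesis by auto
  qed
  then have "\<exists>c\<in>carrier A. norm (emb A c - q) \<le> sqrt (inverse (real (Suc n)))" for n
    by simp
  then obtain c where c: "\<And>n. c n \<in> carrier A"
      "\<And>n. norm (emb A (c n) - q) \<le> sqrt (inverse (real (Suc n)))"
    by metis
  have "(\<lambda>n. sqrt (inverse (real (Suc n)))) \<longlonglongrightarrow> sqrt 0"
    by (intro tendsto_real_sqrt LIMSEQ_inverse_real_of_nat)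
  then have "(\<lambda>n. sqrt (inverse (real (Suc n)))) \<longlonglongrightarrow> 0"
    by (simp only: real_sqrt_zero)
  then have "(\<lambda>n. emb A (c n) - q) \<longlonglongrightarrow> 0"
    by (rule Lim_null_comparison[rotated]) (intro always_eventually allI c(2))
  then have "(\<lambda>n. emb A (c n)) \<longlonglongrightarrow> q" by (rule LIM_zero_cancel)
  from emb_image_closed[OF c(1) this] obtain s where s: "s \<in> carrier A" "q = emb A s" by blast
  have "emb A d = emb A (star A s \<otimes> s)"
    using q(2) aq s by (simp add: D_def emb_mult emb_star star_closed)
  then have "d = star A s \<otimes> s"
    using emb_inj d s(1) mult_closed star_closed by blast
  with s(1) show ?thesis by blast
qed

end

section \<open>Completely positive contractive maps\<close>

locale cpc_map = A: cstar_algebra A + B: cstar_algebra B for A :: "'a cstar" and B :: "'b cstar" +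
  fixes \<phi> :: "'a \<Rightarrow> 'b"
  assumes cpc: "cpc A B \<phi>"
begin

lemma closed: "x \<in> carrier A \<Longrightarrow> \<phi> x \<in> carrier B"
  and add: "\<lbrakk>x \<in> carrier A; y \<in> carrier A\<rbrakk> \<Longrightarrow> \<phi> (x \<oplus>\<^bsub>A\<^esub> y) = \<phi> x \<oplus>\<^bsub>B\<^esub> \<phi> y"
  and smult: "x \<in> carrier A \<Longrightarrow> \<phi> (c \<odot>\<^bsub>A\<^esub> x) = c \<odot>\<^bsub>B\<^esub> \<phi> x"
  and contractive: "x \<in> carrier A \<Longrightarrow> nrm B (\<phi> x) \<le> nrm A x"
  using cpc by (auto simp: cpc_def completely_positive_def linear_map_def)

lemma minus: "\<lbrakk>x \<in> carrier A; y \<in> carrier A\<rbrakk> \<Longrightarrow> \<phi> (x \<ominus>\<^bsub>A\<^esub> y) = \<phi> x \<ominus>\<^bsub>B\<^esub> \<phi> y"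
  by (simp add: A.minus_eq_csmult B.minus_eq_csmult add smult A.csmult_closed closed)

text \<open>The matrix with first row \<open>x\<close>, \<open>y\<close> and second row zero shows
  that the Gram matrix of \<open>x\<close> and \<open>y\<close> is positive. Complete positivity
  factorizes its image under \<open>\<phi>\<close>; the pairs \<open>b0\<close>, \<open>b1\<close>
  and \<open>c0\<close>, \<open>c1\<close> are the columns of the factor. Inequalities for
  \<open>\<phi>\<close> become inequalities between such pairs.\<close>

lemma gram:
  assumes "x \<in> carrier A" "y \<in> carrier A"
  obtains b0 b1 c0 c1 where
    "emb B (\<phi> (star A x \<otimes>\<^bsub>A\<^esub> x)) = adj b0 * b0 + adj b1 * b1"
    "emb B (\<phi> (star A x \<otimes>\<^bsub>A\<^esub> y)) = adj b0 * c0 + adj b1 * c1"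
    "emb B (\<phi> (star A y \<otimes>\<^bsub>A\<^esub> x)) = adj c0 * b0 + adj c1 * b1"
    "emb B (\<phi> (star A y \<otimes>\<^bsub>A\<^esub> y)) = adj c0 * c0 + adj c1 * c1"
proof -
  define v where "v i = (if i = (0::nat) then x else y)" for i
  have v: "v i \<in> carrier A" for i using assms by (simp add: v_def)
  define b where "b k i = (if k = (0::nat) then v i else \<zero>\<^bsub>A\<^esub>)" for k i
  have zc: "\<zero>\<^bsub>A\<^esub> \<in> carrier A" by simp
  have zm: "star A \<zero>\<^bsub>A\<^esub> \<otimes>\<^bsub>A\<^esub> \<zero>\<^bsub>A\<^esub> = \<zero>\<^bsub>A\<^esub>"
    using A.cstar_identity[OF zc] A.nrm_eq_0_iff[OF A.mult_closed[OF A.star_closed[OF zc] zc]]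
    by (simp only: A.nrm_zero) simp
  have two: "{..<2::nat} = {0, 1}" by auto
  have "mat_positive A 2 (\<lambda>i j. star A (v i) \<otimes>\<^bsub>A\<^esub> v j)"
    unfolding mat_positive_def
  proof (intro exI[of _ b] conjI allI impI)
    show "b i j \<in> carrier A" for i j using v by (simp add: b_def)
    show "star A (v i) \<otimes>\<^bsub>A\<^esub> v j = (\<Oplus>\<^bsub>A\<^esub>k\<in>{..<2}. star A (b k i) \<otimes>\<^bsub>A\<^esub> b k j)" for i j
      unfolding two using v
      by (subst A.M.finsum_insert) (auto simp: b_def zm A.mult_closed A.star_closed)
  qed
  then have "mat_positive B 2 (\<lambda>i j. \<phi> (star A (v i) \<otimes>\<^bsub>A\<^esub> v j))"
    using cpc unfolding cpc_def completely_positive_def by blast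
  then obtain d :: "nat \<Rightarrow> nat \<Rightarrow> 'b" where "(\<forall>i<2. \<forall>j<2. d i j \<in> carrier B) \<and> (\<forall>i<2. \<forall>j<2.
      \<phi> (star A (v i) \<otimes>\<^bsub>A\<^esub> v j) = (\<Oplus>\<^bsub>B\<^esub>k\<in>{..<2}. star B (d k i) \<otimes>\<^bsub>B\<^esub> d k j))"
    unfolding mat_positive_def by (rule exE)
  then have d: "\<And>i j. i < 2 \<Longrightarrow> j < 2 \<Longrightarrow> d i j \<in> carrier B"
    and eq: "\<And>i j. i < 2 \<Longrightarrow> j < 2 \<Longrightarrow>
      \<phi> (star A (v i) \<otimes>\<^bsub>A\<^esub> v j) = (\<Oplus>\<^bsub>B\<^esub>k\<in>{..<2}. star B (d k i) \<otimes>\<^bsub>B\<^esub> d k j)"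
    by simp_all
  have eq': "emb B (\<phi> (star A (v i) \<otimes>\<^bsub>A\<^esub> v j))
      = adj (emb B (d 0 i)) * emb B (d 0 j) + adj (emb B (d 1 i)) * emb B (d 1 j)"
    if ij: "i < 2" "j < 2" for i j
  proof -
    note c = d[of 0 i] d[of 0 j] d[of 1 i] d[of 1 j] ij
    have "(\<Oplus>\<^bsub>B\<^esub>k\<in>{..<2}. star B (d k i) \<otimes>\<^bsub>B\<^esub> d k j)
        = star B (d 0 i) \<otimes>\<^bsub>B\<^esub> d 0 j \<oplus>\<^bsub>B\<^esub> star B (d 1 i) \<otimes>\<^bsub>B\<^esub> d 1 j"
      unfolding two using c
      by (subst B.M.finsum_insert) (auto simp: B.mult_closed B.star_closed)
    then show ?thesis
      using c by (simp add: eq B.emb_add B.emb_mult B.emb_star B.mult_closed B.star_closed)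
  qed
  show ?thesis
    by (rule that[of "emb B (d 0 0)" "emb B (d 1 0)" "emb B (d 0 1)" "emb B (d 1 1)"])
       (use eq'[of 0 0] eq'[of 0 1] eq'[of 1 0] eq'[of 1 1] in \<open>simp_all add: v_def\<close>)
qed

lemma Cauchy_Schwarz:
  assumes "x \<in> carrier A" "y \<in> carrier A"
  shows "(nrm B (\<phi> (star A x \<otimes>\<^bsub>A\<^esub> y)))\<^sup>2
     \<le> nrm B (\<phi> (star A x \<otimes>\<^bsub>A\<^esub> x)) * nrm B (\<phi> (star A y \<otimes>\<^bsub>A\<^esub> y))"
proof -
  obtain b0 b1 c0 c1 where g:
    "emb B (\<phi> (star A x \<otimes>\<^bsub>A\<^esub> x)) = adj b0 * b0 + adj b1 * b1"
    "emb B (\<phi> (star A x \<otimes>\<^bsub>A\<^esub> y)) = adj b0 * c0 + adj b1 * c1"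
    "emb B (\<phi> (star A y \<otimes>\<^bsub>A\<^esub> y)) = adj c0 * c0 + adj c1 * c1"
    using gram[OF assms] by metis
  have "(norm (emb B (\<phi> (star A x \<otimes>\<^bsub>A\<^esub> y))))\<^sup>2
     \<le> norm (emb B (\<phi> (star A x \<otimes>\<^bsub>A\<^esub> x))) * norm (emb B (\<phi> (star A y \<otimes>\<^bsub>A\<^esub> y)))"
    unfolding g by (rule pair_Cauchy_Schwarz_norm)
  then show ?thesis
    using assms by (simp add: B.norm_emb closed A.mult_closed A.star_closed)
qed

text \<open>A substitute for the unit, adapted to the given \<open>x\<close>. The second limit comes
  from the first by the involution of \<open>A\<close>; that \<open>\<phi>\<close> respects the
  involution is not yet available here.\<close>

lemma approximate_unit_seq:
  assumes x: "x \<in> carrier A"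
  obtains e where "\<And>n :: nat. e n \<in> carrier A" "\<And>n. star A (e n) = e n" "\<And>n. nrm A (e n) \<le> 1"
    "(\<lambda>n. emb B (\<phi> (e n \<otimes>\<^bsub>A\<^esub> x))) \<longlonglongrightarrow> emb B (\<phi> x)"
    "(\<lambda>n. emb B (\<phi> (star A x \<otimes>\<^bsub>A\<^esub> e n))) \<longlonglongrightarrow> emb B (\<phi> (star A x))"
proof -
  have "\<exists>e. e \<in> carrier A \<and> star A e = e \<and> nrm A e \<le> 1 \<and> nrm A (x \<ominus>\<^bsub>A\<^esub> e \<otimes>\<^bsub>A\<^esub> x) \<le> inverse (real (Suc n))" for n
    using A.approximate_unit[OF x, of "inverse (real (Suc n))"] by auto
  then obtain e where e: "\<And>n. e n \<in> carrier A" "\<And>n. star A (e n) = e n" "\<And>n. nrm A (e n) \<le> 1"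
    "\<And>n. nrm A (x \<ominus>\<^bsub>A\<^esub> e n \<otimes>\<^bsub>A\<^esub> x) \<le> inverse (real (Suc n))"
    by metis
  have *: "(\<lambda>n. emb B (\<phi> (z n))) \<longlonglongrightarrow> emb B (\<phi> y)"
    if y: "y \<in> carrier A" and z: "\<And>n. z n \<in> carrier A"
      and le: "\<And>n. nrm A (y \<ominus>\<^bsub>A\<^esub> z n) \<le> inverse (real (Suc n))" for y z
  proof -
    have "norm (emb B (\<phi> (z n)) - emb B (\<phi> y)) \<le> inverse (real (Suc n))" for n
    proof -
      have "norm (emb B (\<phi> (z n)) - emb B (\<phi> y)) = nrm B (\<phi> (y \<ominus>\<^bsub>A\<^esub> z n))"
        by (metis B.norm_emb_minus closed minus norm_minus_commute y z)
      also have "\<dots> \<le> nrm A (y \<ominus>\<^bsub>A\<^esub> z n)" using y z by (intro contractive) simp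
      finally show ?thesis using le[of n] by simp
    qed
    then have "(\<lambda>n. emb B (\<phi> (z n)) - emb B (\<phi> y)) \<longlonglongrightarrow> 0"
      by (intro Lim_null_comparison[OF _ LIMSEQ_inverse_real_of_nat]) auto
    then show ?thesis by (rule LIM_zero_cancel)
  qed
  show ?thesis
  proof (rule that[OF e(1,2,3)])
    show "(\<lambda>n. emb B (\<phi> (e n \<otimes>\<^bsub>A\<^esub> x))) \<longlonglongrightarrow> emb B (\<phi> x)"
      using e x by (intro *) (auto simp: A.mult_closed)
    show "(\<lambda>n. emb B (\<phi> (star A x \<otimes>\<^bsub>A\<^esub> e n))) \<longlonglongrightarrow> emb B (\<phi> (star A x))"
    proof (rule *)
      fix n
      have "star A (x \<ominus>\<^bsub>A\<^esub> e n \<otimes>\<^bsub>A\<^esub> x) = star A x \<ominus>\<^bsub>A\<^esub> star A x \<otimes>\<^bsub>A\<^esub> e n"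
        using e x by (simp add: A.star_minus A.mult_closed A.star_mult)
      then show "nrm A (star A x \<ominus>\<^bsub>A\<^esub> star A x \<otimes>\<^bsub>A\<^esub> e n) \<le> inverse (real (Suc n))"
        using e(4)[of n] A.nrm_star[of "x \<ominus>\<^bsub>A\<^esub> e n \<otimes>\<^bsub>A\<^esub> x"] e(1) x by (simp add: A.mult_closed)
    qed (use e x in \<open>auto simp: A.mult_closed A.star_closed\<close>)
  qed
qed

text \<open>The Gram matrix of \<open>x\<close> and \<open>e n\<close> has a hermitian image, so the
  values of \<open>\<phi>\<close> at \<open>star A x \<otimes> e n\<close> and at
  \<open>e n \<otimes> x\<close> are adjoint to each other. Then \<open>e n\<close> is removed in
  the limit.\<close>

lemma preserves_star:
  assumes x: "x \<in> carrier A"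
  shows "\<phi> (star A x) = star B (\<phi> x)"
proof -
  obtain e where e: "\<And>n :: nat. e n \<in> carrier A" "\<And>n. star A (e n) = e n"
    "(\<lambda>n. emb B (\<phi> (e n \<otimes>\<^bsub>A\<^esub> x))) \<longlonglongrightarrow> emb B (\<phi> x)"
    "(\<lambda>n. emb B (\<phi> (star A x \<otimes>\<^bsub>A\<^esub> e n))) \<longlonglongrightarrow> emb B (\<phi> (star A x))"
    using approximate_unit_seq[OF x] by metis
  have "emb B (\<phi> (star A x \<otimes>\<^bsub>A\<^esub> e n)) = adj (emb B (\<phi> (e n \<otimes>\<^bsub>A\<^esub> x)))" for n
  proof -
    obtain b0 b1 c0 c1 where
      "emb B (\<phi> (star A x \<otimes>\<^bsub>A\<^esub> e n)) = adj b0 * c0 + adj b1 * c1"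
      "emb B (\<phi> (star A (e n) \<otimes>\<^bsub>A\<^esub> x)) = adj c0 * b0 + adj c1 * b1"
      using gram[OF x e(1)] by metis
    then show ?thesis by (simp add: e(2) adj_add adj_mult)
  qed
  then have "(\<lambda>n. adj (emb B (\<phi> (e n \<otimes>\<^bsub>A\<^esub> x)))) \<longlonglongrightarrow> emb B (\<phi> (star A x))"
    using e(4) by simp
  with tendsto_adj[OF e(3)] have "emb B (\<phi> (star A x)) = adj (emb B (\<phi> x))"
    using LIMSEQ_unique by blast
  then have "emb B (\<phi> (star A x)) = emb B (star B (\<phi> x))"
    using B.emb_star[OF closed[OF x]] by simp
  then show ?thesis
    using x by (intro B.emb_inj) (auto simp: closed A.star_closed B.star_closed)
qed

text \<open>With a unit this would be the pair Cauchy-Schwarz inequality for \<open>x\<close> and 1.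
  Here the contractions \<open>e n\<close> replace the unit, the constant being
  \<open>M = 1\<close>, and positive elements form a closed set. The conclusion needs a factor
  \<open>s\<close> in \<open>B\<close> itself, which \<open>pos_emb_eq_star_mult_self\<close>
  provides.\<close>

lemma Kadison_Schwarz:
  assumes x: "x \<in> carrier A"
  shows "\<exists>s\<in>carrier B. \<phi> (star A x \<otimes>\<^bsub>A\<^esub> x) \<ominus>\<^bsub>B\<^esub> star B (\<phi> x) \<otimes>\<^bsub>B\<^esub> \<phi> x = star B s \<otimes>\<^bsub>B\<^esub> s"
proof -
  obtain e where e: "\<And>n :: nat. e n \<in> carrier A" "\<And>n. star A (e n) = e n" "\<And>n. nrm A (e n) \<le> 1"
    "(\<lambda>n. emb B (\<phi> (e n \<otimes>\<^bsub>A\<^esub> x))) \<longlonglongrightarrow> emb B (\<phi> x)"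
    using approximate_unit_seq[OF x] by metis
  define U where "U = emb B (\<phi> (star A x \<otimes>\<^bsub>A\<^esub> x))"
  define Y where "Y n = emb B (\<phi> (e n \<otimes>\<^bsub>A\<^esub> x))" for n
  have p: "pos (U - adj (Y n) * Y n)" for n
  proof -
    obtain b0 b1 c0 c1 where g:
      "U = adj b0 * b0 + adj b1 * b1"
      "Y n = adj c0 * b0 + adj c1 * b1"
      "emb B (\<phi> (e n \<otimes>\<^bsub>A\<^esub> e n)) = adj c0 * c0 + adj c1 * c1"
      using gram[OF x e(1)[of n]] unfolding U_def Y_def e(2) by metis
    have "norm (emb B (\<phi> (e n \<otimes>\<^bsub>A\<^esub> e n))) = nrm B (\<phi> (e n \<otimes>\<^bsub>A\<^esub> e n))"
      using e(1) by (intro B.norm_emb closed A.mult_closed)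
    also have "\<dots> \<le> nrm A (e n \<otimes>\<^bsub>A\<^esub> e n)"
      using e(1) by (intro contractive A.mult_closed)
    also have "\<dots> \<le> nrm A (e n) * nrm A (e n)" using e(1) by (intro A.nrm_mult)
    also have "\<dots> \<le> 1 * 1" using e(1,3) A.nrm_nonneg by (intro mult_mono) auto
    finally have "norm (adj c0 * c0 + adj c1 * c1) \<le> 1" unfolding g(3) by simp
    from pair_Cauchy_Schwarz[OF this, of b0 b1] show ?thesis
      unfolding g(1,2) by simp
  qed
  have "(\<lambda>n. U - adj (Y n) * Y n) \<longlonglongrightarrow> U - adj (emb B (\<phi> x)) * emb B (\<phi> x)"
    using e(4) unfolding Y_def by (intro tendsto_intros tendsto_adj)
  from pos_closed[OF p this] have "pos (U - adj (emb B (\<phi> x)) * emb B (\<phi> x))" .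
  then have "pos (emb B (\<phi> (star A x \<otimes>\<^bsub>A\<^esub> x) \<ominus>\<^bsub>B\<^esub> star B (\<phi> x) \<otimes>\<^bsub>B\<^esub> \<phi> x))"
    using x by (simp add: U_def B.emb_minus B.emb_mult B.emb_star closed A.mult_closed A.star_closed
        B.mult_closed B.star_closed)
  then show ?thesis
    using x by (intro B.pos_emb_eq_star_mult_self)
      (auto simp: closed A.mult_closed A.star_closed B.mult_closed B.star_closed)
qed

end

section \<open>Iterated limits\<close>

text \<open>The iterated limit, first in \<open>m\<close> and then in \<open>n\<close>, as one
  filter, so that the calculus of \<open>tendsto\<close> applies. How large \<open>m\<close> must be
  may depend on \<open>n\<close>.\<close>

definition iter :: "(nat \<times> nat) filter" where
  "iter = Abs_filter (\<lambda>P. \<forall>\<^sub>F n in sequentially. \<forall>\<^sub>F m in sequentially. P (n, m))"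

lemma eventually_iter:
  "eventually P iter \<longleftrightarrow> (\<forall>\<^sub>F n in sequentially. \<forall>\<^sub>F m in sequentially. P (n, m))"
  unfolding iter_def
proof (rule eventually_Abs_filter, unfold_locales)
  fix P Q :: "nat \<times> nat \<Rightarrow> bool"
  assume P: "\<forall>\<^sub>F n in sequentially. \<forall>\<^sub>F m in sequentially. P (n, m)"
  { assume "\<forall>\<^sub>F n in sequentially. \<forall>\<^sub>F m in sequentially. Q (n, m)"
    with P show "\<forall>\<^sub>F n in sequentially. \<forall>\<^sub>F m in sequentially. P (n, m) \<and> Q (n, m)"
      by eventually_elim (rule eventually_conj) }
  { assume "\<forall>x. P x \<longrightarrow> Q x"
    with P show "\<forall>\<^sub>F n in sequentially. \<forall>\<^sub>F m in sequentially. Q (n, m)"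
      by (auto elim!: eventually_mono) }
qed simp

lemma filterlim_fst_iter: "filterlim fst sequentially iter"
  unfolding filterlim_at_top eventually_iter by (auto intro: eventually_mono[OF eventually_ge_at_top])

lemma eventually_less_iter: "\<forall>\<^sub>F p in iter. fst p < snd p"
  unfolding eventually_iter by (auto intro: eventually_gt_at_top)

lemma eventually_snd_iter: "(\<forall>\<^sub>F p in iter. P (snd p)) \<longleftrightarrow> eventually P sequentially"
  by (simp add: eventually_iter)

lemma tendsto_snd_iter: "((\<lambda>p. f (snd p)) \<longlongrightarrow> l) iter \<longleftrightarrow> f \<longlonglongrightarrow> l"
  unfolding tendsto_def eventually_snd_iter[symmetric] ..

lemma tendsto_fst_iter: "f \<longlonglongrightarrow> l \<Longrightarrow> ((\<lambda>p. f (fst p)) \<longlongrightarrow> l) iter"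
  by (rule filterlim_compose[OF _ filterlim_fst_iter])

lemma norm_mult_diff_le:
  fixes a b x y :: "'a :: real_normed_algebra"
  shows "norm (a * b - x * y) \<le> norm (a - x) * norm b + norm x * norm (b - y)"
proof -
  have "a * b - x * y = (a - x) * b + x * (b - y)" by (simp add: algebra_simps)
  then show ?thesis
    using norm_triangle_ineq[of "(a - x) * b" "x * (b - y)"]
      norm_mult_ineq[of "a - x" b] norm_mult_ineq[of x "b - y"] by simp
qed

lemma eventually_bounded_imp_bounded:
  fixes f :: "nat \<Rightarrow> 'a :: real_normed_vector"
  assumes "\<forall>\<^sub>F m in sequentially. norm (f m) \<le> C"
  shows "\<exists>C. \<forall>m. norm (f m) \<le> C"
proof -
  have "Bfun f sequentially" using assms by (rule BfunI)
  then show ?thesis unfolding Bseq_def by blast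
qed

lemma tendsto_zero_mult_bounded:
  fixes f g :: "'b \<Rightarrow> 'a :: real_normed_algebra"
  assumes "(f \<longlongrightarrow> 0) F" "\<And>x. norm (g x) \<le> C"
  shows "((\<lambda>x. f x * g x) \<longlongrightarrow> 0) F" "((\<lambda>x. g x * f x) \<longlongrightarrow> 0) F"
proof -
  have 0: "((\<lambda>x. C * norm (f x)) \<longlongrightarrow> 0) F"
    using tendsto_mult[OF tendsto_const[of C] tendsto_norm[OF assms(1)]] by simp
  have "norm (f x * g x) \<le> C * norm (f x)" "norm (g x * f x) \<le> C * norm (f x)" for x
    using norm_mult_ineq[of "f x" "g x"] norm_mult_ineq[of "g x" "f x"]
      mult_right_mono[OF assms(2)[of x] norm_ge_zero[of "f x"]] by (simp_all add: mult.commute)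
  then show "((\<lambda>x. f x * g x) \<longlongrightarrow> 0) F" "((\<lambda>x. g x * f x) \<longlongrightarrow> 0) F"
    by (intro Lim_null_comparison[OF always_eventually 0]; simp)+
qed

section \<open>Towers of subalgebras\<close>

text \<open>What the analysis uses of a system once its algebras lie in a single unital one:
  \<open>B n\<close> is the image of \<open>A n\<close>, and \<open>R m n\<close> is the transition
  map, which is meaningful only on \<open>B n\<close> and for \<open>n \<le> m\<close>. Positivity
  of the maps enters through the last two inequalities before the encoding condition.\<close>

locale cstar_tower =
  fixes B :: "nat \<Rightarrow> 'u :: cstar_unital set" and R :: "nat \<Rightarrow> nat \<Rightarrow> 'u \<Rightarrow> 'u"
  assumes zero_in: "0 \<in> B n"
    and add_in: "\<lbrakk>u \<in> B n; v \<in> B n\<rbrakk> \<Longrightarrow> u + v \<in> B n"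
    and cscale_in: "u \<in> B n \<Longrightarrow> cscale c * u \<in> B n"
    and mult_in: "\<lbrakk>u \<in> B n; v \<in> B n\<rbrakk> \<Longrightarrow> u * v \<in> B n"
    and adj_in: "u \<in> B n \<Longrightarrow> adj u \<in> B n"
    and R_in: "\<lbrakk>n \<le> m; u \<in> B n\<rbrakk> \<Longrightarrow> R m n u \<in> B m"
    and R_add: "\<lbrakk>n \<le> m; u \<in> B n; v \<in> B n\<rbrakk> \<Longrightarrow> R m n (u + v) = R m n u + R m n v"
    and R_cscale: "\<lbrakk>n \<le> m; u \<in> B n\<rbrakk> \<Longrightarrow> R m n (cscale c * u) = cscale c * R m n u"
    and R_adj: "\<lbrakk>n \<le> m; u \<in> B n\<rbrakk> \<Longrightarrow> R m n (adj u) = adj (R m n u)"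
    and R_norm: "\<lbrakk>n \<le> m; u \<in> B n\<rbrakk> \<Longrightarrow> norm (R m n u) \<le> norm u"
    and R_R: "\<lbrakk>k \<le> n; n \<le> m; u \<in> B k\<rbrakk> \<Longrightarrow> R m n (R n k u) = R m k u"
    and R_Kadison_Schwarz: "\<lbrakk>n \<le> m; u \<in> B n\<rbrakk>
      \<Longrightarrow> \<exists>s\<in>B m. R m n (adj u * u) - adj (R m n u) * R m n u = adj s * s"
    and R_Cauchy_Schwarz: "\<lbrakk>n \<le> m; u \<in> B n; v \<in> B n\<rbrakk> \<Longrightarrow>
      (norm (R m n (adj u * v)))\<^sup>2 \<le> norm (R m n (adj u * u)) * norm (R m n (adj v * v))"
    and encoding: "\<lbrakk>x \<in> B k; y \<in> B k; \<epsilon> > 0\<rbrakk> \<Longrightarrow>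
      \<exists>M\<ge>k. \<forall>m n j. M < n \<and> M < j \<and> max n j < m \<longrightarrow>
        norm (R m n (R n k x * R n k y) - R m j (R j k x * R j k y)) < \<epsilon>"
begin

lemma uminus_in: "u \<in> B n \<Longrightarrow> - u \<in> B n"
  using cscale_in[of u n "- 1"] by (simp add: cscale_minus)

lemma minus_in: "\<lbrakk>u \<in> B n; v \<in> B n\<rbrakk> \<Longrightarrow> u - v \<in> B n"
  using add_in[of u n "cscale (- 1) * v"] cscale_in[of v n "- 1"] by (simp add: cscale_minus)

lemma R_minus: "\<lbrakk>n \<le> m; u \<in> B n; v \<in> B n\<rbrakk> \<Longrightarrow> R m n (u - v) = R m n u - R m n v"
  using R_add[of n m u "cscale (- 1) * v"] R_cscale[of n m v "- 1"] cscale_in[of v n "- 1"]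
  by (simp add: cscale_minus)

section \<open>Bounded sequences and limits along the tower\<close>

definition bseq :: "(nat \<Rightarrow> 'u) \<Rightarrow> bool" where
  "bseq a \<longleftrightarrow> (\<forall>n. a n \<in> B n) \<and> (\<exists>C. \<forall>n. norm (a n) \<le> C)"

lemma bseq_in: "bseq a \<Longrightarrow> a n \<in> B n"
  by (simp add: bseq_def)

lemma bseq_bound:
  assumes "bseq a"
  obtains C where "C > 0" "\<And>n. norm (a n) \<le> C"
proof -
  obtain C where C: "\<And>n. norm (a n) \<le> C" using assms by (auto simp: bseq_def)
  show ?thesis
  proof (rule that[of "\<bar>C\<bar> + 1"])
    show "norm (a n) \<le> \<bar>C\<bar> + 1" for n using C[of n] by linarith
  qed linarith
qed

lemma bseqI: "(\<And>n. a n \<in> B n) \<Longrightarrow> (\<And>n. norm (a n) \<le> C) \<Longrightarrow> bseq a"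
  by (auto simp: bseq_def)

lemma bseq_add: assumes "bseq a" "bseq b" shows "bseq (\<lambda>n. a n + b n)"
proof -
  obtain C D where "\<And>n. norm (a n) \<le> C" "\<And>n. norm (b n) \<le> D"
    using assms by (auto simp: bseq_def)
  then show ?thesis
    using assms by (intro bseqI[of _ "C + D"]) (auto simp: bseq_in add_in intro: norm_triangle_mono)
qed

lemma bseq_cscale: assumes "bseq a" shows "bseq (\<lambda>n. cscale c * a n)"
proof -
  obtain C where "\<And>n. norm (a n) \<le> C" using assms by (auto simp: bseq_def)
  then show ?thesis
    using assms by (intro bseqI[of _ "cmod c * C"])
      (auto simp: bseq_in cscale_in norm_cscale_mult intro: mult_left_mono)
qed

lemma bseq_minus: assumes "bseq a" "bseq b" shows "bseq (\<lambda>n. a n - b n)"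
  using bseq_add[OF assms(1) bseq_cscale[OF assms(2), of "- 1"]] by (simp add: cscale_minus)

lemma bseq_mult: assumes "bseq a" "bseq b" shows "bseq (\<lambda>n. a n * b n)"
proof -
  obtain C D where CD: "C > 0" "\<And>n. norm (a n) \<le> C" "D > 0" "\<And>n. norm (b n) \<le> D"
    using assms bseq_bound by metis
  show ?thesis
  proof (rule bseqI[of _ "C * D"])
    show "norm (a n * b n) \<le> C * D" for n
      by (rule order_trans[OF norm_mult_ineq mult_mono]) (use CD in \<open>auto intro: less_imp_le\<close>)
  qed (use assms in \<open>auto simp: bseq_in mult_in\<close>)
qed

lemma bseq_adj: "bseq a \<Longrightarrow> bseq (\<lambda>n. adj (a n))"
  by (auto simp: bseq_def adj_in)

lemma bseq_R:
  assumes "x \<in> B k"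
  shows "bseq (\<lambda>n. if k \<le> n then R n k x else 0)"
  by (rule bseqI[of _ "norm x"]) (use assms in \<open>auto simp: R_in zero_in R_norm\<close>)

text \<open>In the sequence algebra: the class of \<open>c\<close> is the limit of
  \<open>\<rho>\<^sub>n(d\<^sub>n)\<close>. The inner limit in \<open>m\<close> expresses the norm
  of a class as a limit superior.\<close>

definition is_lim :: "(nat \<Rightarrow> 'u) \<Rightarrow> (nat \<Rightarrow> 'u) \<Rightarrow> bool" where
  "is_lim c d \<longleftrightarrow> ((\<lambda>p. c (snd p) - R (snd p) (fst p) (d (fst p))) \<longlongrightarrow> 0) iter"

lemma is_lim_iff:
  "is_lim c d \<longleftrightarrow> (\<forall>\<epsilon>>0. \<forall>\<^sub>F n in sequentially. \<forall>\<^sub>F m in sequentially. norm (c m - R m n (d n)) < \<epsilon>)"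
  by (simp add: is_lim_def tendsto_iff eventually_iter)

lemma tendsto_R_null:
  assumes "((\<lambda>p. d p) \<longlongrightarrow> 0) iter" and "\<And>p. d p \<in> B (fst p)"
  shows "((\<lambda>p. R (snd p) (fst p) (d p)) \<longlongrightarrow> 0) iter"
proof (rule Lim_null_comparison)
  show "((\<lambda>p. norm (d p)) \<longlongrightarrow> 0) iter" using tendsto_norm[OF assms(1)] by simp
  show "\<forall>\<^sub>F p in iter. norm (R (snd p) (fst p) (d p)) \<le> norm (d p)"
    using eventually_less_iter by eventually_elim (use assms(2) in \<open>auto intro: R_norm\<close>)
qed

lemma is_lim_add:
  assumes "is_lim c d" "is_lim c' d'" "\<And>n. d n \<in> B n" "\<And>n. d' n \<in> B n"
  shows "is_lim (\<lambda>n. c n + c' n) (\<lambda>n. d n + d' n)"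
proof -
  note t = tendsto_add[OF assms(1,2)[unfolded is_lim_def]]
  have "\<forall>\<^sub>F p in iter. c (snd p) - R (snd p) (fst p) (d (fst p)) + (c' (snd p) - R (snd p) (fst p) (d' (fst p)))
      = c (snd p) + c' (snd p) - R (snd p) (fst p) (d (fst p) + d' (fst p))"
    using eventually_less_iter by eventually_elim (use assms in \<open>simp add: R_add\<close>)
  from Lim_transform_eventually[OF t this] show ?thesis by (simp add: is_lim_def)
qed

lemma is_lim_cscale:
  assumes "is_lim c d" "\<And>n. d n \<in> B n"
  shows "is_lim (\<lambda>n. cscale s * c n) (\<lambda>n. cscale s * d n)"
proof -
  note t = tendsto_mult_right_zero[OF assms(1)[unfolded is_lim_def], of "cscale s"]
  have "\<forall>\<^sub>F p in iter. cscale s * (c (snd p) - R (snd p) (fst p) (d (fst p)))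
      = cscale s * c (snd p) - R (snd p) (fst p) (cscale s * d (fst p))"
    using eventually_less_iter by eventually_elim (use assms in \<open>simp add: R_cscale right_diff_distrib\<close>)
  from Lim_transform_eventually[OF t this] show ?thesis by (simp add: is_lim_def)
qed

lemma is_lim_minus:
  assumes "is_lim c d" "is_lim c' d'" "\<And>n. d n \<in> B n" "\<And>n. d' n \<in> B n"
  shows "is_lim (\<lambda>n. c n - c' n) (\<lambda>n. d n - d' n)"
  using is_lim_add[OF assms(1) is_lim_cscale[OF assms(2,4), of "- 1"] assms(3)] assms(4)
  by (simp add: cscale_minus uminus_in)

lemma is_lim_adj:
  assumes "is_lim c d" "\<And>n. d n \<in> B n"
  shows "is_lim (\<lambda>n. adj (c n)) (\<lambda>n. adj (d n))"
proof -
  note t = tendsto_adj[OF assms(1)[unfolded is_lim_def]]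
  have "\<forall>\<^sub>F p in iter. adj (c (snd p) - R (snd p) (fst p) (d (fst p)))
      = adj (c (snd p)) - R (snd p) (fst p) (adj (d (fst p)))"
    using eventually_less_iter by eventually_elim (use assms in \<open>simp add: R_adj adj_diff\<close>)
  from Lim_transform_eventually[OF t this] show ?thesis by (simp add: is_lim_def)
qed

lemma is_lim_imp_null:
  assumes "is_lim c d" "((\<lambda>p. R (snd p) (fst p) (d (fst p))) \<longlongrightarrow> 0) iter"
  shows "c \<longlonglongrightarrow> 0"
  using tendsto_add[OF assms(1)[unfolded is_lim_def] assms(2)] by (simp add: tendsto_snd_iter)

lemma is_lim_unique:
  assumes "is_lim c d" "is_lim c' d'" "(\<lambda>n. d n - d' n) \<longlonglongrightarrow> 0" "\<And>n. d n \<in> B n" "\<And>n. d' n \<in> B n"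
  shows "(\<lambda>n. c n - c' n) \<longlonglongrightarrow> 0"
  by (rule is_lim_imp_null[OF is_lim_minus[OF assms(1,2,4,5)]])
     (use assms in \<open>auto intro!: tendsto_R_null tendsto_fst_iter simp: minus_in\<close>)

lemma is_lim_bound:
  assumes "is_lim c d" "\<And>n. d n \<in> B n" "\<forall>\<^sub>F n in sequentially. norm (d n) \<le> C" "\<epsilon> > 0"
  shows "\<forall>\<^sub>F m in sequentially. norm (c m) < C + \<epsilon>"
proof -
  have "\<forall>\<^sub>F p in iter. norm (c (snd p) - R (snd p) (fst p) (d (fst p))) < \<epsilon>"
    using assms(1,4) unfolding is_lim_def tendsto_iff by simp
  moreover have "\<forall>\<^sub>F p in iter. norm (d (fst p)) \<le> C"
    using eventually_compose_filterlim[OF assms(3) filterlim_fst_iter] .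
  ultimately have "\<forall>\<^sub>F p in iter. norm (c (snd p)) < C + \<epsilon>"
    using eventually_less_iter
  proof eventually_elim
    case (elim p)
    have "norm (R (snd p) (fst p) (d (fst p))) \<le> norm (d (fst p))"
      using elim assms(2) by (intro R_norm) auto
    with elim show ?case
      using norm_triangle_sub[of "c (snd p)" "R (snd p) (fst p) (d (fst p))"] by linarith
  qed
  then show ?thesis by (simp add: eventually_iter)
qed

text \<open>\<open>coh a\<close> says that the class of \<open>a\<close> is the limit of \<open>\<rho>\<^sub>n(a\<^sub>n)\<close>; by \<open>coh_iff\<close> this means that
  it belongs to the closure of the union of the images of the \<open>\<rho>\<^sub>n\<close>.\<close>

definition coh :: "(nat \<Rightarrow> 'u) \<Rightarrow> bool" where
  "coh a \<longleftrightarrow> bseq a \<and> is_lim a a"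

lemma coh_bseq: "coh a \<Longrightarrow> bseq a"
  by (simp add: coh_def)

lemma is_lim_approx:
  assumes "is_lim c d" "\<epsilon> > 0"
  obtains n where "n \<ge> N" "\<forall>\<^sub>F m in sequentially. norm (c m - R m n (d n)) < \<epsilon>"
proof -
  have "\<forall>\<^sub>F n in sequentially. N \<le> n \<and> (\<forall>\<^sub>F m in sequentially. norm (c m - R m n (d n)) < \<epsilon>)"
    using assms by (intro eventually_conj eventually_ge_at_top) (simp add: is_lim_iff)
  then show ?thesis
    using that eventually_happens'[OF sequentially_bot] by blast
qed

text \<open>One orbit near \<open>a\<close> suffices. The maps are contractive, so the error at
  \<open>n\<close> does not grow on the way to \<open>m\<close>: \<open>R m n (a n)\<close> stays
  close to \<open>R m k x\<close>, and so does \<open>a m\<close>.\<close>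

lemma cohI_approx:
  assumes a: "bseq a"
    and approx: "\<And>\<epsilon>. \<epsilon> > 0 \<Longrightarrow> \<exists>k. \<exists>x\<in>B k. \<forall>\<^sub>F m in sequentially. norm (a m - R m k x) < \<epsilon>"
  shows "coh a"
  unfolding coh_def is_lim_iff
proof (intro conjI a allI impI)
  fix \<epsilon> :: real assume "\<epsilon> > 0"
  then have "\<epsilon> / 2 > 0" by simp
  from approx[OF this] obtain k x where x: "x \<in> B k"
    and ev: "\<forall>\<^sub>F m in sequentially. norm (a m - R m k x) < \<epsilon> / 2" by blast
  show "\<forall>\<^sub>F n in sequentially. \<forall>\<^sub>F m in sequentially. norm (a m - R m n (a n)) < \<epsilon>"
    using ev eventually_ge_at_top[of k]
  proof eventually_elim
    case n: (elim n)
    show ?case using ev eventually_ge_at_top[of n]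
    proof eventually_elim
      case (elim m)
      have "norm (R m n (a n) - R m k x) = norm (R m n (a n - R n k x))"
        using n elim x a by (simp add: R_minus R_in bseq_in R_R)
      also have "\<dots> \<le> norm (a n - R n k x)"
        using n elim x a by (intro R_norm) (auto simp: minus_in R_in bseq_in)
      finally have "norm (R m n (a n) - R m k x) < \<epsilon> / 2" using n by simp
      then have "norm ((a m - R m k x) - (R m n (a n) - R m k x)) < \<epsilon>"
        using elim norm_triangle_ineq4[of "a m - R m k x" "R m n (a n) - R m k x"] by linarith
      then show ?case by simp
    qed
  qed
qed

lemma is_lim_coh:
  assumes "bseq c" "is_lim c d" "\<And>n. d n \<in> B n"
  shows "coh c"
proof (rule cohI_approx[OF assms(1)])
  fix \<epsilon> :: real assume "\<epsilon> > 0"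
  from is_lim_approx[OF assms(2) this, of 0] assms(3)
  show "\<exists>k. \<exists>x\<in>B k. \<forall>\<^sub>F m in sequentially. norm (c m - R m k x) < \<epsilon>" by blast
qed

lemma coh_iff:
  "coh a \<longleftrightarrow> bseq a \<and> (\<forall>\<epsilon>>0. \<exists>k. \<exists>x\<in>B k. \<forall>\<^sub>F m in sequentially. norm (a m - R m k x) < \<epsilon>)"
proof
  assume "coh a"
  then have a: "bseq a" "is_lim a a" by (simp_all add: coh_def)
  have "\<exists>k. \<exists>x\<in>B k. \<forall>\<^sub>F m in sequentially. norm (a m - R m k x) < \<epsilon>" if "\<epsilon> > 0" for \<epsilon>
    using is_lim_approx[OF a(2) that, of 0] bseq_in[OF a(1)] by blast
  with a show "bseq a \<and> (\<forall>\<epsilon>>0. \<exists>k. \<exists>x\<in>B k. \<forall>\<^sub>F m in sequentially. norm (a m - R m k x) < \<epsilon>)"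
    by blast
qed (use cohI_approx in blast)

lemma coh_R: "x \<in> B k \<Longrightarrow> coh (\<lambda>n. if k \<le> n then R n k x else 0)"
proof (rule cohI_approx[OF bseq_R])
  fix \<epsilon> :: real assume "x \<in> B k" "\<epsilon> > 0"
  then show "\<exists>k'. \<exists>x'\<in>B k'. \<forall>\<^sub>F m in sequentially. norm ((if k \<le> m then R m k x else 0) - R m k' x') < \<epsilon>"
    by (intro exI[of _ k] bexI[of _ x] eventually_mono[OF eventually_ge_at_top[of k]]) auto
qed

lemma coh_add: "coh a \<Longrightarrow> coh b \<Longrightarrow> coh (\<lambda>n. a n + b n)"
  by (simp add: coh_def bseq_add is_lim_add bseq_in)

lemma coh_cscale: "coh a \<Longrightarrow> coh (\<lambda>n. cscale c * a n)"
  by (simp add: coh_def bseq_cscale is_lim_cscale bseq_in)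

lemma coh_adj: "coh a \<Longrightarrow> coh (\<lambda>n. adj (a n))"
  by (simp add: coh_def bseq_adj is_lim_adj bseq_in)

text \<open>Follow \<open>F p\<close> up to the point where \<open>F (p + 1)\<close> has become close to all of
  \<open>F 0, \<dots>, F p\<close>.\<close>

lemma diagonal_sequence:
  fixes F :: "nat \<Rightarrow> nat \<Rightarrow> 'u"
  assumes F: "\<And>j. bseq (F j)"
    and Cauchy: "\<And>\<epsilon>. \<epsilon> > 0 \<Longrightarrow> \<exists>J. \<forall>i\<ge>J. \<forall>j\<ge>J. \<forall>\<^sub>F m in sequentially. norm (F i m - F j m) < \<epsilon>"
  shows "\<exists>c. bseq c \<and> (\<forall>\<epsilon>>0. \<exists>J. \<forall>j\<ge>J. \<forall>\<^sub>F m in sequentially. norm (c m - F j m) < \<epsilon>)"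
proof -
  define e where "e q = inverse (real (Suc q))" for q
  have e0: "e q > 0" for q by (simp add: e_def)
  obtain J0 where J0: "\<And>q i j. i \<ge> J0 q \<Longrightarrow> j \<ge> J0 q \<Longrightarrow> \<forall>\<^sub>F m in sequentially. norm (F i m - F j m) < e q"
    using Cauchy[OF e0] by metis
  \<comment> \<open>The maximum makes \<open>J p\<close> admissible for all tolerances
    \<open>e q\<close> with \<open>q \<le> p\<close> at once.\<close>
  define J where "J q = Max (J0 ` {..q})" for q
  have J0J: "J0 q \<le> J p" if "q \<le> p" for p q
    unfolding J_def using that by (intro Max_ge) auto
  define g where "g p = F (J p)" for p
  have "\<forall>\<^sub>F m in sequentially. \<forall>q\<in>{..p}. norm (g p m - g q m) < e q" for p
    unfolding g_def by (intro eventually_ball_finite ballI J0) (auto intro: J0J)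
  then obtain N where N: "\<And>p m q. m \<ge> N p \<Longrightarrow> q \<le> p \<Longrightarrow> norm (g p m - g q m) < e q"
    unfolding eventually_sequentially by (metis atMost_iff)
  \<comment> \<open>The stages whose threshold has been passed at \<open>m\<close>. The bound
    \<open>p \<le> m\<close> keeps the set finite, and 0 keeps it nonempty.\<close>
  define P where "P m = insert 0 {p. p \<le> m \<and> N p \<le> m}" for m
  have finP: "finite (P m)" "P m \<noteq> {}" for m by (auto simp: P_def)
  define c where "c m = g (Max (P m)) m" for m
  have close: "norm (c m - g q m) < e q" if "m \<ge> q" "m \<ge> N q" for m q
  proof -
    have q: "q \<in> P m" using that by (simp add: P_def)
    then have le: "q \<le> Max (P m)" using finP by (intro Max_ge)
    have "Max (P m) \<in> P m" using finP by (intro Max_in)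
    \<comment> \<open>Stage 0 may have been selected without its threshold having been passed; then
      \<open>q = 0\<close> and the difference is 0.\<close>
    then consider "Max (P m) = 0" | "N (Max (P m)) \<le> m" by (auto simp: P_def)
    then show ?thesis
    proof cases
      case 1
      with le have "q = 0" by simp
      with 1 show ?thesis using e0[of q] by (simp add: c_def)
    next
      case 2
      then show ?thesis unfolding c_def using le by (rule N)
    qed
  qed
  have conv: "\<exists>J. \<forall>j\<ge>J. \<forall>\<^sub>F m in sequentially. norm (c m - F j m) < \<epsilon>" if \<epsilon>: "\<epsilon> > 0" for \<epsilon>
  proof -
    obtain q where q: "inverse (real (Suc q)) < \<epsilon> / 2" using reals_Archimedean[of "\<epsilon> / 2"] \<epsilon> by auto
    have "\<forall>\<^sub>F m in sequentially. norm (c m - F j m) < \<epsilon>" if j: "j \<ge> J q" for j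
    proof -
      have "\<forall>\<^sub>F m in sequentially. norm (g q m - F j m) < e q"
        unfolding g_def using J0J[of q q] j by (intro J0) auto
      then show ?thesis
        using eventually_ge_at_top[of q] eventually_ge_at_top[of "N q"]
      proof eventually_elim
        case (elim m)
        then show ?case
          using close[of q m] q norm_triangle_ineq[of "c m - g q m" "g q m - F j m"]
          by (simp add: e_def)
      qed
    qed
    then show ?thesis by blast
  qed
  obtain C where C: "\<And>n. norm (g 0 n) \<le> C" using bseq_bound[OF F[of "J 0"]] unfolding g_def by metis
  have "\<forall>\<^sub>F m in sequentially. norm (c m) \<le> C + e 0"
    using eventually_ge_at_top[of "N 0"]
  proof eventually_elim
    case (elim m)
    then show ?case using close[of 0 m] C[of m] norm_triangle_sub[of "c m" "g 0 m"] by simp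
  qed
  then have "bseq c"
    using F eventually_bounded_imp_bounded by (auto simp: bseq_def c_def g_def)
  with conv show ?thesis by blast
qed

text \<open>Completeness of the sequence algebra in terms of representatives: the orbits of the
  \<open>d j\<close>, padded by zeros, form a Cauchy sequence, and its diagonal sequence is
  \<open>c\<close>.\<close>

lemma is_lim_exists:
  assumes d: "bseq d"
    and Cauchy: "\<And>\<epsilon>. \<epsilon> > 0 \<Longrightarrow>
      \<exists>J. \<forall>i\<ge>J. \<forall>j\<ge>J. \<forall>\<^sub>F m in sequentially. norm (R m i (d i) - R m j (d j)) < \<epsilon>"
  shows "\<exists>c. bseq c \<and> is_lim c d"
proof -
  define F where "F j m = (if j \<le> m then R m j (d j) else 0)" for j m
  have "\<exists>c. bseq c \<and> (\<forall>\<epsilon>>0. \<exists>J. \<forall>j\<ge>J. \<forall>\<^sub>F m in sequentially. norm (c m - F j m) < \<epsilon>)"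
  proof (rule diagonal_sequence)
    show "bseq (F j)" for j unfolding F_def by (rule bseq_R[OF bseq_in[OF d]])
    show "\<exists>J. \<forall>i\<ge>J. \<forall>j\<ge>J. \<forall>\<^sub>F m in sequentially. norm (F i m - F j m) < \<epsilon>" if \<epsilon>: "\<epsilon> > 0" for \<epsilon>
    proof -
      obtain J where J: "\<And>i j. i \<ge> J \<Longrightarrow> j \<ge> J \<Longrightarrow> \<forall>\<^sub>F m in sequentially. norm (R m i (d i) - R m j (d j)) < \<epsilon>"
        using Cauchy[OF \<epsilon>] by blast
      have "\<forall>\<^sub>F m in sequentially. norm (F i m - F j m) < \<epsilon>" if "i \<ge> J" "j \<ge> J" for i j
        using J[OF that] eventually_ge_at_top[of i] eventually_ge_at_top[of j]
        by eventually_elim (simp add: F_def)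
      then show ?thesis by blast
    qed
  qed
  then obtain c where c: "bseq c"
    and conv: "\<And>\<epsilon>. \<epsilon> > 0 \<Longrightarrow> \<exists>J. \<forall>j\<ge>J. \<forall>\<^sub>F m in sequentially. norm (c m - F j m) < \<epsilon>" by blast
  have "is_lim c d"
    unfolding is_lim_iff
  proof (intro allI impI)
    fix \<epsilon> :: real assume "\<epsilon> > 0"
    then obtain J where J: "\<And>j. j \<ge> J \<Longrightarrow> \<forall>\<^sub>F m in sequentially. norm (c m - F j m) < \<epsilon>"
      using conv by blast
    show "\<forall>\<^sub>F n in sequentially. \<forall>\<^sub>F m in sequentially. norm (c m - R m n (d n)) < \<epsilon>"
      using eventually_ge_at_top[of J]
    proof eventually_elim
      case (elim n)
      from J[OF this] eventually_ge_at_top[of n] show ?case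
        by eventually_elim (simp add: F_def)
    qed
  qed
  with c show ?thesis by blast
qed

section \<open>The limit product\<close>

text \<open>The encoding condition concerns the orbits of two fixed elements of one
  \<open>B k\<close>. By coherence, \<open>a\<close> and \<open>b\<close> are uniformly close to the
  orbits of \<open>a k\<close> and \<open>b k\<close> from some index on, so their products are
  close as well.\<close>

lemma is_lim_mult_exists:
  assumes a: "coh a" and b: "coh b"
  shows "\<exists>c. bseq c \<and> is_lim c (\<lambda>n. a n * b n)"
proof (rule is_lim_exists)
  note ba = coh_bseq[OF a] and bb = coh_bseq[OF b]
  show "bseq (\<lambda>n. a n * b n)" using ba bb by (rule bseq_mult)
  fix \<epsilon> :: real assume \<epsilon>: "\<epsilon> > 0"
  obtain C D where C: "C > 0" "\<And>n. norm (a n) \<le> C" and D: "D > 0" "\<And>n. norm (b n) \<le> D"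
    using bseq_bound[OF ba] bseq_bound[OF bb] by metis
  define K where "K = C + D"
  have K: "K > 0" "norm (a n) \<le> K" "norm (b n) \<le> K" for n
    unfolding K_def using C(1) D(1) C(2)[of n] D(2)[of n] by linarith+
  \<comment> \<open>Replacing both factors then costs \<open>2 * \<eta> * K = \<epsilon> / 4\<close>
    at each of the two indices, and \<open>\<epsilon> / 2\<close> is left for the encoding
    condition.\<close>
  define \<eta> where "\<eta> = \<epsilon> / (8 * K)"
  have \<eta>: "\<eta> > 0" using \<epsilon> K by (simp add: \<eta>_def)
  have "\<forall>\<^sub>F k in sequentially. (\<forall>\<^sub>F m in sequentially. norm (a m - R m k (a k)) < \<eta>) \<and>
      (\<forall>\<^sub>F m in sequentially. norm (b m - R m k (b k)) < \<eta>)"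
    using a b \<eta> by (intro eventually_conj) (simp_all add: coh_def is_lim_iff)
  then obtain k where k: "\<forall>\<^sub>F m in sequentially. norm (a m - R m k (a k)) < \<eta>"
      "\<forall>\<^sub>F m in sequentially. norm (b m - R m k (b k)) < \<eta>"
    using eventually_happens'[OF sequentially_bot] by blast
  define x where "x = a k"
  define y where "y = b k"
  have xy: "x \<in> B k" "y \<in> B k" using ba bb by (simp_all add: x_def y_def bseq_in)
  obtain M where M: "M \<ge> k"
    "\<And>m n j. M < n \<Longrightarrow> M < j \<Longrightarrow> max n j < m \<Longrightarrow>
        norm (R m n (R n k x * R n k y) - R m j (R j k x * R j k y)) < \<epsilon> / 2"
    using encoding[OF xy, of "\<epsilon> / 2"] \<epsilon> by auto
  have "\<forall>\<^sub>F m in sequentially. norm (a m - R m k x) < \<eta> \<and> norm (b m - R m k y) < \<eta>"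
    unfolding x_def y_def using k by (rule eventually_conj)
  then obtain N where N: "\<And>m. m \<ge> N \<Longrightarrow> norm (a m - R m k x) < \<eta> \<and> norm (b m - R m k y) < \<eta>"
    unfolding eventually_sequentially by blast
  have close: "norm (R m i (a i * b i) - R m i (R i k x * R i k y)) \<le> \<epsilon> / 4"
    if "i \<ge> N" "i \<ge> k" "m \<ge> i" for m i
  proof -
    have "norm (R m i (a i * b i) - R m i (R i k x * R i k y)) \<le> norm (a i * b i - R i k x * R i k y)"
      using that xy ba bb by (subst R_minus[symmetric]) (auto intro!: R_norm simp: minus_in mult_in R_in bseq_in)
    also have "\<dots> \<le> norm (a i - R i k x) * norm (b i) + norm (R i k x) * norm (b i - R i k y)"
      by (rule norm_mult_diff_le)
    also have "\<dots> \<le> \<eta> * K + K * \<eta>"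
      using N[OF that(1)] K \<eta> order_trans[OF R_norm[OF that(2) xy(1)] K(2)[of k, folded x_def]]
      by (intro add_mono mult_mono) auto
    also have "\<dots> = \<epsilon> / 4" using K by (simp add: \<eta>_def)
    finally show ?thesis .
  qed
  have "\<forall>\<^sub>F m in sequentially. norm (R m i (a i * b i) - R m j (a j * b j)) < \<epsilon>"
    if ij: "i \<ge> max N (Suc M)" "j \<ge> max N (Suc M)" for i j
    using eventually_gt_at_top[of "max i j"]
  proof eventually_elim
    case (elim m)
    define p q where "p = R m i (R i k x * R i k y)" and "q = R m j (R j k x * R j k y)"
    have "norm (R m i (a i * b i) - p) \<le> \<epsilon> / 4" "norm (R m j (a j * b j) - q) \<le> \<epsilon> / 4"
      unfolding p_def q_def using close[of i m] close[of j m] ij elim M(1) by simp_all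
    moreover have "norm (p - q) < \<epsilon> / 2"
      unfolding p_def q_def using ij elim by (intro M(2)) auto
    moreover have eq: "R m i (a i * b i) - R m j (a j * b j)
        = (R m i (a i * b i) - p) + (p - q) - (R m j (a j * b j) - q)" by simp
    ultimately show ?case
      unfolding eq
      using norm_triangle_ineq4[of "(R m i (a i * b i) - p) + (p - q)" "R m j (a j * b j) - q"]
        norm_triangle_ineq[of "R m i (a i * b i) - p" "p - q"] by linarith
  qed
  then show "\<exists>J. \<forall>i\<ge>J. \<forall>j\<ge>J. \<forall>\<^sub>F m in sequentially. norm (R m i (a i * b i) - R m j (a j * b j)) < \<epsilon>"
    by blast
qed

text \<open>The choice is determined only up to null sequences, which is why the laws below say that
  differences tend to 0.\<close>

definition lim_mult :: "(nat \<Rightarrow> 'u) \<Rightarrow> (nat \<Rightarrow> 'u) \<Rightarrow> nat \<Rightarrow> 'u" where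
  "lim_mult a b = (SOME c. bseq c \<and> is_lim c (\<lambda>n. a n * b n))"

lemma
  assumes "coh a" "coh b"
  shows bseq_lim_mult: "bseq (lim_mult a b)"
    and is_lim_lim_mult: "is_lim (lim_mult a b) (\<lambda>n. a n * b n)"
  using someI_ex[OF is_lim_mult_exists[OF assms]] by (simp_all add: lim_mult_def)

lemma coh_lim_mult: "coh a \<Longrightarrow> coh b \<Longrightarrow> coh (lim_mult a b)"
  by (rule is_lim_coh[OF bseq_lim_mult is_lim_lim_mult]) (auto simp: mult_in bseq_in coh_bseq)

lemma bseq_mult_in: "bseq a \<Longrightarrow> bseq b \<Longrightarrow> a n * b n \<in> B n"
  by (simp add: mult_in bseq_in)

text \<open>The common source of the algebraic laws: the other side of the law is exhibited as a
  limit of some \<open>d\<close> that is asymptotic to the pointwise product.\<close>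

lemma lim_mult_unique:
  assumes "coh a" "coh b" "is_lim c d" "\<And>n. d n \<in> B n" "(\<lambda>n. a n * b n - d n) \<longlonglongrightarrow> 0"
  shows "(\<lambda>n. lim_mult a b n - c n) \<longlonglongrightarrow> 0"
  using is_lim_unique[OF is_lim_lim_mult[OF assms(1,2)] assms(3,5) _ assms(4)] assms(1,2)
  by (simp add: bseq_mult_in coh_bseq)

lemma lim_mult_cong:
  assumes "coh a" "coh b" "coh a'" "coh b'"
    "(\<lambda>n. a n - a' n) \<longlonglongrightarrow> 0" "(\<lambda>n. b n - b' n) \<longlonglongrightarrow> 0"
  shows "(\<lambda>n. lim_mult a b n - lim_mult a' b' n) \<longlonglongrightarrow> 0"
proof (rule lim_mult_unique[OF assms(1,2) is_lim_lim_mult[OF assms(3,4)]])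
  obtain C D where "\<And>n. norm (b n) \<le> C" "\<And>n. norm (a' n) \<le> D"
    using bseq_bound[OF coh_bseq[OF assms(2)]] bseq_bound[OF coh_bseq[OF assms(3)]] by metis
  then have "(\<lambda>n. (a n - a' n) * b n + a' n * (b n - b' n)) \<longlonglongrightarrow> 0 + 0"
    by (intro tendsto_add tendsto_zero_mult_bounded assms)
  then show "(\<lambda>n. a n * b n - a' n * b' n) \<longlonglongrightarrow> 0" by (simp add: algebra_simps)
qed (use assms in \<open>simp add: bseq_mult_in coh_bseq\<close>)

lemma lim_mult_add_left:
  assumes "coh a" "coh a'" "coh b"
  shows "(\<lambda>n. lim_mult (\<lambda>n. a n + a' n) b n - (lim_mult a b n + lim_mult a' b n)) \<longlonglongrightarrow> 0"
  by (rule lim_mult_unique[OF coh_add[OF assms(1,2)] assms(3)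
        is_lim_add[OF is_lim_lim_mult[OF assms(1,3)] is_lim_lim_mult[OF assms(2,3)]]])
     (use assms in \<open>simp_all add: bseq_mult_in coh_bseq add_in distrib_right\<close>)

lemma lim_mult_add_right:
  assumes "coh a" "coh b" "coh b'"
  shows "(\<lambda>n. lim_mult a (\<lambda>n. b n + b' n) n - (lim_mult a b n + lim_mult a b' n)) \<longlonglongrightarrow> 0"
  by (rule lim_mult_unique[OF assms(1) coh_add[OF assms(2,3)]
        is_lim_add[OF is_lim_lim_mult[OF assms(1,2)] is_lim_lim_mult[OF assms(1,3)]]])
     (use assms in \<open>simp_all add: bseq_mult_in coh_bseq add_in distrib_left\<close>)

lemma lim_mult_cscale_left:
  assumes "coh a" "coh b"
  shows "(\<lambda>n. lim_mult (\<lambda>n. cscale c * a n) b n - cscale c * lim_mult a b n) \<longlonglongrightarrow> 0"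
  by (rule lim_mult_unique[OF coh_cscale[OF assms(1)] assms(2)
        is_lim_cscale[OF is_lim_lim_mult[OF assms]]])
     (use assms in \<open>simp_all add: bseq_mult_in coh_bseq cscale_in mult.assoc\<close>)

lemma lim_mult_cscale_right:
  assumes "coh a" "coh b"
  shows "(\<lambda>n. lim_mult a (\<lambda>n. cscale c * b n) n - cscale c * lim_mult a b n) \<longlonglongrightarrow> 0"
  by (rule lim_mult_unique[OF assms(1) coh_cscale[OF assms(2)]
        is_lim_cscale[OF is_lim_lim_mult[OF assms]]])
     (use assms in \<open>simp_all add: bseq_mult_in coh_bseq cscale_in cscale_left_commute[of "a _"]\<close>)

lemma lim_mult_adj:
  assumes "coh a" "coh b"
  shows "(\<lambda>n. lim_mult (\<lambda>n. adj (b n)) (\<lambda>n. adj (a n)) n - adj (lim_mult a b n)) \<longlonglongrightarrow> 0"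
  by (rule lim_mult_unique[OF coh_adj[OF assms(2)] coh_adj[OF assms(1)]
        is_lim_adj[OF is_lim_lim_mult[OF assms]]])
     (use assms in \<open>simp_all add: mult_in bseq_in coh_bseq adj_in adj_mult\<close>)

section \<open>The norm of the limit product\<close>

lemma lim_mult_norm:
  assumes "coh a" "coh b" "\<forall>\<^sub>F n in sequentially. norm (a n) \<le> s"
    "\<forall>\<^sub>F n in sequentially. norm (b n) \<le> t" "\<epsilon> > 0"
  shows "\<forall>\<^sub>F n in sequentially. norm (lim_mult a b n) < s * t + \<epsilon>"
proof (rule is_lim_bound[OF is_lim_lim_mult[OF assms(1,2)] _ _ assms(5)])
  show "\<forall>\<^sub>F n in sequentially. norm (a n * b n) \<le> s * t"
    using assms(3,4)
  proof eventually_elim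
    case (elim n)
    have "norm (a n * b n) \<le> norm (a n) * norm (b n)" by (rule norm_mult_ineq)
    also have "\<dots> \<le> s * t" using elim order_trans[OF norm_ge_zero elim(1)] by (intro mult_mono) auto
    finally show ?case .
  qed
qed (use assms in \<open>simp add: bseq_mult_in coh_bseq\<close>)

lemma R_norm_square_le:
  assumes "n \<le> m" "u \<in> B n"
  shows "(norm (R m n u))\<^sup>2 \<le> norm (R m n (adj u * u))"
proof -
  obtain s where "R m n (adj u * u) - adj (R m n u) * R m n u = adj s * s"
    using R_Kadison_Schwarz[OF assms] by blast
  then have "R m n (adj u * u) = adj (R m n u) * R m n u + adj s * s" by (simp add: algebra_simps)
  then show ?thesis using norm_adj_mult_self_le_add[of "R m n u" s] by simp
qed

text \<open>The part of the C*-identity that does not come from submultiplicativity. For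
  \<open>n\<close> large and \<open>m\<close> larger, \<open>a m\<close> is close to
  \<open>R m n (a n)\<close>, whose squared norm is at most that of
  \<open>R m n (adj (a n) * a n)\<close>, and this is close to the product at
  \<open>m\<close>.\<close>

lemma lim_mult_cstar:
  assumes a: "coh a" and c: "\<forall>\<^sub>F n in sequentially. norm (lim_mult (\<lambda>n. adj (a n)) a n) \<le> s"
    and \<epsilon>: "\<epsilon> > 0"
  shows "\<forall>\<^sub>F n in sequentially. norm (a n) < sqrt s + \<epsilon>"
proof -
  define c where "c = lim_mult (\<lambda>n. adj (a n)) a"
  \<comment> \<open>Of the two approximations, one enters under the square root and one outside;
    continuity of the square root absorbs both into \<open>\<epsilon>\<close>.\<close>
  obtain \<delta> where \<delta>: "\<delta> > 0" "sqrt (s + \<delta>) + \<delta> < sqrt s + \<epsilon>"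
  proof -
    have "((\<lambda>d. sqrt (s + d) + d) \<longlongrightarrow> sqrt (s + 0) + 0) (at_right 0)"
      by (intro tendsto_intros)
    then have "\<forall>\<^sub>F d in at_right 0. sqrt (s + d) + d < sqrt s + \<epsilon>"
      using \<epsilon> by (intro order_tendstoD) auto
    then have "\<forall>\<^sub>F d in at_right 0. d > 0 \<and> sqrt (s + d) + d < sqrt s + \<epsilon>"
      using eventually_at_right_less[of 0] by eventually_elim auto
    then show ?thesis using that eventually_happens'[OF trivial_limit_at_right_real[of 0]] by auto
  qed
  have in': "a n \<in> B n" for n using a by (simp add: coh_bseq bseq_in)
  have lim: "is_lim c (\<lambda>n. adj (a n) * a n)"
    unfolding c_def by (rule is_lim_lim_mult[OF coh_adj[OF a] a])
  have "\<forall>\<^sub>F p in iter. norm (c (snd p) - R (snd p) (fst p) (adj (a (fst p)) * a (fst p))) < \<delta>"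
    using lim \<delta>(1) unfolding is_lim_def tendsto_iff by simp
  moreover have "\<forall>\<^sub>F p in iter. norm (a (snd p) - R (snd p) (fst p) (a (fst p))) < \<delta>"
    using a \<delta>(1) unfolding coh_def is_lim_def tendsto_iff by simp
  moreover have "\<forall>\<^sub>F p in iter. norm (c (snd p)) \<le> s"
    using assms(2) by (simp add: eventually_iter c_def)
  ultimately have "\<forall>\<^sub>F p in iter. norm (a (snd p)) < sqrt s + \<epsilon>"
    using eventually_less_iter
  proof eventually_elim
    case (elim p)
    let ?r = "R (snd p) (fst p) (a (fst p))" and ?q = "R (snd p) (fst p) (adj (a (fst p)) * a (fst p))"
    have "(norm ?r)\<^sup>2 \<le> norm ?q" using elim in' by (intro R_norm_square_le) auto
    also have "\<dots> \<le> s + \<delta>"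
      using elim norm_triangle_sub[of ?q "c (snd p)"] norm_minus_commute[of ?q "c (snd p)"] by linarith
    finally have "norm ?r \<le> sqrt (s + \<delta>)" by (rule real_le_rsqrt)
    then show ?case using elim \<delta>(2) norm_triangle_sub[of "a (snd p)" ?r] by linarith
  qed
  then show ?thesis by (simp add: eventually_iter)
qed

section \<open>Associativity\<close>

text \<open>In the limit, \<open>negligible d\<close> means that \<open>\<rho>\<^sub>m(d\<^sub>mz\<^sub>m) \<rightarrow> 0\<close> for every bounded
  sequence \<open>z\<close>. The point is that \<open>d = c - ab\<close> is negligible whenever \<open>c\<close> represents the product
  of \<open>a\<close> and \<open>b\<close>, although \<open>d\<close> itself need not tend to \<open>0\<close> in norm.\<close>

definition negligible :: "(nat \<Rightarrow> 'u) \<Rightarrow> bool" where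
  "negligible d \<longleftrightarrow> (\<forall>n. d n \<in> B n) \<and>
     (\<forall>z. bseq z \<longrightarrow> ((\<lambda>p. R (snd p) (fst p) (d (fst p) * z (fst p))) \<longlongrightarrow> 0) iter)"

lemma negligible_tendsto:
  "\<lbrakk>negligible d; bseq z\<rbrakk> \<Longrightarrow> ((\<lambda>p. R (snd p) (fst p) (d (fst p) * z (fst p))) \<longlongrightarrow> 0) iter"
  by (simp add: negligible_def)

lemma negligible_add:
  assumes "negligible d" "negligible d'"
  shows "negligible (\<lambda>n. d n + d' n)"
  unfolding negligible_def
proof (intro conjI allI impI)
  show "d n + d' n \<in> B n" for n using assms by (simp add: negligible_def add_in)
  fix z assume z: "bseq z"
  have t: "((\<lambda>p. R (snd p) (fst p) (d (fst p) * z (fst p)) + R (snd p) (fst p) (d' (fst p) * z (fst p)))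
      \<longlongrightarrow> 0 + 0) iter"
    using assms z by (intro tendsto_add) (auto simp: negligible_def)
  have "\<forall>\<^sub>F p in iter. R (snd p) (fst p) (d (fst p) * z (fst p)) + R (snd p) (fst p) (d' (fst p) * z (fst p))
      = R (snd p) (fst p) ((d (fst p) + d' (fst p)) * z (fst p))"
    using eventually_less_iter
    by eventually_elim (use assms z in \<open>simp add: R_add distrib_right negligible_def mult_in bseq_in\<close>)
  from Lim_transform_eventually[OF t this]
  show "((\<lambda>p. R (snd p) (fst p) ((d (fst p) + d' (fst p)) * z (fst p))) \<longlongrightarrow> 0) iter" by simp
qed

lemma negligible_cscale:
  assumes "negligible d"
  shows "negligible (\<lambda>n. cscale c * d n)"
  unfolding negligible_def
proof (intro conjI allI impI)
  show "cscale c * d n \<in> B n" for n using assms by (simp add: negligible_def cscale_in)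
  fix z assume z: "bseq z"
  have t: "((\<lambda>p. cscale c * R (snd p) (fst p) (d (fst p) * z (fst p))) \<longlongrightarrow> 0) iter"
    using assms z by (intro tendsto_mult_right_zero) (auto simp: negligible_def)
  have "\<forall>\<^sub>F p in iter. cscale c * R (snd p) (fst p) (d (fst p) * z (fst p))
      = R (snd p) (fst p) (cscale c * d (fst p) * z (fst p))"
    using eventually_less_iter
    by eventually_elim (use assms z in \<open>simp add: R_cscale[symmetric] mult.assoc negligible_def mult_in bseq_in\<close>)
  from Lim_transform_eventually[OF t this]
  show "((\<lambda>p. R (snd p) (fst p) (cscale c * d (fst p) * z (fst p))) \<longlongrightarrow> 0) iter" .
qed

text \<open>Neither the bounded factor \<open>z\<close> nor the contractions \<open>R m n\<close>
  magnify a norm error by more than a constant. This reduces negligibility to orbits.\<close>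

lemma negligible_approx:
  assumes d: "\<And>n. d n \<in> B n"
    and approx: "\<And>\<epsilon>. \<epsilon> > 0 \<Longrightarrow> \<exists>d'. negligible d' \<and> (\<forall>\<^sub>F m in sequentially. norm (d m - d' m) < \<epsilon>)"
  shows "negligible d"
  unfolding negligible_def
proof (intro conjI allI impI d)
  fix z assume z: "bseq z"
  obtain C where C: "C > 0" "\<And>n. norm (z n) \<le> C" using bseq_bound[OF z] by blast
  show "((\<lambda>p. R (snd p) (fst p) (d (fst p) * z (fst p))) \<longlongrightarrow> 0) iter"
    unfolding tendsto_iff
  proof (intro allI impI)
    fix \<epsilon> :: real assume \<epsilon>: "\<epsilon> > 0"
    then obtain d' where d': "negligible d'" and
      ev: "\<forall>\<^sub>F m in sequentially. norm (d m - d' m) < \<epsilon> / (2 * C)"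
      using approx[of "\<epsilon> / (2 * C)"] C by auto
    have "\<forall>\<^sub>F p in iter. norm (R (snd p) (fst p) (d' (fst p) * z (fst p))) < \<epsilon> / 2"
      using tendstoD[OF negligible_tendsto[OF d' z] half_gt_zero[OF \<epsilon>]] by simp
    moreover have "\<forall>\<^sub>F p in iter. norm (d (fst p) - d' (fst p)) < \<epsilon> / (2 * C)"
      using eventually_compose_filterlim[OF ev filterlim_fst_iter] .
    ultimately show "\<forall>\<^sub>F p in iter. dist (R (snd p) (fst p) (d (fst p) * z (fst p))) 0 < \<epsilon>"
      using eventually_less_iter
    proof eventually_elim
      case (elim p)
      obtain n m where p: "p = (n, m)" by (cases p)
      have i: "d n \<in> B n" "d' n \<in> B n" "z n \<in> B n"
        using d d' z by (auto simp: negligible_def bseq_in)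
      have "norm (R m n (d n * z n) - R m n (d' n * z n)) = norm (R m n ((d n - d' n) * z n))"
        using i elim p by (simp add: R_minus[symmetric] mult_in left_diff_distrib)
      also have "\<dots> \<le> norm ((d n - d' n) * z n)"
        using i elim p by (intro R_norm) (auto simp: mult_in minus_in)
      also have "\<dots> \<le> norm (d n - d' n) * norm (z n)" by (rule norm_mult_ineq)
      also have "\<dots> \<le> \<epsilon> / (2 * C) * C"
        using elim p C \<epsilon> by (intro mult_mono) auto
      also have "\<dots> = \<epsilon> / 2" using C by simp
      finally show ?case
        using elim p norm_triangle_sub[of "R m n (d n * z n)" "R m n (d' n * z n)"] by simp
    qed
  qed
qed

lemma negligible_null:
  assumes "d \<longlonglongrightarrow> 0" "\<And>n. d n \<in> B n"
  shows "negligible d"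
proof (rule negligible_approx[OF assms(2)])
  fix \<epsilon> :: real assume "\<epsilon> > 0"
  moreover have "R m n 0 = 0" if "n \<le> m" for m n
    using R_norm[OF that zero_in[of n]] by simp
  then have "negligible (\<lambda>_. 0)"
    unfolding negligible_def
    by (auto simp: zero_in intro!: tendsto_eventually eventually_mono[OF eventually_less_iter])
  ultimately show "\<exists>d'. negligible d' \<and> (\<forall>\<^sub>F m in sequentially. norm (d m - d' m) < \<epsilon>)"
    using assms(1) by (intro exI[of _ "\<lambda>_. 0"]) (simp add: tendsto_iff)
qed

abbreviation orbit :: "nat \<Rightarrow> 'u \<Rightarrow> nat \<Rightarrow> 'u" where
  "orbit k x \<equiv> (\<lambda>n. if k \<le> n then R n k x else 0)"

lemma coh_orbit_adj: "x \<in> B k \<Longrightarrow> coh (\<lambda>n. adj (orbit k x n))"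
  by (intro coh_adj coh_R)

text \<open>Here \<open>\<rho>\<^bsub>m,n\<^esub>(x\<^sub>n\<^sup>*x\<^sub>n) - x\<^sub>m\<^sup>*x\<^sub>m = s\<^sup>*s\<close> by the Kadison-Schwarz inequality, and its image in
  the limit is small; hence so is the image of \<open>s\<^sup>*(sz)\<close>, by the Cauchy-Schwarz inequality.\<close>

lemma negligible_square:
  assumes x: "x \<in> B k"
  shows "negligible (\<lambda>n. lim_mult (\<lambda>n. adj (orbit k x n)) (orbit k x) n - adj (orbit k x n) * orbit k x n)"
proof -
  note ax = coh_orbit_adj[OF x] and cx = coh_R[OF x]
  define v where "v n = adj (orbit k x n) * orbit k x n" for n
  define c where "c = lim_mult (\<lambda>n. adj (orbit k x n)) (orbit k x)"
  have c: "bseq c" "is_lim c v"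
    unfolding c_def v_def by (rule bseq_lim_mult[OF ax cx], rule is_lim_lim_mult[OF ax cx])
  have v: "v n \<in> B n" for n
    unfolding v_def by (rule bseq_mult_in[OF coh_bseq[OF ax] coh_bseq[OF cx]])
  define K where "K = norm x"
  have "((\<lambda>p. R (snd p) (fst p) ((c (fst p) - v (fst p)) * z (fst p))) \<longlongrightarrow> 0) iter"
    if z: "bseq z" for z
    unfolding tendsto_iff
  proof (intro allI impI)
    fix \<epsilon> :: real assume \<epsilon>: "\<epsilon> > 0"
    obtain C where C: "C > 0" "\<And>n. norm (z n) \<le> C" using bseq_bound[OF z] by blast
    \<comment> \<open>Both parts of the final error have to stay within
      \<open>\<epsilon> / 2\<close>: the distance of \<open>c m\<close> from
      \<open>R m n (v n)\<close> contributes \<open>\<eta> * C\<close>, and the Cauchy-Schwarz term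
      has square at most \<open>\<eta> * (2 * K\<^sup>2 * C\<^sup>2)\<close>.\<close>
    obtain \<eta> where \<eta>: "\<eta> > 0" "\<eta> * C < \<epsilon> / 2" "\<eta> * (2 * K\<^sup>2 * C\<^sup>2) \<le> (\<epsilon> / 2)\<^sup>2"
    proof
      \<comment> \<open>The summand 1 allows division by \<open>t\<close> when
        \<open>x = 0\<close>.\<close>
      define t where "t = (K\<^sup>2 + 1) * C\<^sup>2"
      have t: "t > 0" "2 * K\<^sup>2 * C\<^sup>2 \<le> 2 * t"
        using C(1) by (simp_all add: t_def add_nonneg_pos mult_right_mono)
      define \<eta> where "\<eta> = min (\<epsilon> / (4 * C)) (\<epsilon>\<^sup>2 / (8 * t))"
      show "\<eta> > 0" using \<epsilon> C(1) t by (simp add: \<eta>_def)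
      have "\<eta> * C \<le> \<epsilon> / (4 * C) * C" using C(1) by (intro mult_right_mono) (auto simp: \<eta>_def)
      then show "\<eta> * C < \<epsilon> / 2" using C(1) \<epsilon> by simp
      have "\<eta> * (2 * K\<^sup>2 * C\<^sup>2) \<le> \<epsilon>\<^sup>2 / (8 * t) * (2 * t)"
        using t by (intro mult_mono[OF _ t(2)]) (auto simp: \<eta>_def)
      also have "\<dots> = (\<epsilon> / 2)\<^sup>2" using t(1) by (simp add: power2_eq_square)
      finally show "\<eta> * (2 * K\<^sup>2 * C\<^sup>2) \<le> (\<epsilon> / 2)\<^sup>2" .
    qed
    obtain M where M: "M \<ge> k" "\<And>m n j. M < n \<Longrightarrow> M < j \<Longrightarrow> max n j < m \<Longrightarrow>
        norm (R m n (R n k (adj x) * R n k x) - R m j (R j k (adj x) * R j k x)) < \<eta>"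
      using encoding[OF adj_in[OF x] x \<eta>(1)] by auto
    obtain n where n: "n \<ge> Suc M" and ev: "\<forall>\<^sub>F m in sequentially. norm (c m - R m n (v n)) < \<eta>"
      using is_lim_approx[OF c(2) \<eta>(1)] by blast
    \<comment> \<open>Three indices occur: the squares at \<open>n\<close> and at \<open>m\<close>
      are compared, and the error is measured at \<open>l\<close>.\<close>
    have "norm (R l m ((c m - v m) * z m)) < \<epsilon>"
      if m: "m > n" and cm: "norm (c m - R m n (v n)) < \<eta>" and l: "l > m" for l m
    proof -
      have nk: "k \<le> n" "k \<le> m" "n \<le> m" "m \<le> l" "n \<le> l" using M(1) n m l by auto
      define y where "y = R n k x"
      have y: "y \<in> B n" "norm y \<le> K" using x nk by (auto simp: y_def K_def R_in R_norm)
      have vn: "v n = adj y * y" using nk by (simp add: v_def y_def)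
      have vm: "v m = adj (R m n y) * R m n y" using nk x by (simp add: v_def y_def R_R)
      define d where "d = R m n (v n) - v m"
      obtain s where s: "s \<in> B m" "d = adj s * s"
        using R_Kadison_Schwarz[OF nk(3) y(1)] unfolding d_def vn vm by blast
      have nv: "norm (v j) \<le> K\<^sup>2" for j
      proof -
        have "norm (orbit k x j) \<le> K" using R_norm[of k j x] x by (auto simp: K_def)
        then show ?thesis unfolding v_def cstar_norm by (intro power_mono) auto
      qed
      have "norm (R m n (v n)) \<le> norm (v n)" by (rule R_norm[OF nk(3) v])
      then have "norm d \<le> 2 * K\<^sup>2"
        using nv[of n] nv[of m] norm_triangle_ineq4[of "R m n (v n)" "v m"] by (simp add: d_def)
      then have ns: "(norm s)\<^sup>2 \<le> 2 * K\<^sup>2" by (simp add: s(2) cstar_norm)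
      \<comment> \<open>Transported to \<open>l\<close>, the element \<open>d\<close> becomes the
        difference that the encoding condition bounds for the indices \<open>n\<close> and
        \<open>m\<close>, although \<open>d\<close> itself need not be small.\<close>
      have "R l m d = R l n (v n) - R l m (v m)"
        using nk v by (simp add: d_def R_minus R_in R_R)
      also have "\<dots> = R l n (R n k (adj x) * R n k x) - R l m (R m k (adj x) * R m k x)"
        using nk x by (simp add: v_def R_adj)
      finally have Rd: "norm (R l m (adj s * s)) < \<eta>"
        using M(2)[of n m l] n m l by (simp add: s(2))
      have sz: "s * z m \<in> B m" using s z by (simp add: mult_in bseq_in)
      \<comment> \<open>Cauchy-Schwarz for the pair \<open>s\<close> and \<open>s * z m\<close>, as
        \<open>d * z m = adj s * (s * z m)\<close>.\<close>
      have "(norm (R l m (d * z m)))\<^sup>2 \<le> norm (R l m (adj s * s)) * norm (R l m (adj (s * z m) * (s * z m)))"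
        using R_Cauchy_Schwarz[OF nk(4) s(1) sz] by (simp add: s(2) mult.assoc)
      also have "\<dots> \<le> \<eta> * (2 * K\<^sup>2 * C\<^sup>2)"
      proof (rule mult_mono)
        have "norm (R l m (adj (s * z m) * (s * z m))) \<le> norm (adj (s * z m) * (s * z m))"
          by (rule R_norm[OF nk(4) mult_in[OF adj_in[OF sz] sz]])
        also have "\<dots> = (norm (s * z m))\<^sup>2" by (rule cstar_norm)
        also have "\<dots> \<le> (norm s * C)\<^sup>2"
          using C mult_left_mono[OF C(2)[of m] norm_ge_zero[of s]]
          by (intro power_mono order_trans[OF norm_mult_ineq]) auto
        also have "\<dots> \<le> 2 * K\<^sup>2 * C\<^sup>2"
          using ns by (simp add: power_mult_distrib mult_right_mono)
        finally show "norm (R l m (adj (s * z m) * (s * z m))) \<le> 2 * K\<^sup>2 * C\<^sup>2" .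
      qed (use Rd \<eta> in auto)
      also note \<eta>(3)
      finally have 1: "norm (R l m (d * z m)) \<le> \<epsilon> / 2"
        using \<epsilon> by (simp add: power2_le_iff_abs_le)
      have e: "c m - R m n (v n) \<in> B m" using c v nk by (simp add: minus_in bseq_in R_in)
      have zm: "z m \<in> B m" using z by (rule bseq_in)
      have "norm (R l m ((c m - R m n (v n)) * z m)) \<le> norm ((c m - R m n (v n)) * z m)"
        by (intro R_norm[OF nk(4)] mult_in e zm)
      also have "\<dots> \<le> norm (c m - R m n (v n)) * norm (z m)" by (rule norm_mult_ineq)
      also have "\<dots> \<le> \<eta> * C" using cm C \<eta> by (intro mult_mono) auto
      finally have 2: "norm (R l m ((c m - R m n (v n)) * z m)) < \<epsilon> / 2" using \<eta>(2) by linarith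
      \<comment> \<open>The first summand is already small in norm at \<open>m\<close>; the second
        is small only at \<open>l\<close>.\<close>
      have "(c m - v m) * z m = (c m - R m n (v n)) * z m + d * z m"
        by (simp add: d_def algebra_simps)
      then have "R l m ((c m - v m) * z m) = R l m ((c m - R m n (v n)) * z m) + R l m (d * z m)"
        using nk e zm s by (simp add: R_add mult_in adj_in)
      then show ?thesis
        using 1 2 norm_triangle_ineq[of "R l m ((c m - R m n (v n)) * z m)" "R l m (d * z m)"] by simp
    qed
    then show "\<forall>\<^sub>F p in iter. dist (R (snd p) (fst p) ((c (fst p) - v (fst p)) * z (fst p))) 0 < \<epsilon>"
      unfolding eventually_iter using ev
      by (auto elim!: eventually_elim2[OF _ eventually_gt_at_top[of n]]
          intro: eventually_mono[OF eventually_gt_at_top])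
  qed
  moreover have "c n - v n \<in> B n" for n using c v by (simp add: minus_in bseq_in)
  ultimately show ?thesis unfolding negligible_def c_def v_def by blast
qed

lemma negligible_minus: "negligible d \<Longrightarrow> negligible d' \<Longrightarrow> negligible (\<lambda>n. d n - d' n)"
  using negligible_add[of d "\<lambda>n. cscale (- 1) * d' n"] negligible_cscale[of d' "- 1"]
  by (simp add: cscale_minus)

text \<open>Polarization of \<open>negligible_square\<close>: the product \<open>adj a * b\<close>
  is a combination of the squares belonging to \<open>x\<close>, \<open>y\<close>,
  \<open>x + y\<close> and \<open>x + \<i> y\<close>.\<close>

lemma negligible_orbits:
  assumes x: "x \<in> B k" and y: "y \<in> B k"
  shows "negligible (\<lambda>n. lim_mult (\<lambda>n. adj (orbit k x n)) (orbit k y) n - adj (orbit k x n) * orbit k y n)"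
proof -
  define q where "q w n = adj (orbit k w n) * orbit k w n" for w n
  define c where "c w = lim_mult (\<lambda>n. adj (orbit k w n)) (orbit k w)" for w
  have q: "q w n \<in> B n" if "w \<in> B k" for w n
    using bseq_mult_in[OF coh_bseq[OF coh_orbit_adj[OF that]] coh_bseq[OF coh_R[OF that]]]
    by (simp add: q_def)
  have lim: "is_lim (c w) (q w)" if "w \<in> B k" for w
    using is_lim_lim_mult[OF coh_orbit_adj[OF that] coh_R[OF that]] by (simp add: c_def q_def[abs_def])
  define e where "e w n = c w n - q w n" for w n
  have neg: "negligible (e w)" if "w \<in> B k" for w
    using negligible_square[OF that] by (simp add: e_def[abs_def] c_def q_def)
  define w1 w2 where "w1 = x + y" and "w2 = x + cscale \<i> * y"
  have w: "w1 \<in> B k" "w2 \<in> B k" using x y by (simp_all add: w1_def w2_def add_in cscale_in)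
  \<comment> \<open>For a sesquilinear form, \<open>w1\<close> contributes
    \<open>adj a * b + adj b * a\<close>, and \<open>w2\<close>, multiplied by
    \<open>- \<i>\<close>, contributes \<open>adj a * b - adj b * a\<close>.\<close>
  define comb where "comb f n = cscale (1/2) * ((f w1 n - f x n - f y n) - cscale \<i> * (f w2 n - f x n - f y n))"
    for f :: "'u \<Rightarrow> nat \<Rightarrow> 'u" and n
  have lim_comb: "is_lim (comb c) (comb q)"
    unfolding comb_def using x y w lim q by (intro is_lim_cscale is_lim_minus cscale_in minus_in)
  have half: "cscale (1/2) * (u + u) = u" for u :: 'u
    using cscale_add[of "1/2" "1/2", where ?'a = 'u] by (simp add: distrib_left flip: distrib_right)
  have comb_q: "comb q n = adj (orbit k x n) * orbit k y n" for n
  proof -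
    define a b where "a = orbit k x n" and "b = orbit k y n"
    have o: "orbit k w1 n = a + b" "orbit k w2 n = a + cscale \<i> * b"
      using x y by (simp_all add: w1_def w2_def a_def b_def R_add R_cscale cscale_in)
    have sq: "adj (a + cscale \<i> * b) * (a + cscale \<i> * b)
        = adj a * a + cscale \<i> * (adj a * b) - cscale \<i> * (adj b * a) + adj b * b"
      by (simp add: adj_add adj_cscale_mult cscale_minus algebra_simps cscale_ii
          cscale_left_commute[of "adj a"] cscale_left_commute[of "adj b"])
    have "(adj (a + b) * (a + b) - adj a * a - adj b * b)
        - cscale \<i> * ((adj a * a + cscale \<i> * (adj a * b) - cscale \<i> * (adj b * a) + adj b * b)
          - adj a * a - adj b * b) = adj a * b + adj a * b"
      by (simp add: adj_add algebra_simps cscale_ii)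
    then have "comb q n = cscale (1/2) * (adj a * b + adj a * b)"
      by (simp only: comb_def q_def o sq a_def[symmetric] b_def[symmetric])
    then show ?thesis by (simp only: half a_def b_def)
  qed
  then have "comb q = (\<lambda>n. adj (orbit k x n) * orbit k y n)" by (rule ext)
  with lim_comb have lim': "is_lim (comb c) (\<lambda>n. adj (orbit k x n) * orbit k y n)"
    by (simp only:)
  define L where "L = lim_mult (\<lambda>n. adj (orbit k x n)) (orbit k y)"
  note coh' = coh_orbit_adj[OF x] coh_R[OF y]
  have in': "adj (orbit k x n) * orbit k y n \<in> B n" for n
    by (rule bseq_mult_in[OF coh_bseq[OF coh'(1)] coh_bseq[OF coh'(2)]])
  \<comment> \<open>The chosen products satisfy the polarization identity only up to a null
    sequence, and null sequences are negligible.\<close>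
  have "(\<lambda>n. L n - comb c n) \<longlonglongrightarrow> 0"
    unfolding L_def by (rule lim_mult_unique[OF coh' lim' in']) simp
  moreover have "L n - comb c n \<in> B n" for n
    using x y w bseq_in[OF bseq_lim_mult[OF coh_orbit_adj coh_R]]
    unfolding L_def comb_def c_def by (intro minus_in cscale_in) blast+
  ultimately have "negligible (\<lambda>n. L n - comb c n)" by (rule negligible_null)
  moreover have "negligible (comb e)"
    unfolding comb_def using x y w neg by (intro negligible_cscale negligible_minus)
  ultimately have "negligible (\<lambda>n. (L n - comb c n) + comb e n)"
    by (rule negligible_add)
  moreover have "(L n - comb c n) + comb e n = L n - comb q n" for n
    by (simp add: comb_def e_def algebra_simps)
  ultimately have "negligible (\<lambda>n. L n - comb q n)" by (simp only:)
  then show ?thesis by (simp only: comb_q L_def)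
qed

text \<open>One index \<open>k\<close> serves both sequences, because
  \<open>negligible_orbits\<close> concerns two elements of the same \<open>B k\<close>.\<close>

lemma orbit_approx:
  assumes "coh a" "coh b" "\<epsilon> > 0"
  obtains k where "\<forall>\<^sub>F m in sequentially. norm (a m - orbit k (a k) m) < \<epsilon>"
    "\<forall>\<^sub>F m in sequentially. norm (b m - orbit k (b k) m) < \<epsilon>"
proof -
  have "\<forall>\<^sub>F k in sequentially. (\<forall>\<^sub>F m in sequentially. norm (a m - R m k (a k)) < \<epsilon>) \<and>
      (\<forall>\<^sub>F m in sequentially. norm (b m - R m k (b k)) < \<epsilon>)"
    using assms by (intro eventually_conj) (simp_all add: coh_def is_lim_iff)
  then obtain k where k: "\<forall>\<^sub>F m in sequentially. norm (a m - R m k (a k)) < \<epsilon>"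
      "\<forall>\<^sub>F m in sequentially. norm (b m - R m k (b k)) < \<epsilon>"
    using eventually_happens'[OF sequentially_bot] by blast
  show ?thesis
  proof (rule that[of k])
    show "\<forall>\<^sub>F m in sequentially. norm (a m - orbit k (a k) m) < \<epsilon>"
      using k(1) eventually_ge_at_top[of k] by eventually_elim simp
    show "\<forall>\<^sub>F m in sequentially. norm (b m - orbit k (b k) m) < \<epsilon>"
      using k(2) eventually_ge_at_top[of k] by eventually_elim simp
  qed
qed

text \<open>Orbits \<open>a'\<close> and \<open>b'\<close> near \<open>a\<close> and
  \<open>b\<close> change the pointwise product by little in norm, and then, as the maps are
  contractive, also the limit product. So the difference is approximated by the negligible one for
  orbits.\<close>

lemma negligible_lim_mult:
  assumes a: "coh a" and b: "coh b"
  shows "negligible (\<lambda>n. lim_mult a b n - a n * b n)"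
proof (rule negligible_approx)
  note ba = coh_bseq[OF a] and bb = coh_bseq[OF b]
  show "lim_mult a b n - a n * b n \<in> B n" for n
    using bseq_in[OF bseq_lim_mult[OF a b]] bseq_mult_in[OF ba bb] by (rule minus_in)
  fix \<epsilon> :: real assume \<epsilon>: "\<epsilon> > 0"
  obtain C D where C: "C > 0" "\<And>n. norm (a n) \<le> C" and D: "D > 0" "\<And>n. norm (b n) \<le> D"
    using bseq_bound[OF ba] bseq_bound[OF bb] by metis
  define K where "K = C + D"
  have K: "K > 0" "norm (a n) \<le> K" "norm (b n) \<le> K" for n
    unfolding K_def using C(1) D(1) C(2)[of n] D(2)[of n] by linarith+
  define \<eta> where "\<eta> = \<epsilon> / (8 * K)"
  have \<eta>: "\<eta> > 0" using \<epsilon> K by (simp add: \<eta>_def)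
  obtain k where k: "\<forall>\<^sub>F m in sequentially. norm (a m - orbit k (a k) m) < \<eta>"
      "\<forall>\<^sub>F m in sequentially. norm (b m - orbit k (b k) m) < \<eta>"
    using orbit_approx[OF a b \<eta>] by blast
  have ak: "a k \<in> B k" "b k \<in> B k" using ba bb by (simp_all add: bseq_in)
  define a' where "a' = orbit k (a k)"
  define b' where "b' = orbit k (b k)"
  have coh': "coh a'" "coh b'" using ak unfolding a'_def b'_def by (simp_all only: coh_R)
  \<comment> \<open>The first factor in \<open>negligible_orbits\<close> is an adjoint, so
    \<open>a'\<close> is rewritten as the adjoint of an orbit.\<close>
  have "a' = (\<lambda>n. adj (orbit k (adj (a k)) n))"
    using ak by (auto simp: a'_def R_adj fun_eq_iff)
  then have neg: "negligible (\<lambda>n. lim_mult a' b' n - a' n * b' n)"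
    using negligible_orbits[OF adj_in[OF ak(1)] ak(2)] by (simp add: b'_def)
  have le: "\<forall>\<^sub>F m in sequentially. norm (a m * b m - a' m * b' m) \<le> \<epsilon> / 4"
    using k
  proof eventually_elim
    case (elim m)
    have "norm (a' m) \<le> K" using R_norm[OF _ ak(1)] K(2)[of k] K(1)
      by (auto simp: a'_def intro: order_trans)
    then have "norm (a m - a' m) * norm (b m) + norm (a' m) * norm (b m - b' m) \<le> \<eta> * K + K * \<eta>"
      using elim K \<eta> by (intro add_mono mult_mono) (auto simp: a'_def b'_def)
    also have "\<dots> = \<epsilon> / 4" using K by (simp add: \<eta>_def)
    finally show ?case using norm_mult_diff_le[of "a m" "b m" "a' m" "b' m"] by linarith
  qed
  note i = bseq_mult_in[OF ba bb] bseq_mult_in[OF coh_bseq[OF coh'(1)] coh_bseq[OF coh'(2)]]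
  have "\<forall>\<^sub>F m in sequentially. norm (lim_mult a b m - lim_mult a' b' m) < \<epsilon> / 4 + \<epsilon> / 4"
    by (rule is_lim_bound[OF is_lim_minus[OF is_lim_lim_mult[OF a b] is_lim_lim_mult[OF coh'] i] _ le])
       (use \<epsilon> minus_in[OF i] in auto)
  with le have "\<forall>\<^sub>F m in sequentially. norm (lim_mult a b m - a m * b m - (lim_mult a' b' m - a' m * b' m)) < \<epsilon>"
  proof eventually_elim
    case (elim m)
    have eq: "lim_mult a b m - a m * b m - (lim_mult a' b' m - a' m * b' m)
        = (lim_mult a b m - lim_mult a' b' m) - (a m * b m - a' m * b' m)" by simp
    show ?case
      unfolding eq using elim \<epsilon>
        norm_triangle_ineq4[of "lim_mult a b m - lim_mult a' b' m" "a m * b m - a' m * b' m"]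
      by linarith
  qed
  with neg show "\<exists>d'. negligible d' \<and> (\<forall>\<^sub>F m in sequentially. norm (lim_mult a b m - a m * b m - d' m) < \<epsilon>)"
    by blast
qed

text \<open>The two sides are limits of \<open>g n * z n\<close> and \<open>a n * h n\<close>. Each
  of these differs from the associative product \<open>a n * b n * z n\<close> by an error whose
  transports tend to 0.\<close>

lemma lim_mult_assoc:
  assumes a: "coh a" and b: "coh b" and z: "coh z"
  shows "(\<lambda>n. lim_mult (lim_mult a b) z n - lim_mult a (lim_mult b z) n) \<longlonglongrightarrow> 0"
proof -
  define g where "g = lim_mult a b"
  define h where "h = lim_mult b z"
  have g: "coh g" and h: "coh h" unfolding g_def h_def using a b z by (simp_all add: coh_lim_mult)
  note bs = a[THEN coh_bseq] b[THEN coh_bseq] z[THEN coh_bseq] g[THEN coh_bseq] h[THEN coh_bseq]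
  note i = bs[THEN bseq_in]
  have "negligible (\<lambda>n. g n - a n * b n)" unfolding g_def by (rule negligible_lim_mult[OF a b])
  then have 1: "((\<lambda>p. R (snd p) (fst p) ((g (fst p) - a (fst p) * b (fst p)) * z (fst p))) \<longlongrightarrow> 0) iter"
    using bs by (simp add: negligible_def)
  \<comment> \<open>Negligible sequences absorb factors on the right only. The error
    \<open>a n * (h n - b n * z n)\<close> has its factor on the left and is treated through its
    adjoint; \<open>L\<close> represents the adjoint product and agrees with
    \<open>adj (h n)\<close> up to a null sequence.\<close>
  define L where "L = lim_mult (\<lambda>n. adj (z n)) (\<lambda>n. adj (b n))"
  have L: "coh L" unfolding L_def using b z by (simp add: coh_lim_mult coh_adj)
  have "negligible (\<lambda>n. L n - adj (z n) * adj (b n))"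
    unfolding L_def by (rule negligible_lim_mult[OF coh_adj[OF z] coh_adj[OF b]])
  moreover have "negligible (\<lambda>n. L n - adj (h n))"
    using lim_mult_adj[OF b z] bseq_in[OF coh_bseq[OF L]] i
    by (intro negligible_null) (auto simp: L_def h_def minus_in adj_in)
  ultimately have "negligible (\<lambda>n. (L n - adj (z n) * adj (b n)) - (L n - adj (h n)))"
    by (rule negligible_minus)
  then have "negligible (\<lambda>n. adj (h n - b n * z n))" by (simp add: adj_diff adj_mult)
  then have 2: "((\<lambda>p. R (snd p) (fst p) (adj (h (fst p) - b (fst p) * z (fst p)) * adj (a (fst p)))) \<longlongrightarrow> 0) iter"
    using negligible_tendsto[OF _ bseq_adj[OF bs(1)]] by blast
  have t: "((\<lambda>p. R (snd p) (fst p) ((g (fst p) - a (fst p) * b (fst p)) * z (fst p))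
      - adj (R (snd p) (fst p) (adj (h (fst p) - b (fst p) * z (fst p)) * adj (a (fst p))))) \<longlongrightarrow> 0 - adj 0) iter"
    by (intro tendsto_diff tendsto_adj 1 2)
  have "\<forall>\<^sub>F p in iter. R (snd p) (fst p) ((g (fst p) - a (fst p) * b (fst p)) * z (fst p))
      - adj (R (snd p) (fst p) (adj (h (fst p) - b (fst p) * z (fst p)) * adj (a (fst p))))
      = R (snd p) (fst p) (g (fst p) * z (fst p) - a (fst p) * h (fst p))"
    using eventually_less_iter
  proof eventually_elim
    case (elim p)
    obtain n m where p: "p = (n, m)" by (cases p)
    have nm: "n \<le> m" using elim p by simp
    have "adj (R m n (adj (h n - b n * z n) * adj (a n))) = R m n (a n * (h n - b n * z n))"
      using nm i by (subst R_adj[symmetric]) (auto simp: adj_mult mult_in adj_in minus_in)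
    moreover have "R m n ((g n - a n * b n) * z n) - R m n (a n * (h n - b n * z n))
        = R m n (g n * z n - a n * h n)"
      using nm i by (subst R_minus[symmetric]) (auto simp: mult_in minus_in algebra_simps)
    ultimately show ?case using p by simp
  qed
  from Lim_transform_eventually[OF t this]
  have "((\<lambda>p. R (snd p) (fst p) (g (fst p) * z (fst p) - a (fst p) * h (fst p))) \<longlongrightarrow> 0) iter" by simp
  moreover have "is_lim (\<lambda>n. lim_mult g z n - lim_mult a h n) (\<lambda>n. g n * z n - a n * h n)"
    using i by (intro is_lim_minus is_lim_lim_mult a z g h) (auto simp: mult_in)
  ultimately show ?thesis unfolding g_def h_def by (rule is_lim_imp_null[rotated])
qed

end

section \<open>The tower of a system\<close>

lemma cpc_id: "cpc A A id"
  by (simp add: cpc_def completely_positive_def linear_map_def)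

lemma cpc_comp:
  assumes "cpc A B \<phi>" "cpc B C \<psi>"
  shows "cpc A C (\<psi> \<circ> \<phi>)"
proof -
  have "mat_positive C r (\<lambda>i j. (\<psi> \<circ> \<phi>) (a i j))" if "mat_positive A r a" for r a
  proof -
    have "mat_positive B r (\<lambda>i j. \<phi> (a i j))"
      using assms(1) that unfolding cpc_def completely_positive_def by simp
    then show ?thesis
      using assms(2) unfolding cpc_def completely_positive_def by simp
  qed
  moreover have "linear_map A C (\<psi> \<circ> \<phi>)"
    using assms unfolding cpc_def completely_positive_def linear_map_def by (auto simp: Pi_iff)
  moreover have "nrm C (\<psi> (\<phi> x)) \<le> nrm A x" if "x \<in> carrier A" for x
    using assms that unfolding cpc_def completely_positive_def linear_map_def
    by (meson Pi_mem order_trans)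
  ultimately show ?thesis by (simp add: cpc_def completely_positive_def)
qed

lemma conn_self: "conn \<rho> n n = id"
  by (cases n) auto

lemma conn_conn:
  assumes "n \<le> m" "k \<le> n"
  shows "conn \<rho> m n (conn \<rho> n k x) = conn \<rho> m k x"
  using assms by (induction m rule: dec_induct) (auto simp: conn_self)

context cpc_system
begin

lemma cpc_conn: "n \<le> m \<Longrightarrow> cpc (A n) (A m) (conn \<rho> m n)"
proof (induction m rule: dec_induct)
  case base
  show ?case unfolding conn_self by (rule cpc_id)
next
  case (step m)
  then show ?case using cpc_comp[OF step.IH cpc[of m]] by (simp add: comp_def)
qed

lemma cpc_map_conn: "n \<le> m \<Longrightarrow> cpc_map (A n) (A m) (conn \<rho> m n)"
  by (intro cpc_map.intro cpc_map_axioms.intro cstar cpc_conn)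

sublocale alg: cstar_algebra "A n" for n
  by (rule cstar)

definition img :: "nat \<Rightarrow> 'a multiplier set" where
  "img n = emb (A n) ` carrier (A n)"

definition unemb :: "nat \<Rightarrow> 'a multiplier \<Rightarrow> 'a" where
  "unemb n = inv_into (carrier (A n)) (emb (A n))"

definition transition :: "nat \<Rightarrow> nat \<Rightarrow> 'a multiplier \<Rightarrow> 'a multiplier" where
  "transition m n u = emb (A m) (conn \<rho> m n (unemb n u))"

lemma unemb_emb: "x \<in> carrier (A n) \<Longrightarrow> unemb n (emb (A n) x) = x"
  unfolding unemb_def by (intro inv_into_f_f inj_onI) (auto intro: alg.emb_inj)

lemma emb_unemb: "u \<in> img n \<Longrightarrow> emb (A n) (unemb n u) = u"
  unfolding img_def unemb_def by (rule f_inv_into_f)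

lemma unemb_in: "u \<in> img n \<Longrightarrow> unemb n u \<in> carrier (A n)"
  unfolding img_def unemb_def by (rule inv_into_into)

lemma emb_in: "x \<in> carrier (A n) \<Longrightarrow> emb (A n) x \<in> img n"
  by (simp add: img_def)

lemma transition_emb: "x \<in> carrier (A n) \<Longrightarrow> transition m n (emb (A n) x) = emb (A m) (conn \<rho> m n x)"
  by (simp add: transition_def unemb_emb)

lemma imgE:
  assumes "u \<in> img n"
  obtains x where "x \<in> carrier (A n)" "u = emb (A n) x"
  using assms unfolding img_def by blast

lemma conn_closed: "\<lbrakk>n \<le> m; x \<in> carrier (A n)\<rbrakk> \<Longrightarrow> conn \<rho> m n x \<in> carrier (A m)"
  by (rule cpc_map.closed[OF cpc_map_conn])

end

text \<open>Every element of \<open>img n\<close> is some \<open>emb (A n) a\<close>, so each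
  assumption of the tower is a statement about carriers; the inequalities are those of
  \<open>cpc_map\<close> for the composite maps \<open>conn \<rho> m n\<close>.\<close>

sublocale cstar_encoding_system \<subseteq> cstar_tower img transition
proof
  fix n m k :: nat and u v x y :: "'a multiplier" and c :: complex and \<epsilon> :: real
  show "0 \<in> img n" using alg.emb_zero[of n] emb_in[of "\<zero>\<^bsub>A n\<^esub>" n] by simp
  { assume u: "u \<in> img n"
    then obtain a where a: "a \<in> carrier (A n)" "u = emb (A n) a" by (rule imgE)
    show "cscale c * u \<in> img n"
      using a emb_in[OF alg.csmult_closed[OF a(1), of c]] by (simp add: alg.emb_smult)
    show "adj u \<in> img n"
      using a emb_in[OF alg.star_closed[OF a(1)]] by (simp add: alg.emb_star)
    { assume v: "v \<in> img n"
      then obtain b where b: "b \<in> carrier (A n)" "v = emb (A n) b" by (rule imgE)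
      show "u + v \<in> img n"
        using a b emb_in[OF alg.M.a_closed[OF a(1) b(1)]] by (simp add: alg.emb_add)
      show "u * v \<in> img n"
        using a b emb_in[OF alg.mult_closed[OF a(1) b(1)]] by (simp add: alg.emb_mult) } }
  { assume nm: "n \<le> m" and u: "u \<in> img n"
    from u obtain a where a: "a \<in> carrier (A n)" "u = emb (A n) a" by (rule imgE)
    interpret \<phi>: cpc_map "A n" "A m" "conn \<rho> m n" by (rule cpc_map_conn[OF nm])
    show "transition m n u \<in> img m"
      using a by (simp add: transition_emb emb_in \<phi>.closed)
    show "transition m n (cscale c * u) = cscale c * transition m n u"
      using a by (simp add: transition_emb \<phi>.closed \<phi>.smult alg.csmult_closed flip: alg.emb_smult)
    show "transition m n (adj u) = adj (transition m n u)"
      using a by (simp add: transition_emb \<phi>.closed \<phi>.preserves_star alg.star_closed flip: alg.emb_star)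
    show "norm (transition m n u) \<le> norm u"
      using a by (simp add: transition_emb \<phi>.closed \<phi>.contractive alg.norm_emb)
    show "\<exists>s\<in>img m. transition m n (adj u * u) - adj (transition m n u) * transition m n u = adj s * s"
    proof -
      obtain s where s: "s \<in> carrier (A m)"
        "conn \<rho> m n (star (A n) a \<otimes>\<^bsub>A n\<^esub> a) \<ominus>\<^bsub>A m\<^esub> star (A m) (conn \<rho> m n a) \<otimes>\<^bsub>A m\<^esub> conn \<rho> m n a
          = star (A m) s \<otimes>\<^bsub>A m\<^esub> s"
        using \<phi>.Kadison_Schwarz[OF a(1)] by blast
      have "adj u * u = emb (A n) (star (A n) a \<otimes>\<^bsub>A n\<^esub> a)"
        using a by (simp add: alg.emb_mult alg.emb_star alg.star_closed)
      then have "transition m n (adj u * u) = emb (A m) (conn \<rho> m n (star (A n) a \<otimes>\<^bsub>A n\<^esub> a))"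
        using a(1) by (simp add: transition_emb alg.star_closed alg.mult_closed)
      then have "transition m n (adj u * u) - adj (transition m n u) * transition m n u
          = emb (A m) (conn \<rho> m n (star (A n) a \<otimes>\<^bsub>A n\<^esub> a)
              \<ominus>\<^bsub>A m\<^esub> star (A m) (conn \<rho> m n a) \<otimes>\<^bsub>A m\<^esub> conn \<rho> m n a)"
        using a by (simp add: transition_emb alg.emb_minus alg.emb_mult alg.emb_star alg.star_closed
            alg.mult_closed \<phi>.closed)
      also have "\<dots> = adj (emb (A m) s) * emb (A m) s"
        unfolding s(2) using s(1) by (simp add: alg.emb_mult alg.emb_star alg.star_closed)
      finally show ?thesis using emb_in[OF s(1)] by blast
    qed
    { assume v: "v \<in> img n"
      then obtain b where b: "b \<in> carrier (A n)" "v = emb (A n) b" by (rule imgE)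
      show "transition m n (u + v) = transition m n u + transition m n v"
        using a b by (simp add: transition_emb \<phi>.closed \<phi>.add flip: alg.emb_add)
      have e: "norm (transition m n (adj (emb (A n) x) * emb (A n) y)) = nrm (A m) (conn \<rho> m n (star (A n) x \<otimes>\<^bsub>A n\<^esub> y))"
        if "x \<in> carrier (A n)" "y \<in> carrier (A n)" for x y
        using that by (simp add: transition_emb alg.star_closed alg.mult_closed alg.norm_emb \<phi>.closed
            flip: alg.emb_mult alg.emb_star)
      show "(norm (transition m n (adj u * v)))\<^sup>2 \<le> norm (transition m n (adj u * u)) * norm (transition m n (adj v * v))"
        using \<phi>.Cauchy_Schwarz[OF a(1) b(1)] by (simp add: a b e) } }
  { assume kn: "k \<le> n" and nm: "n \<le> m" and u: "u \<in> img k"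
    from u obtain a where a: "a \<in> carrier (A k)" "u = emb (A k) a" by (rule imgE)
    show "transition m n (transition n k u) = transition m k u"
      using a kn nm by (simp add: transition_emb conn_closed conn_conn) }
  { assume x: "x \<in> img k" and y: "y \<in> img k" and \<epsilon>: "\<epsilon> > 0"
    from x y obtain a b where a: "a \<in> carrier (A k)" "x = emb (A k) a"
      and b: "b \<in> carrier (A k)" "y = emb (A k) b" by (elim imgE)
    obtain M where M: "M > k" "\<And>m n j. n > M \<Longrightarrow> j > M \<Longrightarrow> m > max n j \<Longrightarrow>
      nrm (A m)
        (conn \<rho> m n (conn \<rho> n k a \<otimes>\<^bsub>A n\<^esub> conn \<rho> n k b) \<ominus>\<^bsub>A m\<^esub>
         conn \<rho> m j (conn \<rho> j k a \<otimes>\<^bsub>A j\<^esub> conn \<rho> j k b)) < \<epsilon>"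
      using encoding[OF a(1) b(1) \<epsilon>] by blast
    have t: "transition m n (transition n k x * transition n k y)
        = emb (A m) (conn \<rho> m n (conn \<rho> n k a \<otimes>\<^bsub>A n\<^esub> conn \<rho> n k b))" if "k \<le> n" for m n
      using a b that by (simp add: transition_emb conn_closed alg.mult_closed flip: alg.emb_mult)
    have "norm (transition m n (transition n k x * transition n k y) - transition m j (transition j k x * transition j k y)) < \<epsilon>"
      if "M < n" "M < j" "max n j < m" for m n j
    proof -
      have le: "k \<le> n" "k \<le> j" "n \<le> m" "j \<le> m" using M(1) that by auto
      show ?thesis
        unfolding t[OF le(1)] t[OF le(2)] using M(2)[of n j m] that le a(1) b(1)
        by (simp add: alg.norm_emb_minus conn_closed alg.mult_closed)
    qed
    then show "\<exists>M\<ge>k. \<forall>m n j. M < n \<and> M < j \<and> max n j < m \<longrightarrow>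
        norm (transition m n (transition n k x * transition n k y) - transition m j (transition j k x * transition j k y)) < \<epsilon>"
      using M(1) by (intro exI[of _ M]) auto }
qed

section \<open>The sequence algebra\<close>

context cstar_encoding_system
begin

abbreviation (input) S :: "(nat \<Rightarrow> 'a) set cstar" where
  "S \<equiv> seq_algebra A"

text \<open>A coset of \<open>null_seqs A\<close>, parametrized by a sequence of multipliers, so
  that results about the tower speak directly about the sequence algebra.\<close>

definition cls :: "(nat \<Rightarrow> 'a multiplier) \<Rightarrow> (nat \<Rightarrow> 'a) set" where
  "cls a = {x. (\<forall>n. x n \<in> carrier (A n)) \<and> (\<lambda>n. emb (A n) (x n) - a n) \<longlonglongrightarrow> 0}"

lemma unemb_in_cls: "bseq a \<Longrightarrow> (\<lambda>n. unemb n (a n)) \<in> cls a"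
  by (simp add: cls_def unemb_in emb_unemb bseq_in)

lemma cls_eqI: "(\<lambda>n. a n - b n) \<longlonglongrightarrow> 0 \<Longrightarrow> cls a = cls b"
proof -
  have "cls a \<subseteq> cls b" if "(\<lambda>n. a n - b n) \<longlonglongrightarrow> 0" for a b
  proof
    fix x assume "x \<in> cls a"
    then have x: "\<And>n. x n \<in> carrier (A n)" "(\<lambda>n. emb (A n) (x n) - a n) \<longlonglongrightarrow> 0" by (auto simp: cls_def)
    show "x \<in> cls b" using x(1) tendsto_add[OF x(2) that] by (simp add: cls_def)
  qed
  moreover assume "(\<lambda>n. a n - b n) \<longlonglongrightarrow> 0"
  moreover from this have "(\<lambda>n. b n - a n) \<longlonglongrightarrow> 0" using tendsto_minus by fastforce
  ultimately show ?thesis by blast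
qed

lemma cls_eq_iff:
  assumes "bseq a" "bseq b"
  shows "cls a = cls b \<longleftrightarrow> (\<lambda>n. a n - b n) \<longlonglongrightarrow> 0"
proof
  assume "cls a = cls b"
  then have "(\<lambda>n. unemb n (a n)) \<in> cls b" using unemb_in_cls[OF assms(1)] by simp
  then show "(\<lambda>n. a n - b n) \<longlonglongrightarrow> 0" using assms by (simp add: cls_def emb_unemb bseq_in)
qed (rule cls_eqI)

lemma seq_class_eq_cls:
  assumes "\<And>n. x n \<in> carrier (A n)"
  shows "seq_class A x = cls (\<lambda>n. emb (A n) (x n))"
proof (intro Set.set_eqI iffI)
  fix y assume "y \<in> seq_class A x"
  then obtain h where h: "\<And>n. h n \<in> carrier (A n)" "(\<lambda>n. nrm (A n) (h n)) \<longlonglongrightarrow> 0"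
    and y: "y = (\<lambda>n. h n \<oplus>\<^bsub>A n\<^esub> x n)"
    by (auto simp: seq_class_def a_r_coset_def' null_seqs_def prod_cstar_def)
  have "(\<lambda>n. emb (A n) (h n)) \<longlonglongrightarrow> 0"
    using h by (subst tendsto_norm_zero_iff[symmetric]) (simp add: alg.norm_emb)
  then show "y \<in> cls (\<lambda>n. emb (A n) (x n))"
    using h(1) assms by (simp add: cls_def y alg.emb_add)
next
  fix y assume "y \<in> cls (\<lambda>n. emb (A n) (x n))"
  then have y: "\<And>n. y n \<in> carrier (A n)" "(\<lambda>n. emb (A n) (y n) - emb (A n) (x n)) \<longlonglongrightarrow> 0"
    by (auto simp: cls_def)
  define h where "h n = y n \<ominus>\<^bsub>A n\<^esub> x n" for n
  have "h \<in> null_seqs A"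
    using tendsto_norm[OF y(2)] y(1) assms by (simp add: null_seqs_def h_def alg.norm_emb_minus)
  moreover have "y = (\<lambda>n. h n \<oplus>\<^bsub>A n\<^esub> x n)"
    using y(1) assms by (simp add: fun_eq_iff h_def a_minus_def alg.M.a_assoc alg.M.l_neg)
  ultimately show "y \<in> seq_class A x"
    by (auto simp: seq_class_def a_r_coset_def' prod_cstar_def)
qed

lemma bseq_emb:
  assumes "x \<in> carrier (prod_cstar A)"
  shows "bseq (\<lambda>n. emb (A n) (x n))"
proof -
  have x: "\<And>n. x n \<in> carrier (A n)" "bdd_above (range (\<lambda>n. nrm (A n) (x n)))"
    using assms by (auto simp: prod_cstar_def)
  then obtain C where "\<And>n. nrm (A n) (x n) \<le> C" by (auto simp: bdd_above_def)
  then show ?thesis using x by (intro bseqI[of _ C]) (simp_all add: emb_in alg.norm_emb)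
qed

lemma cls_bounded:
  assumes a: "bseq a" and x: "x \<in> cls a"
  shows "x \<in> carrier (prod_cstar A)"
proof -
  obtain C where C: "\<And>n. norm (a n) \<le> C" using bseq_bound[OF a] by metis
  have xc: "\<And>n. x n \<in> carrier (A n)" "(\<lambda>n. emb (A n) (x n) - a n) \<longlonglongrightarrow> 0" using x by (auto simp: cls_def)
  from xc(2) have "Bseq (\<lambda>n. emb (A n) (x n) - a n)" using convergentI convergent_imp_Bseq by blast
  then obtain D where D: "\<And>n. norm (emb (A n) (x n) - a n) \<le> D" by (auto simp: Bseq_def)
  have "nrm (A n) (x n) \<le> C + D" for n
    using C[of n] D[of n] norm_triangle_sub[of "emb (A n) (x n)" "a n"] xc(1)[of n]
    by (simp add: alg.norm_emb)
  then show ?thesis using xc(1) by (auto simp: prod_cstar_def bdd_above_def)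
qed

lemma unemb_bounded: "bseq a \<Longrightarrow> (\<lambda>n. unemb n (a n)) \<in> carrier (prod_cstar A)"
  by (rule cls_bounded[OF _ unemb_in_cls])

section \<open>The operations of the sequence algebra on classes\<close>

lemma carrier_seq_algebra: "carrier S = cls ` Collect bseq"
proof -
  have c: "carrier S = seq_class A ` carrier (prod_cstar A)"
    by (auto simp: seq_algebra_def quot_cstar_def FactRing_def A_RCOSETS_def' seq_class_def)
  show ?thesis
  proof (intro Set.set_eqI iffI)
    fix C assume "C \<in> carrier S"
    then obtain x where x: "x \<in> carrier (prod_cstar A)" "C = seq_class A x" by (auto simp: c)
    then have "C = cls (\<lambda>n. emb (A n) (x n))" by (simp add: seq_class_eq_cls prod_cstar_def)
    then show "C \<in> cls ` Collect bseq" using bseq_emb[OF x(1)] by blast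
  next
    fix C assume "C \<in> cls ` Collect bseq"
    then obtain a where a: "bseq a" "C = cls a" by auto
    then have "C = seq_class A (\<lambda>n. unemb n (a n))"
      by (simp add: seq_class_eq_cls unemb_in emb_unemb bseq_in)
    then show "C \<in> carrier S" using unemb_bounded[OF a(1)] by (auto simp: c)
  qed
qed

lemma zero_seq_algebra: "\<zero>\<^bsub>S\<^esub> = cls (\<lambda>_. 0)"
proof -
  have "\<zero>\<^bsub>S\<^esub> = null_seqs A" by (simp add: seq_algebra_def quot_cstar_def FactRing_def)
  also have "\<dots> = cls (\<lambda>_. 0)"
  proof -
    have "(\<lambda>n. nrm (A n) (x n)) \<longlonglongrightarrow> 0 \<longleftrightarrow> (\<lambda>n. emb (A n) (x n)) \<longlonglongrightarrow> 0"
      if "\<And>n. x n \<in> carrier (A n)" for x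
      using that by (subst tendsto_norm_zero_iff[symmetric]) (simp add: alg.norm_emb)
    then show ?thesis by (auto simp: null_seqs_def cls_def)
  qed
  finally show ?thesis .
qed

text \<open>The sum of two cosets is the set of all sums. An element \<open>z\<close> of the class
  of the sum is decomposed by subtracting the canonical representative of \<open>b\<close>.\<close>

lemma add_seq_algebra:
  assumes "bseq a" "bseq b"
  shows "cls a \<oplus>\<^bsub>S\<^esub> cls b = cls (\<lambda>n. a n + b n)"
proof -
  have "cls a \<oplus>\<^bsub>S\<^esub> cls b = (\<Union>x\<in>cls a. \<Union>y\<in>cls b. {\<lambda>n. x n \<oplus>\<^bsub>A n\<^esub> y n})"
    by (simp add: seq_algebra_def quot_cstar_def FactRing_def set_add_def' prod_cstar_def)
  also have "\<dots> = cls (\<lambda>n. a n + b n)"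
  proof (intro Set.set_eqI iffI)
    fix z assume "z \<in> (\<Union>x\<in>cls a. \<Union>y\<in>cls b. {\<lambda>n. x n \<oplus>\<^bsub>A n\<^esub> y n})"
    then obtain x y where xy: "x \<in> cls a" "y \<in> cls b" "z = (\<lambda>n. x n \<oplus>\<^bsub>A n\<^esub> y n)" by blast
    then have c: "\<And>n. x n \<in> carrier (A n)" "\<And>n. y n \<in> carrier (A n)" by (auto simp: cls_def)
    have "(\<lambda>n. (emb (A n) (x n) - a n) + (emb (A n) (y n) - b n)) \<longlonglongrightarrow> 0 + 0"
      using xy by (intro tendsto_add) (auto simp: cls_def)
    then show "z \<in> cls (\<lambda>n. a n + b n)"
      using c by (simp add: cls_def xy(3) alg.emb_add algebra_simps)
  next
    fix z assume z: "z \<in> cls (\<lambda>n. a n + b n)"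
    then have zc: "\<And>n. z n \<in> carrier (A n)" by (auto simp: cls_def)
    define y where "y n = unemb n (b n)" for n
    have y: "y \<in> cls b" "\<And>n. y n \<in> carrier (A n)" "\<And>n. emb (A n) (y n) = b n"
      using assms(2) unemb_in_cls[OF assms(2)]
      by (simp_all add: y_def[abs_def] unemb_in emb_unemb bseq_in)
    have "(\<lambda>n. z n \<ominus>\<^bsub>A n\<^esub> y n) \<in> cls a"
      using z zc y by (simp add: cls_def alg.emb_minus algebra_simps)
    moreover have "z = (\<lambda>n. (z n \<ominus>\<^bsub>A n\<^esub> y n) \<oplus>\<^bsub>A n\<^esub> y n)"
      using zc y(2) by (simp add: fun_eq_iff a_minus_def alg.M.a_assoc alg.M.l_neg)
    ultimately show "z \<in> (\<Union>x\<in>cls a. \<Union>y\<in>cls b. {\<lambda>n. x n \<oplus>\<^bsub>A n\<^esub> y n})" using y(1) by blast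
  qed
  finally show ?thesis .
qed

text \<open>Scalar multiplication and involution of the quotient are unions over representatives;
  the union is harmless once every representative yields the same class.\<close>

lemma Union_cls_const:
  assumes "bseq a" "\<And>x. x \<in> cls a \<Longrightarrow> g x = C"
  shows "(\<Union>x\<in>cls a. g x) = C"
  using assms unemb_in_cls[OF assms(1)] by auto

lemma smult_seq_algebra:
  assumes "bseq a"
  shows "c \<odot>\<^bsub>S\<^esub> cls a = cls (\<lambda>n. cscale c * a n)"
proof -
  have "c \<odot>\<^bsub>S\<^esub> cls a = (\<Union>x\<in>cls a. seq_class A (\<lambda>n. c \<odot>\<^bsub>A n\<^esub> x n))"
    by (simp add: seq_algebra_def quot_cstar_def seq_class_def prod_cstar_def)
  also have "\<dots> = cls (\<lambda>n. cscale c * a n)"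
  proof (rule Union_cls_const[OF assms])
    fix x assume "x \<in> cls a"
    then have x: "\<And>n. x n \<in> carrier (A n)" "(\<lambda>n. emb (A n) (x n) - a n) \<longlonglongrightarrow> 0" by (auto simp: cls_def)
    have "(\<lambda>n. cscale c * (emb (A n) (x n) - a n)) \<longlonglongrightarrow> 0"
      by (rule tendsto_mult_right_zero[OF x(2)])
    then show "seq_class A (\<lambda>n. c \<odot>\<^bsub>A n\<^esub> x n) = cls (\<lambda>n. cscale c * a n)"
      using x(1) by (simp add: seq_class_eq_cls alg.csmult_closed alg.emb_smult right_diff_distrib cls_eqI)
  qed
  finally show ?thesis .
qed

lemma star_seq_algebra:
  assumes "bseq a"
  shows "star S (cls a) = cls (\<lambda>n. adj (a n))"
proof -
  have "star S (cls a) = (\<Union>x\<in>cls a. seq_class A (\<lambda>n. star (A n) (x n)))"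
    by (simp add: seq_algebra_def quot_cstar_def seq_class_def prod_cstar_def)
  also have "\<dots> = cls (\<lambda>n. adj (a n))"
  proof (rule Union_cls_const[OF assms])
    fix x assume "x \<in> cls a"
    then have x: "\<And>n. x n \<in> carrier (A n)" "(\<lambda>n. emb (A n) (x n) - a n) \<longlonglongrightarrow> 0" by (auto simp: cls_def)
    have "(\<lambda>n. adj (emb (A n) (x n) - a n)) \<longlonglongrightarrow> adj 0" by (rule tendsto_adj[OF x(2)])
    then show "seq_class A (\<lambda>n. star (A n) (x n)) = cls (\<lambda>n. adj (a n))"
      using x(1) by (simp add: seq_class_eq_cls alg.star_closed alg.emb_star adj_diff cls_eqI)
  qed
  finally show ?thesis .
qed

section \<open>The quotient norm as a limit superior\<close>

lemma nrm_seq_algebra: "nrm S C = (INF x\<in>C. SUP n. nrm (A n) (x n))"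
  by (simp add: seq_algebra_def quot_cstar_def prod_cstar_def)

lemma cls_SUP:
  assumes "bseq a" "x \<in> cls a"
  shows "nrm (A n) (x n) \<le> (SUP n. nrm (A n) (x n))" "0 \<le> (SUP n. nrm (A n) (x n))"
proof -
  have x: "\<And>n. x n \<in> carrier (A n)" "bdd_above (range (\<lambda>n. nrm (A n) (x n)))"
    using cls_bounded[OF assms] by (auto simp: prod_cstar_def)
  show le: "nrm (A n) (x n) \<le> (SUP n. nrm (A n) (x n))" for n
    by (rule cSUP_upper[OF UNIV_I x(2)])
  show "0 \<le> (SUP n. nrm (A n) (x n))"
    using le[of 0] alg.nrm_nonneg[OF x(1)[of 0]] by linarith
qed

lemma cls_bdd_below: "bseq a \<Longrightarrow> bdd_below ((\<lambda>x. SUP n. nrm (A n) (x n)) ` cls a)"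
  using cls_SUP(2) by (auto simp: bdd_below_def)

lemma nrm_cls_nonneg: "bseq a \<Longrightarrow> 0 \<le> nrm S (cls a)"
  unfolding nrm_seq_algebra using unemb_in_cls cls_SUP(2) by (intro cINF_greatest) auto

text \<open>Only finitely many terms can exceed \<open>c\<close>; setting them to zero stays in the
  class and brings the supremum down to \<open>c\<close>.\<close>

lemma nrm_cls_le:
  assumes a: "bseq a" and le: "\<forall>\<^sub>F n in sequentially. norm (a n) \<le> c"
  shows "nrm S (cls a) \<le> c"
proof -
  define x where "x n = (if norm (a n) \<le> c then unemb n (a n) else \<zero>\<^bsub>A n\<^esub>)" for n
  have xc: "x n \<in> carrier (A n)" for n using a by (simp add: x_def unemb_in bseq_in)
  have "\<forall>\<^sub>F n in sequentially. emb (A n) (x n) - a n = 0"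
    using le by eventually_elim (use a in \<open>simp add: x_def emb_unemb bseq_in\<close>)
  then have x: "x \<in> cls a" using xc by (simp add: cls_def tendsto_eventually)
  have c0: "0 \<le> c"
    using eventually_happens'[OF sequentially_bot le] norm_ge_zero order_trans by blast
  have "nrm (A n) (x n) \<le> c" for n
  proof (cases "norm (a n) \<le> c")
    case True
    then show ?thesis
      using alg.norm_emb[OF xc[of n]] a by (simp add: x_def emb_unemb bseq_in)
  qed (use c0 in \<open>simp add: x_def alg.nrm_zero\<close>)
  then have "(SUP n. nrm (A n) (x n)) \<le> c" by (intro cSUP_least) auto
  moreover have "nrm S (cls a) \<le> (SUP n. nrm (A n) (x n))"
    unfolding nrm_seq_algebra by (rule cINF_lower[OF cls_bdd_below[OF a] x])
  ultimately show ?thesis by linarith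
qed

text \<open>A representative with supremum below \<open>c\<close> differs from \<open>a\<close> by a
  null sequence. Together with \<open>nrm_cls_le\<close> this identifies the quotient norm with the
  limit superior of the norms.\<close>

lemma nrm_cls_lessD:
  assumes a: "bseq a" and less: "nrm S (cls a) < c"
  shows "\<forall>\<^sub>F n in sequentially. norm (a n) < c"
proof -
  have "cls a \<noteq> {}" using unemb_in_cls[OF a] by blast
  then obtain x where x: "x \<in> cls a" "(SUP n. nrm (A n) (x n)) < c"
    using less cINF_less_iff[OF _ cls_bdd_below[OF a]] unfolding nrm_seq_algebra by blast
  define s where "s = (SUP n. nrm (A n) (x n))"
  have xc: "\<And>n. x n \<in> carrier (A n)" "(\<lambda>n. emb (A n) (x n) - a n) \<longlonglongrightarrow> 0" using x by (auto simp: cls_def)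
  have "\<forall>\<^sub>F n in sequentially. norm (emb (A n) (x n) - a n) < c - s"
    using tendstoD[OF xc(2), of "c - s"] x(2) by (simp add: s_def)
  then show ?thesis
  proof eventually_elim
    case (elim n)
    have "norm (emb (A n) (x n)) \<le> s"
      using cls_SUP(1)[OF a x(1), of n] alg.norm_emb[OF xc(1)[of n]] by (simp add: s_def)
    then show ?case
      using elim norm_triangle_sub[of "a n" "emb (A n) (x n)"] by (simp add: norm_minus_commute)
  qed
qed

lemma nrm_cls_leI:
  assumes "bseq a" "\<And>\<epsilon>. \<epsilon> > 0 \<Longrightarrow> \<forall>\<^sub>F n in sequentially. norm (a n) \<le> c + \<epsilon>"
  shows "nrm S (cls a) \<le> c"
  by (rule field_le_epsilon, rule nrm_cls_le[OF assms])

lemma nrm_cls_eventually: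
  assumes "bseq a" "\<epsilon> > 0"
  shows "\<forall>\<^sub>F n in sequentially. norm (a n) \<le> nrm S (cls a) + \<epsilon>"
  using nrm_cls_lessD[OF assms(1), of "nrm S (cls a) + \<epsilon>"] assms(2)
  by (auto elim: eventually_mono)

lemma nrm_cls_eq_0_iff:
  assumes a: "bseq a"
  shows "nrm S (cls a) = 0 \<longleftrightarrow> a \<longlonglongrightarrow> 0"
proof
  assume 0: "nrm S (cls a) = 0"
  show "a \<longlonglongrightarrow> 0"
    unfolding tendsto_iff using nrm_cls_lessD[OF a] 0 by simp
next
  assume "a \<longlonglongrightarrow> 0"
  then have "\<forall>\<^sub>F n in sequentially. norm (a n) \<le> 0 + \<epsilon>" if "\<epsilon> > 0" for \<epsilon>
    using that tendstoD[of a 0 sequentially \<epsilon>] by (auto elim: eventually_mono)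
  then have "nrm S (cls a) \<le> 0" using a by (intro nrm_cls_leI)
  then show "nrm S (cls a) = 0" using nrm_cls_nonneg[OF a] by simp
qed

lemma nrm_cls_add:
  assumes "bseq a" "bseq b"
  shows "nrm S (cls (\<lambda>n. a n + b n)) \<le> nrm S (cls a) + nrm S (cls b)"
proof (rule nrm_cls_leI[OF bseq_add[OF assms]])
  fix \<epsilon> :: real assume "\<epsilon> > 0"
  then have "\<epsilon> / 2 > 0" by simp
  from nrm_cls_eventually[OF assms(1) this] nrm_cls_eventually[OF assms(2) this]
  show "\<forall>\<^sub>F n in sequentially. norm (a n + b n) \<le> nrm S (cls a) + nrm S (cls b) + \<epsilon>"
  proof eventually_elim
    case (elim n)
    then show ?case using norm_triangle_ineq[of "a n" "b n"] by linarith
  qed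
qed

lemma nrm_cls_cscale:
  assumes a: "bseq a"
  shows "nrm S (cls (\<lambda>n. cscale c * a n)) = cmod c * nrm S (cls a)"
proof -
  have le: "nrm S (cls (\<lambda>n. cscale c * a n)) \<le> cmod c * nrm S (cls a)" if a: "bseq a" for c a
  proof (rule nrm_cls_leI[OF bseq_cscale[OF a]])
    fix \<epsilon> :: real assume \<epsilon>: "\<epsilon> > 0"
    \<comment> \<open>The summand 1 avoids division by zero for \<open>c = 0\<close>.\<close>
    define \<delta> where "\<delta> = \<epsilon> / (cmod c + 1)"
    have p: "cmod c + 1 > 0" by (simp add: add_nonneg_pos)
    have \<delta>: "\<delta> > 0" using \<epsilon> p by (simp add: \<delta>_def)
    have "cmod c * \<delta> \<le> (cmod c + 1) * \<delta>" using \<delta> by (intro mult_right_mono) auto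
    then have c\<delta>: "cmod c * \<delta> \<le> \<epsilon>" using p by (simp add: \<delta>_def)
    show "\<forall>\<^sub>F n in sequentially. norm (cscale c * a n) \<le> cmod c * nrm S (cls a) + \<epsilon>"
      using nrm_cls_eventually[OF a \<delta>]
    proof eventually_elim
      case (elim n)
      then have "cmod c * norm (a n) \<le> cmod c * (nrm S (cls a) + \<delta>)" by (intro mult_left_mono) auto
      then show ?case using c\<delta> by (simp add: norm_cscale_mult distrib_left)
    qed
  qed
  show ?thesis
  proof (cases "c = 0")
    case True
    then show ?thesis using le[OF a, of c] nrm_cls_nonneg[OF bseq_cscale[OF a, of c]] by simp
  next
    case False
    have "cscale (inverse c) * (cscale c * u) = u" for u :: "'a multiplier"
      using False by (simp flip: cscale_mult mult.assoc)
    then have "nrm S (cls a) \<le> cmod (inverse c) * nrm S (cls (\<lambda>n. cscale c * a n))"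
      using le[OF bseq_cscale[OF a, of c], of "inverse c"] by simp
    then have "cmod c * nrm S (cls a) \<le> nrm S (cls (\<lambda>n. cscale c * a n))"
      using False by (simp add: norm_divide field_simps)
    then show ?thesis using le[OF a, of c] by simp
  qed
qed

section \<open>Spaces of classes\<close>

context
  fixes K :: "(nat \<Rightarrow> 'a multiplier) set"
    and f :: "(nat \<Rightarrow> 'a) set \<Rightarrow> (nat \<Rightarrow> 'a) set \<Rightarrow> (nat \<Rightarrow> 'a) set"
  assumes K_bseq: "\<And>a. a \<in> K \<Longrightarrow> bseq a"
    and K_zero: "(\<lambda>_. 0) \<in> K"
    and K_add: "\<And>a b. \<lbrakk>a \<in> K; b \<in> K\<rbrakk> \<Longrightarrow> (\<lambda>n. a n + b n) \<in> K"
    and K_cscale: "\<And>a c. a \<in> K \<Longrightarrow> (\<lambda>n. cscale c * a n) \<in> K"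
begin

abbreviation (input) W :: "(nat \<Rightarrow> 'a) set cstar" where
  "W \<equiv> S\<lparr>carrier := cls ` K, monoid.mult := f\<rparr>"

text \<open>Applied twice: to all bounded sequences, for the sequence algebra, and to the coherent
  ones, for the limit with its new product.\<close>

lemma normed_cspace_cls: "normed_cspace W"
proof (intro normed_cspace.intro moduleI normed_cspace_axioms.intro)
  note ops = add_seq_algebra smult_seq_algebra zero_seq_algebra K_bseq bseq_add bseq_cscale
  show "cring (ring_of_type_algebra :: complex ring)" by (rule cring_from_type_algebra)
  show "abelian_group W"
  proof (rule abelian_groupI)
    show "\<exists>y\<in>carrier W. y \<oplus>\<^bsub>W\<^esub> x = \<zero>\<^bsub>W\<^esub>" if "x \<in> carrier W" for x
    proof -
      from that obtain a where a: "a \<in> K" "x = cls a" by auto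
      have "cls (\<lambda>n. cscale (- 1) * a n) \<oplus>\<^bsub>S\<^esub> cls a = \<zero>\<^bsub>S\<^esub>"
        unfolding zero_seq_algebra add_seq_algebra[OF bseq_cscale[OF K_bseq[OF a(1)]] K_bseq[OF a(1)]]
        by (simp add: cscale_minus)
      then show ?thesis
        using a K_cscale[OF a(1), of "- 1"] by auto
    qed
  qed (auto simp: ops K_add K_zero add_ac intro!: imageI)
  note rt = ring_of_type_algebra_def
  show "c \<odot>\<^bsub>W\<^esub> x \<in> carrier W" if "x \<in> carrier W" for c x
    using that by (auto simp: ops K_cscale intro!: imageI)
  show "(c \<oplus>\<^bsub>ring_of_type_algebra\<^esub> d) \<odot>\<^bsub>W\<^esub> x = c \<odot>\<^bsub>W\<^esub> x \<oplus>\<^bsub>W\<^esub> d \<odot>\<^bsub>W\<^esub> x" if "x \<in> carrier W" for c d x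
    using that by (auto simp: ops rt cscale_add distrib_right)
  show "c \<odot>\<^bsub>W\<^esub> (x \<oplus>\<^bsub>W\<^esub> y) = c \<odot>\<^bsub>W\<^esub> x \<oplus>\<^bsub>W\<^esub> c \<odot>\<^bsub>W\<^esub> y" if "x \<in> carrier W" "y \<in> carrier W" for c x y
    using that by (auto simp: ops distrib_left)
  show "(c \<otimes>\<^bsub>ring_of_type_algebra\<^esub> d) \<odot>\<^bsub>W\<^esub> x = c \<odot>\<^bsub>W\<^esub> (d \<odot>\<^bsub>W\<^esub> x)" if "x \<in> carrier W" for c d x
    using that by (auto simp: ops rt cscale_mult mult.assoc)
  show "\<one>\<^bsub>ring_of_type_algebra\<^esub> \<odot>\<^bsub>W\<^esub> x = x" if "x \<in> carrier W" for x
    using that by (auto simp: ops rt)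
  show "0 \<le> nrm W x" if "x \<in> carrier W" for x
    using that by (auto simp: K_bseq nrm_cls_nonneg)
  show "nrm W x = 0 \<longleftrightarrow> x = \<zero>\<^bsub>W\<^esub>" if "x \<in> carrier W" for x
  proof -
    from that obtain a where a: "a \<in> K" "x = cls a" by auto
    then show ?thesis
      using K_bseq[OF K_zero] by (simp add: K_bseq nrm_cls_eq_0_iff zero_seq_algebra cls_eq_iff)
  qed
  show "nrm W (x \<oplus>\<^bsub>W\<^esub> y) \<le> nrm W x + nrm W y" if "x \<in> carrier W" "y \<in> carrier W" for x y
    using that by (auto simp: ops nrm_cls_add)
  show "nrm W (c \<odot>\<^bsub>W\<^esub> x) = cmod c * nrm W x" if "x \<in> carrier W" for c x
    using that by (auto simp: ops nrm_cls_cscale)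
qed

lemma norm_dist_cls:
  assumes "a \<in> K" "b \<in> K"
  shows "norm_dist W (cls a) (cls b) = nrm S (cls (\<lambda>n. a n - b n))"
proof -
  interpret W: normed_cspace W by (rule normed_cspace_cls)
  have "bseq (\<lambda>n. - b n)"
    using bseq_cscale[OF K_bseq[OF assms(2)], of "- 1"] by (simp add: cscale_minus)
  then have "cls a \<ominus>\<^bsub>W\<^esub> cls b = cls (\<lambda>n. a n - b n)"
    using assms W.minus_eq_csmult[of "cls a" "cls b"]
    by (simp add: add_seq_algebra smult_seq_algebra K_bseq bseq_cscale cscale_minus)
  then show ?thesis using assms by (simp add: norm_dist_def)
qed

end

lemma seq_algebra_eq: "S = S\<lparr>carrier := cls ` Collect bseq, monoid.mult := monoid.mult S\<rparr>"
  by (simp add: carrier_seq_algebra[symmetric])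

lemma bseq_zero: "bseq (\<lambda>_. 0)"
  by (rule bseqI[of _ 0]) (simp_all add: zero_in)

lemma normed_cspace_seq_algebra: "normed_cspace S"
  by (subst seq_algebra_eq) (rule normed_cspace_cls, auto simp: bseq_zero bseq_add bseq_cscale)

lemma norm_dist_seq_algebra:
  assumes "bseq a" "bseq b"
  shows "norm_dist S (cls a) (cls b) = nrm S (cls (\<lambda>n. a n - b n))"
  using norm_dist_cls[of "Collect bseq" a b "monoid.mult S", folded seq_algebra_eq] assms
  by (simp add: bseq_zero bseq_add bseq_cscale)

lemma to_limit_eq:
  assumes x: "x \<in> carrier (A n)"
  shows "to_limit A \<rho> n x = cls (orbit n (emb (A n) x))"
proof -
  have "to_limit A \<rho> n x = cls (\<lambda>m. emb (A m) (if m > n then conn \<rho> m n x else \<zero>\<^bsub>A m\<^esub>))"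
    unfolding to_limit_def using x by (intro seq_class_eq_cls) (simp add: conn_closed)
  \<comment> \<open>The two sequences can differ only at \<open>m = n\<close>, where one is padded
    by zero and the other has already started.\<close>
  also have "\<dots> = cls (orbit n (emb (A n) x))"
    by (rule cls_eqI, rule tendsto_eventually, rule eventually_mono[OF eventually_gt_at_top[of n]])
       (use x in \<open>simp add: transition_emb\<close>)
  finally show ?thesis .
qed

text \<open>Balls of the quotient norm are translated into eventual estimates by the limit superior
  formula; adherence to the union of the images then becomes the approximation criterion of
  \<open>cohI_approx\<close>.\<close>

lemma system_limit_eq: "system_limit A \<rho> = cls ` Collect coh"
proof -
  interpret S: normed_cspace S by (rule normed_cspace_seq_algebra)
  have U: "(\<Union>n. to_limit A \<rho> n ` carrier (A n)) = (\<Union>n. (\<lambda>u. cls (orbit n u)) ` img n)"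
    by (intro SUP_cong refl) (simp add: img_def image_image to_limit_eq)
  have orb: "cls (orbit n u) \<in> carrier S" if "u \<in> img n" for n u
    unfolding carrier_seq_algebra by (intro imageI CollectI bseq_R that)
  have "system_limit A \<rho> = {C \<in> carrier S. \<forall>r>0. \<exists>D \<in> (\<Union>n. (\<lambda>u. cls (orbit n u)) ` img n).
      D \<in> S.metric.mball C r}"
    unfolding system_limit_def norm_topology_def U by (rule S.metric.metric_closure_of)
  also have "\<dots> = {C \<in> carrier S. \<forall>r>0. \<exists>n. \<exists>u\<in>img n. norm_dist S C (cls (orbit n u)) < r}"
    by (rule Collect_cong) (simp add: orb cong: conj_cong bex_cong)
  also have "\<dots> = cls ` Collect coh"
  proof (intro Set.set_eqI iffI)
    fix C assume C: "C \<in> {C \<in> carrier S. \<forall>r>0. \<exists>n. \<exists>u\<in>img n. norm_dist S C (cls (orbit n u)) < r}"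
    then obtain a where a: "bseq a" "C = cls a"
      unfolding carrier_seq_algebra by blast
    have ball: "\<exists>n. \<exists>u\<in>img n. norm_dist S (cls a) (cls (orbit n u)) < r" if "r > 0" for r
      using C that unfolding a(2) by simp
    have "coh a"
    proof (rule cohI_approx[OF a(1)])
      fix \<epsilon> :: real assume "\<epsilon> > 0"
      then obtain n u where u: "u \<in> img n" "norm_dist S (cls a) (cls (orbit n u)) < \<epsilon>" using ball by blast
      then have "\<forall>\<^sub>F m in sequentially. norm (a m - orbit n u m) < \<epsilon>"
        using a(1) by (intro nrm_cls_lessD bseq_minus bseq_R) (simp_all add: norm_dist_seq_algebra bseq_R)
      then have "\<forall>\<^sub>F m in sequentially. norm (a m - transition m n u) < \<epsilon>"
        using eventually_ge_at_top[of n] by eventually_elim simp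
      with u(1) show "\<exists>k. \<exists>x\<in>img k. \<forall>\<^sub>F m in sequentially. norm (a m - transition m k x) < \<epsilon>" by blast
    qed
    then show "C \<in> cls ` Collect coh" using a(2) by blast
  next
    fix C assume "C \<in> cls ` Collect coh"
    then obtain a where a: "coh a" "C = cls a" by blast
    have "\<exists>n. \<exists>u\<in>img n. norm_dist S (cls a) (cls (orbit n u)) < r" if r: "r > 0" for r
    proof -
      obtain k where k: "\<forall>\<^sub>F m in sequentially. norm (a m - orbit k (a k) m) < r / 2"
        using orbit_approx[OF a(1) a(1) half_gt_zero[OF r]] by blast
      note ak = bseq_in[OF coh_bseq[OF a(1)], of k]
      have "nrm S (cls (\<lambda>m. a m - orbit k (a k) m)) \<le> r / 2"
        using k by (intro nrm_cls_le bseq_minus coh_bseq[OF a(1)] bseq_R[OF ak])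
          (auto elim: eventually_mono)
      then have "norm_dist S (cls a) (cls (orbit k (a k))) < r"
        using r by (simp add: norm_dist_seq_algebra coh_bseq[OF a(1)] bseq_R[OF ak])
      with ak show ?thesis by blast
    qed
    moreover have "C \<in> carrier S" using a coh_bseq by (auto simp: carrier_seq_algebra)
    ultimately show "C \<in> {C \<in> carrier S. \<forall>r>0. \<exists>n. \<exists>u\<in>img n. norm_dist S C (cls (orbit n u)) < r}"
      unfolding a(2) by simp
  qed
  finally show ?thesis .
qed

section \<open>The product on the limit\<close>

definition rep :: "(nat \<Rightarrow> 'a) set \<Rightarrow> nat \<Rightarrow> 'a multiplier" where
  "rep C = (SOME a. coh a \<and> cls a = C)"

definition prod_cls :: "(nat \<Rightarrow> 'a) set \<Rightarrow> (nat \<Rightarrow> 'a) set \<Rightarrow> (nat \<Rightarrow> 'a) set" where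
  "prod_cls C D = cls (lim_mult (rep C) (rep D))"

text \<open>Independence of the representatives that \<open>rep\<close> selects, by
  \<open>lim_mult_cong\<close>.\<close>

lemma prod_cls_eq:
  assumes "coh a" "coh b"
  shows "prod_cls (cls a) (cls b) = cls (lim_mult a b)"
proof -
  have rep: "coh (rep (cls c))" "(\<lambda>n. rep (cls c) n - c n) \<longlonglongrightarrow> 0" if c: "coh c" for c
  proof -
    have "coh (rep (cls c)) \<and> cls (rep (cls c)) = cls c"
      unfolding rep_def by (rule someI[of _ c]) (use c in simp)
    then show "coh (rep (cls c))" "(\<lambda>n. rep (cls c) n - c n) \<longlonglongrightarrow> 0"
      using c cls_eq_iff[OF coh_bseq coh_bseq] by blast+
  qed
  show ?thesis
    unfolding prod_cls_def
    by (rule cls_eqI, rule lim_mult_cong) (use rep assms in auto)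
qed

text \<open>The norms of the terms come below the norm of a class only with some slack
  \<open>d\<close>, which tends to 0 at the end.\<close>

lemma nrm_prod_cls_le:
  assumes "coh a" "coh b"
  shows "nrm S (cls (lim_mult a b)) \<le> nrm S (cls a) * nrm S (cls b)"
proof -
  define s t where "s = nrm S (cls a)" and "t = nrm S (cls b)"
  have "\<forall>\<^sub>F d in at_right 0. nrm S (cls (lim_mult a b)) \<le> (s + d) * (t + d) + d"
    using eventually_at_right_less[of 0]
  proof eventually_elim
    case (elim d)
    have "\<forall>\<^sub>F n in sequentially. norm (lim_mult a b n) < (s + d) * (t + d) + d"
      using assms elim
      by (intro lim_mult_norm) (simp_all add: s_def t_def nrm_cls_eventually coh_bseq)
    then show ?case
      by (intro nrm_cls_le bseq_lim_mult assms) (auto elim: eventually_mono)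
  qed
  moreover have "((\<lambda>d. (s + d) * (t + d) + d) \<longlongrightarrow> (s + 0) * (t + 0) + 0) (at_right 0)"
    by (intro tendsto_intros)
  ultimately have "nrm S (cls (lim_mult a b)) \<le> (s + 0) * (t + 0) + 0"
    by (intro tendsto_lowerbound) auto
  then show ?thesis by (simp add: s_def t_def)
qed

lemma nrm_adj_le:
  assumes "coh a"
  shows "nrm S (cls (\<lambda>n. adj (a n))) \<le> nrm S (cls a)"
  using nrm_cls_eventually[OF coh_bseq[OF assms]]
  by (intro nrm_cls_leI) (simp_all add: coh_bseq coh_adj assms)

text \<open>One inequality is submultiplicativity. For the other, any \<open>c\<close> above
  \<open>sqrt t\<close> leaves room for an \<open>r\<close> in between;
  \<open>lim_mult_cstar\<close> with the bound \<open>r\<^sup>2\<close> and slack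
  \<open>c - r\<close> gives the bound \<open>c\<close>.\<close>

lemma nrm_prod_cls_cstar:
  assumes a: "coh a"
  shows "nrm S (cls (lim_mult (\<lambda>n. adj (a n)) a)) = (nrm S (cls a))\<^sup>2"
proof (rule antisym)
  note ba = coh_bseq[OF a] and bl = bseq_lim_mult[OF coh_adj[OF a] a]
  define t where "t = nrm S (cls (lim_mult (\<lambda>n. adj (a n)) a))"
  have t0: "t \<ge> 0" unfolding t_def by (rule nrm_cls_nonneg[OF bl])
  have "t \<le> nrm S (cls (\<lambda>n. adj (a n))) * nrm S (cls a)"
    unfolding t_def by (rule nrm_prod_cls_le[OF coh_adj[OF a] a])
  also have "\<dots> \<le> nrm S (cls a) * nrm S (cls a)"
    by (intro mult_right_mono nrm_adj_le a nrm_cls_nonneg ba)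
  finally show "nrm S (cls (lim_mult (\<lambda>n. adj (a n)) a)) \<le> (nrm S (cls a))\<^sup>2"
    by (simp add: t_def power2_eq_square)
  have "nrm S (cls a) \<le> sqrt t"
  proof (rule dense_ge)
    fix c assume c: "sqrt t < c"
    define r where "r = (sqrt t + c) / 2"
    have r: "sqrt t < r" "r < c" using c by (simp_all add: r_def)
    have r0: "r > 0" using r(1) real_sqrt_ge_zero[OF t0] by linarith
    have "t < r\<^sup>2" using r(1) r0 t0 by (metis less_le_trans not_less order_less_imp_le real_le_rsqrt)
    then have "\<forall>\<^sub>F n in sequentially. norm (lim_mult (\<lambda>n. adj (a n)) a n) \<le> r\<^sup>2"
      using nrm_cls_lessD[OF bl, of "r\<^sup>2"] by (auto simp: t_def elim: eventually_mono)
    from lim_mult_cstar[OF a this, of "c - r"] r r0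
    have "\<forall>\<^sub>F n in sequentially. norm (a n) < c" by simp
    then show "nrm S (cls a) \<le> c" by (intro nrm_cls_le ba) (auto elim: eventually_mono)
  qed
  then have "(nrm S (cls a))\<^sup>2 \<le> (sqrt t)\<^sup>2" by (intro power_mono nrm_cls_nonneg ba)
  then show "(nrm S (cls a))\<^sup>2 \<le> nrm S (cls (lim_mult (\<lambda>n. adj (a n)) a))"
    using t0 by (simp add: t_def)
qed

section \<open>The limit as a complete normed space\<close>

lemma coh_zero: "coh (\<lambda>_. 0)"
  using coh_cscale[OF coh_R[OF zero_in[of 0]], of 0] by simp

abbreviation (input) L :: "(nat \<Rightarrow> 'a) set cstar" where
  "L \<equiv> S\<lparr>carrier := cls ` Collect coh, monoid.mult := prod_cls\<rparr>"

lemma normed_cspace_limit: "normed_cspace L"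
  by (rule normed_cspace_cls) (auto simp: coh_bseq coh_zero coh_add coh_cscale)

lemma norm_dist_limit:
  assumes "coh a" "coh b"
  shows "norm_dist L (cls a) (cls b) = nrm S (cls (\<lambda>n. a n - b n))"
  by (rule norm_dist_cls) (use assms in \<open>auto simp: coh_bseq coh_zero coh_add coh_cscale\<close>)

text \<open>The diagonal sequence of coherent representatives is a limit in the sequence algebra. It
  is again coherent, since an orbit near one of the representatives is near the diagonal
  sequence.\<close>

lemma mcomplete_limit: "Metric_space.mcomplete (carrier L) (norm_dist L)"
proof -
  interpret L: normed_cspace L by (rule normed_cspace_limit)
  have "\<exists>C. limitin L.metric.mtopology F C sequentially" if F: "L.metric.MCauchy F" for F
  proof -
    have "F n \<in> carrier L" for n
      using F unfolding L.metric.MCauchy_def by blast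
    then have "\<exists>a. coh a \<and> F n = cls a" for n
      by (auto simp: image_iff)
    then obtain a where a: "\<And>n. coh (a n)" "\<And>n. F n = cls (a n)" by metis
    note ba = coh_bseq[OF a(1)]
    have "\<exists>c. bseq c \<and> (\<forall>\<epsilon>>0. \<exists>J. \<forall>j\<ge>J. \<forall>\<^sub>F m in sequentially. norm (c m - a j m) < \<epsilon>)"
    proof (rule diagonal_sequence[OF ba])
      fix \<epsilon> :: real assume "\<epsilon> > 0"
      then obtain J where J: "\<And>i j. i \<ge> J \<Longrightarrow> j \<ge> J \<Longrightarrow> norm_dist L (F i) (F j) < \<epsilon>"
        using F unfolding L.metric.MCauchy_def by metis
      have "\<forall>\<^sub>F m in sequentially. norm (a i m - a j m) < \<epsilon>" if "i \<ge> J" "j \<ge> J" for i j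
        using J[OF that] a by (intro nrm_cls_lessD bseq_minus ba) (simp add: norm_dist_limit)
      then show "\<exists>J. \<forall>i\<ge>J. \<forall>j\<ge>J. \<forall>\<^sub>F m in sequentially. norm (a i m - a j m) < \<epsilon>" by blast
    qed
    then obtain c where c: "bseq c"
      and lim: "\<And>\<epsilon>. \<epsilon> > 0 \<Longrightarrow> \<exists>J. \<forall>j\<ge>J. \<forall>\<^sub>F m in sequentially. norm (c m - a j m) < \<epsilon>" by blast
    have "coh c"
    proof (rule cohI_approx[OF c])
      fix \<epsilon> :: real assume "\<epsilon> > 0"
      then have \<epsilon>: "\<epsilon> / 2 > 0" by simp
      obtain j where j: "\<forall>\<^sub>F m in sequentially. norm (c m - a j m) < \<epsilon> / 2" using lim[OF \<epsilon>] by blast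
      obtain k x where x: "x \<in> img k" "\<forall>\<^sub>F m in sequentially. norm (a j m - transition m k x) < \<epsilon> / 2"
        using a(1)[of j] \<epsilon> unfolding coh_iff by blast
      have "\<forall>\<^sub>F m in sequentially. norm (c m - transition m k x) < \<epsilon>"
        using j x(2)
      proof eventually_elim
        case (elim m)
        then show ?case using norm_triangle_ineq[of "c m - a j m" "a j m - transition m k x"] by simp
      qed
      with x(1) show "\<exists>k. \<exists>x\<in>img k. \<forall>\<^sub>F m in sequentially. norm (c m - transition m k x) < \<epsilon>" by blast
    qed
    have "\<exists>N. \<forall>n\<ge>N. F n \<in> carrier L \<and> norm_dist L (F n) (cls c) < \<epsilon>" if "\<epsilon> > 0" for \<epsilon>
    proof -
      have "\<epsilon> / 2 > 0" using that by simp
      from lim[OF this] obtain J where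
        J: "\<And>j. j \<ge> J \<Longrightarrow> \<forall>\<^sub>F m in sequentially. norm (c m - a j m) < \<epsilon> / 2" by blast
      have "norm_dist L (F j) (cls c) < \<epsilon>" if "j \<ge> J" for j
      proof -
        have "nrm S (cls (\<lambda>m. a j m - c m)) \<le> \<epsilon> / 2"
          using J[OF that] by (intro nrm_cls_le bseq_minus ba c)
            (auto simp: norm_minus_commute elim: eventually_mono)
        then show ?thesis using a \<open>coh c\<close> \<open>\<epsilon> > 0\<close> by (simp add: norm_dist_limit)
      qed
      then show ?thesis using a by auto
    qed
    then have "limitin L.metric.mtopology F (cls c) sequentially"
      unfolding L.metric.limit_metric_sequentially using \<open>coh c\<close> by auto
    then show ?thesis by blast
  qed
  then show ?thesis unfolding L.metric.mcomplete_def by blast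
qed

lemma bilinear_on_limit: "bilinear_on S (cls ` Collect coh) prod_cls"
  unfolding bilinear_on_def
  by (auto simp: prod_cls_eq add_seq_algebra smult_seq_algebra coh_bseq coh_add coh_cscale coh_lim_mult
      bseq_lim_mult intro!: imageI cls_eqI lim_mult_add_left lim_mult_add_right lim_mult_cscale_left
      lim_mult_cscale_right)

lemma prod_cls_assoc:
  assumes "a \<in> cls ` Collect coh" "b \<in> cls ` Collect coh" "c \<in> cls ` Collect coh"
  shows "prod_cls (prod_cls a b) c = prod_cls a (prod_cls b c)"
proof -
  obtain u v w where "coh u" "coh v" "coh w" "a = cls u" "b = cls v" "c = cls w"
    using assms by blast
  then show ?thesis
    by (simp add: prod_cls_eq coh_lim_mult cls_eqI[OF lim_mult_assoc])
qed

lemma cstar_algebra_limit: "cstar_algebra L"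
proof (intro cstar_algebra.intro cstar_algebra_axioms.intro)
  interpret L: normed_cspace L by (rule normed_cspace_limit)
  note bil = bilinear_on_limit[unfolded bilinear_on_def]
  note closed = bil[THEN conjunct1, rule_format]
    and add = bil[THEN conjunct2, THEN conjunct1, rule_format]
    and smult = bil[THEN conjunct2, THEN conjunct2, rule_format]
  show "Module.module (ring_of_type_algebra :: complex ring) L" by unfold_locales
  note ops = prod_cls_eq add_seq_algebra smult_seq_algebra star_seq_algebra coh_bseq coh_add coh_cscale
    coh_lim_mult bseq_lim_mult coh_adj
  show "0 \<le> nrm L x" if "x \<in> carrier L" for x by (rule L.nrm_nonneg[OF that])
  show "nrm L x = 0 \<longleftrightarrow> x = \<zero>\<^bsub>L\<^esub>" if "x \<in> carrier L" for x by (rule L.nrm_eq_0_iff[OF that])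
  show "nrm L (x \<oplus>\<^bsub>L\<^esub> y) \<le> nrm L x + nrm L y" if "x \<in> carrier L" "y \<in> carrier L" for x y
    by (rule L.nrm_triangle[OF that])
  show "nrm L (c \<odot>\<^bsub>L\<^esub> x) = cmod c * nrm L x" if "x \<in> carrier L" for c x by (rule L.nrm_smult[OF that])
  show "Metric_space.mcomplete (carrier L) (norm_dist L)" by (rule mcomplete_limit)
  show "x \<otimes>\<^bsub>L\<^esub> y \<in> carrier L" if "x \<in> carrier L" "y \<in> carrier L" for x y
    using that by (simp add: closed)
  show "(x \<otimes>\<^bsub>L\<^esub> y) \<otimes>\<^bsub>L\<^esub> z = x \<otimes>\<^bsub>L\<^esub> (y \<otimes>\<^bsub>L\<^esub> z)"
    if "x \<in> carrier L" "y \<in> carrier L" "z \<in> carrier L" for x y z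
    using prod_cls_assoc that by simp
  show "(x \<oplus>\<^bsub>L\<^esub> y) \<otimes>\<^bsub>L\<^esub> z = (x \<otimes>\<^bsub>L\<^esub> z) \<oplus>\<^bsub>L\<^esub> (y \<otimes>\<^bsub>L\<^esub> z)"
    "x \<otimes>\<^bsub>L\<^esub> (y \<oplus>\<^bsub>L\<^esub> z) = (x \<otimes>\<^bsub>L\<^esub> y) \<oplus>\<^bsub>L\<^esub> (x \<otimes>\<^bsub>L\<^esub> z)"
    if "x \<in> carrier L" "y \<in> carrier L" "z \<in> carrier L" for x y z
    using that by (simp_all add: add)
  show "(c \<odot>\<^bsub>L\<^esub> x) \<otimes>\<^bsub>L\<^esub> y = c \<odot>\<^bsub>L\<^esub> (x \<otimes>\<^bsub>L\<^esub> y)" "x \<otimes>\<^bsub>L\<^esub> (c \<odot>\<^bsub>L\<^esub> y) = c \<odot>\<^bsub>L\<^esub> (x \<otimes>\<^bsub>L\<^esub> y)"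
    if "x \<in> carrier L" "y \<in> carrier L" for c x y
    using that by (simp_all add: smult)
  show "star L x \<in> carrier L" "star L (star L x) = x" if "x \<in> carrier L" for x
    using that by (auto simp: ops intro!: imageI)
  show "star L (x \<oplus>\<^bsub>L\<^esub> y) = star L x \<oplus>\<^bsub>L\<^esub> star L y" if "x \<in> carrier L" "y \<in> carrier L" for x y
    using that by (auto simp: ops bseq_add bseq_adj adj_add)
  show "star L (c \<odot>\<^bsub>L\<^esub> x) = cnj c \<odot>\<^bsub>L\<^esub> star L x" if "x \<in> carrier L" for c x
    using that by (auto simp: ops bseq_cscale bseq_adj adj_cscale_mult)
  show "star L (x \<otimes>\<^bsub>L\<^esub> y) = star L y \<otimes>\<^bsub>L\<^esub> star L x" if "x \<in> carrier L" "y \<in> carrier L" for x y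
  proof -
    obtain a b where "coh a" "coh b" "x = cls a" "y = cls b" using \<open>x \<in> carrier L\<close> \<open>y \<in> carrier L\<close> by auto
    then show ?thesis by (simp add: ops cls_eqI[OF lim_mult_adj])
  qed
  show "nrm L (x \<otimes>\<^bsub>L\<^esub> y) \<le> nrm L x * nrm L y" if "x \<in> carrier L" "y \<in> carrier L" for x y
    using that by (auto simp: ops nrm_prod_cls_le)
  show "nrm L (star L x \<otimes>\<^bsub>L\<^esub> x) = (nrm L x)\<^sup>2" if "x \<in> carrier L" for x
    using that by (auto simp: ops nrm_prod_cls_cstar)
qed

text \<open>For \<open>a\<close> and \<open>b\<close> the orbits of \<open>x\<close> and
  \<open>y\<close>, the sequence on the left is, from \<open>n = k\<close> on, the class of the
  orbit of \<open>a n * b n\<close>; its convergence is \<open>is_lim_lim_mult\<close> read in the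
  quotient norm.\<close>

lemma prod_cls_to_limit:
  assumes x: "x \<in> carrier (A k)" and y: "y \<in> carrier (A k)"
  shows "limitin (norm_topology S)
     (\<lambda>n. to_limit A \<rho> n (conn \<rho> n k x \<otimes>\<^bsub>A n\<^esub> conn \<rho> n k y))
     (prod_cls (to_limit A \<rho> k x) (to_limit A \<rho> k y)) sequentially"
proof -
  interpret S: normed_cspace S by (rule normed_cspace_seq_algebra)
  define a where "a = orbit k (emb (A k) x)"
  define b where "b = orbit k (emb (A k) y)"
  have ab: "coh a" "coh b" unfolding a_def b_def by (rule coh_R[OF emb_in[OF x]], rule coh_R[OF emb_in[OF y]])
  note bl = bseq_lim_mult[OF ab]
  have lim: "prod_cls (to_limit A \<rho> k x) (to_limit A \<rho> k y) = cls (lim_mult a b)"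
    using x y ab by (simp add: to_limit_eq prod_cls_eq flip: a_def b_def)
  have in': "a n * b n \<in> img n" for n
    by (rule bseq_mult_in[OF coh_bseq[OF ab(1)] coh_bseq[OF ab(2)]])
  have seq: "to_limit A \<rho> n (conn \<rho> n k x \<otimes>\<^bsub>A n\<^esub> conn \<rho> n k y) = cls (orbit n (a n * b n))" if "k \<le> n" for n
  proof -
    have "emb (A n) (conn \<rho> n k x \<otimes>\<^bsub>A n\<^esub> conn \<rho> n k y) = a n * b n"
      using x y that by (simp add: a_def b_def transition_emb alg.emb_mult conn_closed)
    then show ?thesis
      by (simp only: to_limit_eq[OF alg.mult_closed[OF conn_closed[OF that x] conn_closed[OF that y]]])
  qed
  have "\<exists>N. \<forall>n\<ge>N. to_limit A \<rho> n (conn \<rho> n k x \<otimes>\<^bsub>A n\<^esub> conn \<rho> n k y) \<in> carrier S \<and>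
      norm_dist S (to_limit A \<rho> n (conn \<rho> n k x \<otimes>\<^bsub>A n\<^esub> conn \<rho> n k y)) (cls (lim_mult a b)) < \<epsilon>"
    if \<epsilon>: "\<epsilon> > 0" for \<epsilon>
  proof -
    have "\<forall>\<^sub>F n in sequentially. \<forall>\<^sub>F m in sequentially. norm (lim_mult a b m - transition m n (a n * b n)) < \<epsilon> / 2"
      using is_lim_lim_mult[OF ab] half_gt_zero[OF \<epsilon>] unfolding is_lim_iff by blast
    then have "\<forall>\<^sub>F n in sequentially. k \<le> n \<and>
        (\<forall>\<^sub>F m in sequentially. norm (lim_mult a b m - transition m n (a n * b n)) < \<epsilon> / 2)"
      by (rule eventually_conj[OF eventually_ge_at_top])
    then obtain N where N: "\<And>n. n \<ge> N \<Longrightarrow> k \<le> n"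
      "\<And>n. n \<ge> N \<Longrightarrow> \<forall>\<^sub>F m in sequentially. norm (lim_mult a b m - transition m n (a n * b n)) < \<epsilon> / 2"
      unfolding eventually_sequentially[where P = "\<lambda>n. k \<le> n \<and> _ n"] by blast
    have "cls (orbit n (a n * b n)) \<in> carrier S \<and>
        norm_dist S (cls (orbit n (a n * b n))) (cls (lim_mult a b)) < \<epsilon>" if "n \<ge> N" for n
    proof -
      have "\<forall>\<^sub>F m in sequentially. norm (orbit n (a n * b n) m - lim_mult a b m) \<le> \<epsilon> / 2"
        using N(2)[OF that] eventually_ge_at_top[of n]
        by eventually_elim (simp add: norm_minus_commute)
      then have "nrm S (cls (\<lambda>m. orbit n (a n * b n) m - lim_mult a b m)) \<le> \<epsilon> / 2"
        by (intro nrm_cls_le bseq_minus bseq_R in' bl)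
      then show ?thesis
        using \<epsilon> bseq_R[OF in'] bl by (simp add: norm_dist_seq_algebra carrier_seq_algebra)
    qed
    then show ?thesis using N(1) seq by (intro exI[of _ N]) simp
  qed
  moreover have "cls (lim_mult a b) \<in> carrier S" using bl by (simp add: carrier_seq_algebra)
  ultimately show ?thesis
    unfolding lim norm_topology_def S.metric.limit_metric_sequentially by blast
qed

end

theorem proposition2p8:
  fixes A :: "nat \<Rightarrow> 'a cstar" and \<rho> :: "nat \<Rightarrow> 'a \<Rightarrow> 'a"
  assumes "cstar_encoding_system A \<rho>"
  shows "\<exists>f :: (nat \<Rightarrow> 'a) set \<Rightarrow> (nat \<Rightarrow> 'a) set \<Rightarrow> (nat \<Rightarrow> 'a) set.
    bilinear_on (seq_algebra A) (system_limit A \<rho>) f \<and>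
    (\<forall>a\<in>system_limit A \<rho>. \<forall>b\<in>system_limit A \<rho>. \<forall>c\<in>system_limit A \<rho>.
       f (f a b) c = f a (f b c)) \<and>
    (\<forall>k. \<forall>x\<in>carrier (A k). \<forall>y\<in>carrier (A k).
       limitin (norm_topology (seq_algebra A))
         (\<lambda>n. to_limit A \<rho> n (conn \<rho> n k x \<otimes>\<^bsub>A n\<^esub> conn \<rho> n k y))
         (f (to_limit A \<rho> k x) (to_limit A \<rho> k y)) sequentially) \<and>
    cstar_algebra ((seq_algebra A)\<lparr>carrier := system_limit A \<rho>, monoid.mult := f\<rparr>)"
proof -
  interpret cstar_encoding_system A \<rho> by (fact assms)
  show ?thesis
    unfolding system_limit_eq
    using bilinear_on_limit prod_cls_assoc prod_cls_to_limit cstar_algebra_limit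
    by (intro exI[of _ prod_cls]) blast
qed

end
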